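(* Let $(M,g)$ be a pseudo Riemannian manifold and let $\lambda=\pm1$, $\ell=\pm1$. Integrable $(\lambda,\ell)$-structures on $(M,g)$ interpolate between integrable $(\lambda,0)$- and $(0,\ell)$-structures on $(M,g)$ in the following sense: if $$R=\begin{pmatrix} s & 0\\ 0 & t\end{pmatrix}\qquad\text{and}\qquad Q=\begin{pmatrix} 0 & p\\ \omega^{\flat} & 0\end{pmatrix}$$ (block form with respect to $\mathbb{T}M=TM\oplus TM^{*}$, where $\omega$ is a bilinear form on $TM$, i.e. a smooth tensor field of type $(0,2)$) are integrable $(\lambda,\ell)$-structures on $(M,g)$, then $s$ is an integrable $(\lambda,0)$-structure on $(M,g)$ and $\omega$ is an integrable $(0,\ell)$-structure on $(M,g)$.
   Context: All objects are smooth. For a bilinear form $c$ on $V$, $c^{\flat}:V\to V^{*}$ is $c^{\flat}(u)(v)=c(u,v)$. Extended tangent bundle: $\mathbb{T}M=TM\oplus TM^{*}$ with the split metric $b(u+\sigma,v+\tau)=\tau(u)+\sigma(v)$ and the Courant bracket $[u+\sigma,v+\tau]=[u,v]+\mathcal{L}_u\tau-\mathcal{L}_v\sigma-\tfrac12 d(\tau(u)-\sigma(v))$ on smooth sections. A real linear isomorphism $S$ with $S^2=\lambda\,\mathrm{id}$ ($\lambda=\pm1$) is split if $\operatorname{tr}S=0$ (automatic for $\lambda=-1$). A generalized complex structure (for $\lambda=-1$), respectively generalized paracomplex structure (for $\lambda=1$), on $M$ is a smooth section $S$ of $\mathrm{End}(\mathbb{T}M)$ such that $S^2=\lambda\,\mathrm{id}$,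 $S$ is split, $S$ is skew-symmetric for $b$, and the smooth sections of each $\pm\sqrt{\lambda}$-eigenbundle of $S$ are closed under the Courant bracket (for $\lambda=-1$, in the complexification of $\mathbb{T}M$ with the $\mathbb{C}$-linearly extended bracket). For $k=\pm1$ let $I_k=\begin{pmatrix}0 & k(g^{\flat})^{-1}\\ g^{\flat} & 0\end{pmatrix}$ on $\mathbb{T}M$. For $\lambda,\ell=\pm1$, an integrable $(\lambda,\ell)$-structure on $(M,g)$ is a generalized complex structure $S$ (if $\lambda=-1$) or generalized paracomplex structure $S$ (if $\lambda=1$) on $M$ with $SI_k=-I_kS$, where $k=-\lambda\ell$. Extremal structures: - An integrable $(1,0)$-structure on $(M,g)$ is a tensor field $r$ of type $(1,1)$ with $r^2=\mathrm{id}$, whose eigendistributions for the eigenvalues $\pm1$ are integrable, and which is symmetric with respect to $g$ (the cases $r=\pm\mathrm{id}$ are allowed). - An integrable $(-1,0)$-structure is a complex structure $j$ on $M$ (integrable almost complex structure) which is symmetric with respect to $g$. - An integrable $(0,1)$-structure is a symplectic form $\omega$ on $M$ such that $r^2=\mathrm{id}$, where $r$ is the tensor field with $\omega(\cdot,\cdot)=g(r\cdot,\cdot)$. - An integrable $(0,-1)$-structure is a symplectic form $\omega$ on $M$ such that $j^2=-\mathrm{id}$, where $j$ is the tensor field with $\omega(\cdot,\cdot)=g(j\cdot,\cdot)$. *)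

theory Defs
  imports "HOL-Analysis.Analysis"
begin

section \<open>Smooth maps and smooth manifolds\<close>

(* C^k on an open subset of a Euclidean space: since the domain is finite-dimensional, it suffices
   that all directional derivatives x |-> Df(x)v are C^(k-1). *)
primrec Ck_on :: "nat \<Rightarrow> 'a::euclidean_space set \<Rightarrow> ('a \<Rightarrow> 'b::real_normed_vector) \<Rightarrow> bool" where
  "Ck_on 0 S f \<longleftrightarrow> continuous_on S f"
| "Ck_on (Suc k) S f \<longleftrightarrow> (\<forall>x\<in>S. f differentiable (at x)) \<and>
     (\<forall>v. Ck_on k S (\<lambda>x. frechet_derivative f (at x) v))"

definition smooth_on :: "'a::euclidean_space set \<Rightarrow> ('a \<Rightarrow> 'b::real_normed_vector) \<Rightarrow> bool" where
  "smooth_on S f \<longleftrightarrow> (\<forall>k. Ck_on k S f)"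

(* A chart is a pair (domain, coordinate map). *)
type_synonym ('m, 'e) chart = "'m set \<times> ('m \<Rightarrow> 'e)"

definition chart_inv :: "('m, 'e) chart \<Rightarrow> 'e \<Rightarrow> 'm" where
  "chart_inv c = inv_into (fst c) (snd c)"

(* A smooth manifold is the whole type 'm (Hausdorff and second countable through its type class)
   with a smooth atlas A, not necessarily maximal. *)
definition smooth_atlas ::
    "('m::{t2_space,second_countable_topology}, 'e::euclidean_space) chart set \<Rightarrow> bool" where
  "smooth_atlas A \<longleftrightarrow>
     (\<Union>c\<in>A. fst c) = UNIV \<and>
     (\<forall>c\<in>A. open (fst c) \<and> open (snd c ` fst c) \<and>
        homeomorphism (fst c) (snd c ` fst c) (snd c) (chart_inv c)) \<and>
     (\<forall>c\<in>A. \<forall>c'\<in>A. smooth_on (snd c ` (fst c \<inter> fst c')) (snd c' \<circ> chart_inv c))"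

section \<open>Tangent, cotangent and extended tangent spaces\<close>

(* Every point p gets a preferred chart around it, and a tangent vector at p is represented by its
   components in that chart. Thus T_pM is the type 'e, T_pM* is 'e =>L real, and the fibre at p of
   TM + TM* is 'e gtan. Bilinear forms on T_pM are elements c of 'e =>L 'e =>L real; in this curried
   form, c is its own flat map T_pM -> T_pM*. The preferred charts vary discontinuously with p, so
   smoothness of a field is always tested on its local expressions in the charts of A, defined
   below. *)
definition chart_at :: "('m, 'e) chart set \<Rightarrow> 'm \<Rightarrow> ('m, 'e) chart" where
  "chart_at A p = (SOME c. c \<in> A \<and> p \<in> fst c)"

type_synonym 'e cotan = "'e \<Rightarrow>\<^sub>L real"
type_synonym 'e gtan = "'e \<times> ('e \<Rightarrow>\<^sub>L real)"

definition coord_change :: "('m, 'e::euclidean_space) chart \<Rightarrow> ('m, 'e) chart \<Rightarrow> 'm \<Rightarrow> 'e \<Rightarrow>\<^sub>L 'e" where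
  "coord_change c c' p = Blinfun (frechet_derivative (snd c' \<circ> chart_inv c) (at (snd c p)))"

definition to_chart :: "('m, 'e::euclidean_space) chart set \<Rightarrow> ('m, 'e) chart \<Rightarrow> 'm \<Rightarrow> 'e \<Rightarrow>\<^sub>L 'e" where
  "to_chart A c p = coord_change (chart_at A p) c p"

definition from_chart :: "('m, 'e::euclidean_space) chart set \<Rightarrow> ('m, 'e) chart \<Rightarrow> 'm \<Rightarrow> 'e \<Rightarrow>\<^sub>L 'e" where
  "from_chart A c p = coord_change c (chart_at A p) p"

lift_definition dual_map ::
    "('a::real_normed_vector \<Rightarrow>\<^sub>L 'b::real_normed_vector) \<Rightarrow> 'b cotan \<Rightarrow>\<^sub>L 'a cotan"
  is "\<lambda>B \<sigma>. \<sigma> o\<^sub>L B"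
  by (rule bounded_bilinear.bounded_linear_left[OF bounded_bilinear_blinfun_compose])

(* The block matrix (B11, B12; B21, B22) acting on column vectors. *)
definition block :: "('a::real_normed_vector \<Rightarrow>\<^sub>L 'a) \<Rightarrow> ('b::real_normed_vector \<Rightarrow>\<^sub>L 'a) \<Rightarrow>
    ('a \<Rightarrow>\<^sub>L 'b) \<Rightarrow> ('b \<Rightarrow>\<^sub>L 'b) \<Rightarrow> ('a \<times> 'b) \<Rightarrow>\<^sub>L ('a \<times> 'b)" where
  "block B11 B12 B21 B22 = Blinfun (\<lambda>(u, \<sigma>). (B11 u + B12 \<sigma>, B21 u + B22 \<sigma>))"

lemma block_apply [simp]:
  "blinfun_apply (block B11 B12 B21 B22) (u, \<sigma>) = (B11 u + B12 \<sigma>, B21 u + B22 \<sigma>)"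
proof -
  have "bounded_linear (\<lambda>(u, \<sigma>). (B11 u + B12 \<sigma>, B21 u + B22 \<sigma>))"
    unfolding case_prod_unfold
    by (intro bounded_linear_Pair bounded_linear_add
        bounded_linear_compose[OF blinfun.bounded_linear_right]
        bounded_linear_fst bounded_linear_snd)
  then show ?thesis
    unfolding block_def by (simp add: bounded_linear_Blinfun_apply)
qed

section \<open>Local expressions and smoothness of tensor fields\<close>

(* These are functions on the coordinate image snd c ` fst c of the chart c. *)

definition vec_in_chart :: "('m, 'e::euclidean_space) chart set \<Rightarrow> ('m, 'e) chart \<Rightarrow>
    ('m \<Rightarrow> 'e) \<Rightarrow> 'e \<Rightarrow> 'e" where
  "vec_in_chart A c X x = (let q = chart_inv c x in to_chart A c q (X q))"

definition covec_in_chart :: "('m, 'e::euclidean_space) chart set \<Rightarrow> ('m, 'e) chart \<Rightarrow>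
    ('m \<Rightarrow> 'e cotan) \<Rightarrow> 'e \<Rightarrow> 'e cotan" where
  "covec_in_chart A c \<sigma> x = (let q = chart_inv c x in dual_map (from_chart A c q) (\<sigma> q))"

definition bilin_in_chart :: "('m, 'e::euclidean_space) chart set \<Rightarrow> ('m, 'e) chart \<Rightarrow>
    ('m \<Rightarrow> 'e \<Rightarrow>\<^sub>L 'e cotan) \<Rightarrow> 'e \<Rightarrow> 'e \<Rightarrow>\<^sub>L 'e cotan" where
  "bilin_in_chart A c w x =
     (let q = chart_inv c x in dual_map (from_chart A c q) o\<^sub>L w q o\<^sub>L from_chart A c q)"

definition endo_in_chart :: "('m, 'e::euclidean_space) chart set \<Rightarrow> ('m, 'e) chart \<Rightarrow>
    ('m \<Rightarrow> 'e \<Rightarrow>\<^sub>L 'e) \<Rightarrow> 'e \<Rightarrow> 'e \<Rightarrow>\<^sub>L 'e" where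
  "endo_in_chart A c r x =
     (let q = chart_inv c x in to_chart A c q o\<^sub>L r q o\<^sub>L from_chart A c q)"

definition gvec_in_chart :: "('m, 'e::euclidean_space) chart set \<Rightarrow> ('m, 'e) chart \<Rightarrow>
    ('m \<Rightarrow> 'e gtan) \<Rightarrow> 'e \<Rightarrow> 'e gtan" where
  "gvec_in_chart A c e x = (vec_in_chart A c (fst \<circ> e) x, covec_in_chart A c (snd \<circ> e) x)"

definition gendo_in_chart :: "('m, 'e::euclidean_space) chart set \<Rightarrow> ('m, 'e) chart \<Rightarrow>
    ('m \<Rightarrow> 'e gtan \<Rightarrow>\<^sub>L 'e gtan) \<Rightarrow> 'e \<Rightarrow> 'e gtan \<Rightarrow>\<^sub>L 'e gtan" where
  "gendo_in_chart A c S x =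
     (let q = chart_inv c x in
        block (to_chart A c q) 0 0 (dual_map (from_chart A c q)) o\<^sub>L S q o\<^sub>L
        block (from_chart A c q) 0 0 (dual_map (to_chart A c q)))"

definition smooth_vec :: "('m, 'e::euclidean_space) chart set \<Rightarrow> ('m \<Rightarrow> 'e) \<Rightarrow> bool" where
  "smooth_vec A X \<longleftrightarrow> (\<forall>c\<in>A. smooth_on (snd c ` fst c) (vec_in_chart A c X))"

definition smooth_bilin :: "('m, 'e::euclidean_space) chart set \<Rightarrow> ('m \<Rightarrow> 'e \<Rightarrow>\<^sub>L 'e cotan) \<Rightarrow> bool" where
  "smooth_bilin A w \<longleftrightarrow> (\<forall>c\<in>A. smooth_on (snd c ` fst c) (bilin_in_chart A c w))"

definition smooth_endo :: "('m, 'e::euclidean_space) chart set \<Rightarrow> ('m \<Rightarrow> 'e \<Rightarrow>\<^sub>L 'e) \<Rightarrow> bool" where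
  "smooth_endo A r \<longleftrightarrow> (\<forall>c\<in>A. smooth_on (snd c ` fst c) (endo_in_chart A c r))"

definition smooth_gvec :: "('m, 'e::euclidean_space) chart set \<Rightarrow> ('m \<Rightarrow> 'e gtan) \<Rightarrow> bool" where
  "smooth_gvec A e \<longleftrightarrow> (\<forall>c\<in>A. smooth_on (snd c ` fst c) (gvec_in_chart A c e))"

definition smooth_gendo ::
    "('m, 'e::euclidean_space) chart set \<Rightarrow> ('m \<Rightarrow> 'e gtan \<Rightarrow>\<^sub>L 'e gtan) \<Rightarrow> bool" where
  "smooth_gendo A S \<longleftrightarrow> (\<forall>c\<in>A. smooth_on (snd c ` fst c) (gendo_in_chart A c S))"

section \<open>Differential operators\<close>

(* All values at p are computed in the preferred chart at p, whose components represent T_pM. *)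

definition lie_bracket :: "('m, 'e::euclidean_space) chart set \<Rightarrow>
    ('m \<Rightarrow> 'e) \<Rightarrow> ('m \<Rightarrow> 'e) \<Rightarrow> 'm \<Rightarrow> 'e" where
  "lie_bracket A X Y p =
     (let c = chart_at A p; x = snd c p; X' = vec_in_chart A c X; Y' = vec_in_chart A c Y
      in frechet_derivative Y' (at x) (X' x) - frechet_derivative X' (at x) (Y' x))"

(* (L_X tau)(w) = (D_X tau)(w) + tau(D_w X) *)
definition lie_derivative :: "('m, 'e::euclidean_space) chart set \<Rightarrow>
    ('m \<Rightarrow> 'e) \<Rightarrow> ('m \<Rightarrow> 'e cotan) \<Rightarrow> 'm \<Rightarrow> 'e cotan" where
  "lie_derivative A X \<tau> p =
     (let c = chart_at A p; x = snd c p; X' = vec_in_chart A c X; \<tau>' = covec_in_chart A c \<tau>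
      in frechet_derivative \<tau>' (at x) (X' x) + (\<tau>' x o\<^sub>L Blinfun (frechet_derivative X' (at x))))"

definition differential :: "('m, 'e::euclidean_space) chart set \<Rightarrow> ('m \<Rightarrow> real) \<Rightarrow> 'm \<Rightarrow> 'e cotan" where
  "differential A f p =
     (let c = chart_at A p in Blinfun (frechet_derivative (f \<circ> chart_inv c) (at (snd c p))))"

(* d w (u1, u2, u3) for a 2-form w *)
definition ext_deriv2 :: "('m, 'e::euclidean_space) chart set \<Rightarrow> ('m \<Rightarrow> 'e \<Rightarrow>\<^sub>L 'e cotan) \<Rightarrow>
    'm \<Rightarrow> 'e \<Rightarrow> 'e \<Rightarrow> 'e \<Rightarrow> real" where
  "ext_deriv2 A w p u1 u2 u3 =
     (let c = chart_at A p; D = frechet_derivative (bilin_in_chart A c w) (at (snd c p))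
      in D u1 u2 u3 - D u2 u1 u3 + D u3 u1 u2)"

definition courant :: "('m, 'e::euclidean_space) chart set \<Rightarrow>
    ('m \<Rightarrow> 'e gtan) \<Rightarrow> ('m \<Rightarrow> 'e gtan) \<Rightarrow> 'm \<Rightarrow> 'e gtan" where
  "courant A e e' p =
     (let u = fst \<circ> e; \<sigma> = snd \<circ> e; v = fst \<circ> e'; \<tau> = snd \<circ> e'
      in (lie_bracket A u v p,
          lie_derivative A u \<tau> p - lie_derivative A v \<sigma> p
          - (1/2) *\<^sub>R differential A (\<lambda>q. \<tau> q (u q) - \<sigma> q (v q)) p))"

section \<open>Generalized complex and paracomplex structures\<close>

fun split_metric :: "'e::euclidean_space gtan \<Rightarrow> 'e gtan \<Rightarrow> real" where
  "split_metric (u, \<sigma>) (v, \<tau>) = \<tau> u + \<sigma> v"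

(* Trace with respect to the basis (b, 0), (0, b* ), b in Basis. *)
definition gtrace :: "('e::euclidean_space gtan \<Rightarrow>\<^sub>L 'e gtan) \<Rightarrow> real" where
  "gtrace L = (\<Sum>b\<in>Basis. fst (L (b, 0)) \<bullet> b + snd (L (0, blinfun_inner_left b)) b)"

(* The part of the definitions that does not involve integrability. *)
definition almost_gen_structure :: "('m, 'e::euclidean_space) chart set \<Rightarrow> real \<Rightarrow>
    ('m \<Rightarrow> 'e gtan \<Rightarrow>\<^sub>L 'e gtan) \<Rightarrow> bool" where
  "almost_gen_structure A lam S \<longleftrightarrow> smooth_gendo A S \<and>
     (\<forall>p. S p o\<^sub>L S p = lam *\<^sub>R id_blinfun \<and> gtrace (S p) = 0 \<and>
        (\<forall>x y. split_metric (S p x) y = - split_metric x (S p y)))"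

definition gen_paracomplex_structure :: "('m, 'e::euclidean_space) chart set \<Rightarrow>
    ('m \<Rightarrow> 'e gtan \<Rightarrow>\<^sub>L 'e gtan) \<Rightarrow> bool" where
  "gen_paracomplex_structure A S \<longleftrightarrow> almost_gen_structure A 1 S \<and>
     (\<forall>\<epsilon>\<in>{1, -1}. \<forall>e e'. smooth_gvec A e \<longrightarrow> smooth_gvec A e' \<longrightarrow>
        (\<forall>p. S p (e p) = \<epsilon> *\<^sub>R e p) \<longrightarrow> (\<forall>p. S p (e' p) = \<epsilon> *\<^sub>R e' p) \<longrightarrow>
        (\<forall>p. S p (courant A e e' p) = \<epsilon> *\<^sub>R courant A e e' p))"

(* The complexification of a real vector space V is V \<times> V, with (a, b) standing for a + i b. *)

definition times_i :: "'v::real_vector \<times> 'v \<Rightarrow> 'v \<times> 'v" where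
  "times_i z = (- snd z, fst z)"

definition smooth_gvec_cplx ::
    "('m, 'e::euclidean_space) chart set \<Rightarrow> ('m \<Rightarrow> 'e gtan \<times> 'e gtan) \<Rightarrow> bool" where
  "smooth_gvec_cplx A e \<longleftrightarrow> smooth_gvec A (fst \<circ> e) \<and> smooth_gvec A (snd \<circ> e)"

definition courant_cplx :: "('m, 'e::euclidean_space) chart set \<Rightarrow> ('m \<Rightarrow> 'e gtan \<times> 'e gtan) \<Rightarrow>
    ('m \<Rightarrow> 'e gtan \<times> 'e gtan) \<Rightarrow> 'm \<Rightarrow> 'e gtan \<times> 'e gtan" where
  "courant_cplx A e e' p =
     (let a = fst \<circ> e; b = snd \<circ> e; a' = fst \<circ> e'; b' = snd \<circ> e'
      in (courant A a a' p - courant A b b' p, courant A a b' p + courant A b a' p))"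

definition gen_complex_structure :: "('m, 'e::euclidean_space) chart set \<Rightarrow>
    ('m \<Rightarrow> 'e gtan \<Rightarrow>\<^sub>L 'e gtan) \<Rightarrow> bool" where
  "gen_complex_structure A S \<longleftrightarrow> almost_gen_structure A (-1) S \<and>
     (\<forall>\<epsilon>\<in>{1, -1}. \<forall>e e'. smooth_gvec_cplx A e \<longrightarrow> smooth_gvec_cplx A e' \<longrightarrow>
        (\<forall>p. map_prod (S p) (S p) (e p) = \<epsilon> *\<^sub>R times_i (e p)) \<longrightarrow>
        (\<forall>p. map_prod (S p) (S p) (e' p) = \<epsilon> *\<^sub>R times_i (e' p)) \<longrightarrow>
        (\<forall>p. map_prod (S p) (S p) (courant_cplx A e e' p) = \<epsilon> *\<^sub>R times_i (courant_cplx A e e' p)))"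

section \<open>Pseudo-Riemannian metrics and integrable structures of mixed type\<close>

definition nondegenerate :: "('m \<Rightarrow> 'e::euclidean_space \<Rightarrow>\<^sub>L 'e cotan) \<Rightarrow> bool" where
  "nondegenerate w \<longleftrightarrow> (\<forall>p u. (\<forall>v. w p u v = 0) \<longrightarrow> u = 0)"

definition pseudo_riemannian ::
    "('m, 'e::euclidean_space) chart set \<Rightarrow> ('m \<Rightarrow> 'e \<Rightarrow>\<^sub>L 'e cotan) \<Rightarrow> bool" where
  "pseudo_riemannian A g \<longleftrightarrow> smooth_bilin A g \<and> (\<forall>p u v. g p u v = g p v u) \<and> nondegenerate g"

(* Meaningful for bijective f, such as the flat map of a nondegenerate form. *)
definition blinfun_inv :: "('a::real_normed_vector \<Rightarrow>\<^sub>L 'b::real_normed_vector) \<Rightarrow> 'b \<Rightarrow>\<^sub>L 'a" where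
  "blinfun_inv f = Blinfun (inv (blinfun_apply f))"

definition I_op :: "('m \<Rightarrow> 'e::euclidean_space \<Rightarrow>\<^sub>L 'e cotan) \<Rightarrow> real \<Rightarrow> 'm \<Rightarrow> 'e gtan \<Rightarrow>\<^sub>L 'e gtan" where
  "I_op g k p = block 0 (k *\<^sub>R blinfun_inv (g p)) (g p) 0"

definition integrable_structure :: "('m, 'e::euclidean_space) chart set \<Rightarrow>
    ('m \<Rightarrow> 'e \<Rightarrow>\<^sub>L 'e cotan) \<Rightarrow> real \<Rightarrow> real \<Rightarrow> ('m \<Rightarrow> 'e gtan \<Rightarrow>\<^sub>L 'e gtan) \<Rightarrow> bool" where
  "integrable_structure A g lam ell S \<longleftrightarrow>
     (lam = -1 \<longrightarrow> gen_complex_structure A S) \<and>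
     (lam = 1 \<longrightarrow> gen_paracomplex_structure A S) \<and>
     (\<forall>p. S p o\<^sub>L I_op g (- lam * ell) p = - (I_op g (- lam * ell) p o\<^sub>L S p))"

section \<open>Extremal structures\<close>

definition smooth_into :: "('m::topological_space, 'e::euclidean_space) chart set \<Rightarrow>
    'e set \<Rightarrow> ('e \<Rightarrow> 'm) \<Rightarrow> bool" where
  "smooth_into A U f \<longleftrightarrow> continuous_on U f \<and> (\<forall>c\<in>A. smooth_on (U \<inter> f -` fst c) (snd c \<circ> f))"

definition map_deriv :: "('m, 'e::euclidean_space) chart set \<Rightarrow> ('e \<Rightarrow> 'm) \<Rightarrow> 'e \<Rightarrow> 'e \<Rightarrow> 'e" where
  "map_deriv A f x = frechet_derivative (snd (chart_at A (f x)) \<circ> f) (at x)"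

(* D is integrable if every point p lies on an integral manifold of D: an immersion of a
   neighbourhood of 0 in a linear space W with f 0 = p whose tangent spaces are the fibres of D.
   To treat all ranks in one type, W is a subspace of the model space 'e and the immersion is the
   restriction to U \<inter> W of a smooth map f on the open set U; any smooth map on a neighbourhood of 0
   in W extends in this way, by composition with a linear projection onto W. *)
definition integrable_distribution ::
    "('m::topological_space, 'e::euclidean_space) chart set \<Rightarrow> ('m \<Rightarrow> 'e set) \<Rightarrow> bool" where
  "integrable_distribution A D \<longleftrightarrow>
     (\<forall>p. \<exists>W U f. subspace W \<and> open U \<and> 0 \<in> U \<and> smooth_into A U f \<and> f 0 = p \<and>
        (\<forall>x\<in>U \<inter> W. inj_on (map_deriv A f x) W \<and> map_deriv A f x ` W = D (f x)))"

definition g_symmetric ::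
    "('m \<Rightarrow> 'e::euclidean_space \<Rightarrow>\<^sub>L 'e cotan) \<Rightarrow> ('m \<Rightarrow> 'e \<Rightarrow>\<^sub>L 'e) \<Rightarrow> bool" where
  "g_symmetric g r \<longleftrightarrow> (\<forall>p u v. g p (r p u) v = g p u (r p v))"

definition plus_zero_structure :: "('m::topological_space, 'e::euclidean_space) chart set \<Rightarrow>
    ('m \<Rightarrow> 'e \<Rightarrow>\<^sub>L 'e cotan) \<Rightarrow> ('m \<Rightarrow> 'e \<Rightarrow>\<^sub>L 'e) \<Rightarrow> bool" where
  "plus_zero_structure A g r \<longleftrightarrow> smooth_endo A r \<and> (\<forall>p. r p o\<^sub>L r p = id_blinfun) \<and>
     (\<forall>\<epsilon>\<in>{1, -1}. integrable_distribution A (\<lambda>p. {u. r p u = \<epsilon> *\<^sub>R u})) \<and> g_symmetric g r"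

(* Nijenhuis tensor of an almost complex structure, [jX,jY] - j[jX,Y] - j[X,jY] - [X,Y] *)
definition nijenhuis :: "('m, 'e::euclidean_space) chart set \<Rightarrow> ('m \<Rightarrow> 'e \<Rightarrow>\<^sub>L 'e) \<Rightarrow>
    ('m \<Rightarrow> 'e) \<Rightarrow> ('m \<Rightarrow> 'e) \<Rightarrow> 'm \<Rightarrow> 'e" where
  "nijenhuis A j X Y p =
     (let jX = (\<lambda>q. j q (X q)); jY = (\<lambda>q. j q (Y q))
      in lie_bracket A jX jY p - j p (lie_bracket A jX Y p) - j p (lie_bracket A X jY p)
         - lie_bracket A X Y p)"

(* Complex structures are integrable almost complex structures; as usual, an almost complex
   structure is called integrable if its Nijenhuis tensor vanishes. *)
definition complex_structure ::
    "('m, 'e::euclidean_space) chart set \<Rightarrow> ('m \<Rightarrow> 'e \<Rightarrow>\<^sub>L 'e) \<Rightarrow> bool" where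
  "complex_structure A j \<longleftrightarrow> smooth_endo A j \<and> (\<forall>p. j p o\<^sub>L j p = - id_blinfun) \<and>
     (\<forall>X Y. smooth_vec A X \<longrightarrow> smooth_vec A Y \<longrightarrow> (\<forall>p. nijenhuis A j X Y p = 0))"

definition minus_zero_structure :: "('m, 'e::euclidean_space) chart set \<Rightarrow>
    ('m \<Rightarrow> 'e \<Rightarrow>\<^sub>L 'e cotan) \<Rightarrow> ('m \<Rightarrow> 'e \<Rightarrow>\<^sub>L 'e) \<Rightarrow> bool" where
  "minus_zero_structure A g j \<longleftrightarrow> complex_structure A j \<and> g_symmetric g j"

definition lambda_zero_structure :: "('m::topological_space, 'e::euclidean_space) chart set \<Rightarrow>
    ('m \<Rightarrow> 'e \<Rightarrow>\<^sub>L 'e cotan) \<Rightarrow> real \<Rightarrow> ('m \<Rightarrow> 'e \<Rightarrow>\<^sub>L 'e) \<Rightarrow> bool" where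
  "lambda_zero_structure A g lam s \<longleftrightarrow>
     (lam = 1 \<longrightarrow> plus_zero_structure A g s) \<and> (lam = -1 \<longrightarrow> minus_zero_structure A g s)"

definition symplectic_form ::
    "('m, 'e::euclidean_space) chart set \<Rightarrow> ('m \<Rightarrow> 'e \<Rightarrow>\<^sub>L 'e cotan) \<Rightarrow> bool" where
  "symplectic_form A w \<longleftrightarrow> smooth_bilin A w \<and> (\<forall>p u v. w p u v = - w p v u) \<and> nondegenerate w \<and>
     (\<forall>p u1 u2 u3. ext_deriv2 A w p u1 u2 u3 = 0)"

(* Since g is nondegenerate, r is uniquely determined by w and g. *)
definition zero_ell_structure :: "('m, 'e::euclidean_space) chart set \<Rightarrow>
    ('m \<Rightarrow> 'e \<Rightarrow>\<^sub>L 'e cotan) \<Rightarrow> real \<Rightarrow> ('m \<Rightarrow> 'e \<Rightarrow>\<^sub>L 'e cotan) \<Rightarrow> bool" where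
  "zero_ell_structure A g ell w \<longleftrightarrow> symplectic_form A w \<and>
     (\<exists>r. smooth_endo A r \<and> (\<forall>p u v. w p u v = g p (r p u) v) \<and>
        (\<forall>p. r p o\<^sub>L r p = ell *\<^sub>R id_blinfun))"

end

(* The diagonal structure R restricts to the tangent bundle: for sections without cotangent part the
   Courant bracket is the Lie bracket, so the integrability of R says that the eigenbundles of s are
   involutive, and skew-symmetry together with anticommutation makes s symmetric. For lam = -1,
   involutivity of the eigenbundles is the vanishing of the Nijenhuis tensor. For lam = 1 it is turned
   into integral manifolds by the Frobenius theorem: near a point p the eigendistribution D is spanned
   by the fields in D that project to constant fields in D(p) along a fixed complement; they commute,
   so the total differential equation whose solution is an integral manifold is solvable.
   An eigenbundle of the antidiagonal structure Q is the graph of omega (of i omega for lam = -1), and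
   the Courant bracket of the sections X + omega X and Y + omega Y differs from the section over [X,Y]
   by d omega(X, Y, .). Finally, r = g^-1 omega has r^2 = ell because Q anticommutes with I_k. *)

theory Submission
  imports Defs
begin

section \<open>Calculus of smooth maps\<close>

text \<open>The Courant hypotheses speak of global sections, whereas the Frobenius argument and the
  value of d \<omega> are local. The bridge is a cutoff with value 1 and derivative 0 at a chosen
  point: a local field times the cutoff is global, stays in its eigenbundle and keeps its first
  derivative at that point, so the bracket there is unchanged. One point at a time suffices, since
  involutivity and closedness are pointwise conclusions. A second obstacle is that a bracket at q is
  computed in the preferred chart of q, which jumps with q. Symmetry of second derivatives of the
  transition maps is what allows computing it in one fixed chart. For d \<omega> the cutoff
  multiplies constant coordinate fields. Their Lie bracket vanishes at the point, so the covector
  part of the Courant bracket is the value of d \<omega> itself. The differential equations are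
  scaled to the time interval [0,1] with growth constant 1/2, so that a contraction and a maximum
  argument replace exponential bounds.\<close>

lemma frechet_derivative_eq:
  "(f has_derivative f') (at x) \<Longrightarrow> frechet_derivative f (at x) = f'"
  using frechet_derivative_at by fastforce

lemma Ck_on_subset: "Ck_on k S f \<Longrightarrow> T \<subseteq> S \<Longrightarrow> Ck_on k T f"
  by (induction k arbitrary: f) (auto intro: continuous_on_subset)

text \<open>On an open set equal functions have equal derivatives at every point, which carries the
  induction. This permits replacing \<open>frechet_derivative\<close> by an explicit formula that is
  valid only on \<open>S\<close>.\<close>

lemma Ck_on_cong:
  assumes "open S" "\<And>x. x \<in> S \<Longrightarrow> f x = g x" "Ck_on k S f"
  shows "Ck_on k S g"
  using assms(2,3)
proof (induction k arbitrary: f g)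
  case 0
  then show ?case by (simp cong: continuous_on_cong)
next
  case (Suc k)
  have d: "(g has_derivative frechet_derivative f (at x)) (at x)" if "x \<in> S" for x
  proof (rule has_derivative_transform_within_open[OF _ \<open>open S\<close> that])
    show "(f has_derivative frechet_derivative f (at x)) (at x)"
      using Suc.prems(2) that by (simp add: frechet_derivative_works[symmetric])
  qed (use Suc.prems(1) in auto)
  show ?case
    unfolding Ck_on.simps
  proof (intro conjI ballI allI)
    fix x assume "x \<in> S"
    then show "g differentiable (at x)"
      using d unfolding differentiable_def by blast
  next
    fix v
    show "Ck_on k S (\<lambda>x. frechet_derivative g (at x) v)"
    proof (rule Suc.IH)
      show "Ck_on k S (\<lambda>x. frechet_derivative f (at x) v)"
        using Suc.prems(2) by simp
      show "frechet_derivative f (at x) v = frechet_derivative g (at x) v" if "x \<in> S" for x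
        using frechet_derivative_eq[OF d[OF that]] by simp
    qed
  qed
qed

text \<open>\<open>Ck_on\<close> tests derivatives at single points, so it glues along open covers.
  This serves fields extended by zero, whose formula changes from one neighbourhood to the
  next.\<close>

lemma Ck_on_local:
  assumes "\<And>x. x \<in> S \<Longrightarrow> \<exists>T. open T \<and> x \<in> T \<and> Ck_on k T f"
  shows "Ck_on k S f"
  using assms
proof (induction k arbitrary: f)
  case 0
  show ?case
    unfolding Ck_on.simps
  proof (rule continuous_at_imp_continuous_on, rule ballI)
    fix x assume "x \<in> S"
    then obtain T where "open T" "x \<in> T" "continuous_on T f"
      using 0[OF \<open>x \<in> S\<close>] by auto
    then show "isCont f x"
      by (simp add: continuous_on_eq_continuous_at)
  qed
next
  case (Suc k)
  show ?case
    unfolding Ck_on.simps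
  proof (intro conjI ballI allI)
    show "f differentiable (at x)" if "x \<in> S" for x
      using Suc.prems[OF that] by auto
    show "Ck_on k S (\<lambda>x. frechet_derivative f (at x) v)" for v
    proof (rule Suc.IH)
      fix x assume "x \<in> S"
      from Suc.prems[OF this]
      show "\<exists>T. open T \<and> x \<in> T \<and> Ck_on k T (\<lambda>x. frechet_derivative f (at x) v)"
        by auto
    qed
  qed
qed

lemma Ck_on_SucD: "Ck_on (Suc k) S f \<Longrightarrow> Ck_on k S f"
proof (induction k arbitrary: f)
  case 0
  then show ?case
    by (auto intro!: continuous_at_imp_continuous_on differentiable_imp_continuous_within)
next
  case (Suc k)
  then show ?case by simp
qed

text \<open>Any named derivative may stand in for the one chosen by
  \<open>frechet_derivative\<close>, which reduces the closure properties below to the usual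
  differentiation rules.\<close>

lemma Ck_on_SucI:
  assumes "open S"
    and "\<And>x. x \<in> S \<Longrightarrow> (f has_derivative f' x) (at x)"
    and "\<And>v. Ck_on k S (\<lambda>x. f' x v)"
  shows "Ck_on (Suc k) S f"
  unfolding Ck_on.simps
proof (intro conjI ballI allI)
  show "f differentiable (at x)" if "x \<in> S" for x
    using assms(2)[OF that] by (auto simp: differentiable_def)
  show "Ck_on k S (\<lambda>x. frechet_derivative f (at x) v)" for v
    by (rule Ck_on_cong[OF assms(1) _ assms(3)[of v]]) (simp add: frechet_derivative_eq[OF assms(2)])
qed

lemma Ck_on_has_derivative:
  "Ck_on (Suc k) S f \<Longrightarrow> x \<in> S \<Longrightarrow> (f has_derivative frechet_derivative f (at x)) (at x)"
  by (simp add: frechet_derivative_works[symmetric])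

lemma Ck_on_const: "open S \<Longrightarrow> Ck_on k S (\<lambda>x. c)"
proof (induction k arbitrary: c)
  case (Suc k)
  show ?case
    by (rule Ck_on_SucI[OF Suc.prems, where f' = "\<lambda>_ _. 0"]) (auto intro: Suc)
qed auto

lemma Ck_on_linear:
  assumes "open S" "bounded_linear L" "Ck_on k S f"
  shows "Ck_on k S (\<lambda>x. L (f x))"
  using assms(3)
proof (induction k arbitrary: f)
  case 0
  then show ?case by (simp add: bounded_linear.continuous_on[OF assms(2)])
next
  case (Suc k)
  show ?case
  proof (rule Ck_on_SucI[OF assms(1)])
    fix x assume "x \<in> S"
    then show "((\<lambda>x. L (f x)) has_derivative (\<lambda>v. L (frechet_derivative f (at x) v))) (at x)"
      by (intro bounded_linear.has_derivative[OF assms(2)] Ck_on_has_derivative[OF Suc.prems])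
  qed (use Suc in auto)
qed

lemma Ck_on_id: "open S \<Longrightarrow> Ck_on k S (\<lambda>x. x)"
  by (cases k) (auto intro!: Ck_on_SucI[where f' = "\<lambda>_ v. v"] Ck_on_const)

lemma Ck_on_add:
  assumes "open S" "Ck_on k S f" "Ck_on k S g"
  shows "Ck_on k S (\<lambda>x. f x + g x)"
  using assms(2,3)
proof (induction k arbitrary: f g)
  case 0
  then show ?case by (auto intro: continuous_on_add)
next
  case (Suc k)
  show ?case
  proof (rule Ck_on_SucI[OF assms(1)])
    fix x assume "x \<in> S"
    then show "((\<lambda>x. f x + g x) has_derivative
        (\<lambda>v. frechet_derivative f (at x) v + frechet_derivative g (at x) v)) (at x)"
      by (intro has_derivative_add Ck_on_has_derivative[OF Suc.prems(1)]
          Ck_on_has_derivative[OF Suc.prems(2)])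
  qed (use Suc in auto)
qed

lemma Ck_on_bilinear:
  assumes "open S" "bounded_bilinear B" "Ck_on k S f" "Ck_on k S g"
  shows "Ck_on k S (\<lambda>x. B (f x) (g x))"
  using assms(3,4)
proof (induction k arbitrary: f g)
  case 0
  then show ?case by (simp add: bounded_bilinear.continuous_on[OF assms(2)])
next
  case (Suc k)
  show ?case
  proof (rule Ck_on_SucI[OF assms(1)])
    fix x assume "x \<in> S"
    then show "((\<lambda>x. B (f x) (g x)) has_derivative
        (\<lambda>v. B (f x) (frechet_derivative g (at x) v) + B (frechet_derivative f (at x) v) (g x))) (at x)"
      by (intro bounded_bilinear.FDERIV[OF assms(2)] Ck_on_has_derivative[OF Suc.prems(1)]
          Ck_on_has_derivative[OF Suc.prems(2)])
  next
    fix v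
    \<comment> \<open>The product rule pairs each derivative with an undifferentiated factor, so the
      induction also needs the factors themselves one order lower.\<close>
    have "Ck_on k S f" "Ck_on k S g"
      using Suc.prems by (auto intro: Ck_on_SucD simp del: Ck_on.simps)
    then show "Ck_on k S (\<lambda>x. B (f x) (frechet_derivative g (at x) v)
        + B (frechet_derivative f (at x) v) (g x))"
      using Suc.prems by (intro Ck_on_add[OF assms(1)] Suc.IH) auto
  qed
qed

lemma Ck_on_sum:
  assumes "open S" "\<And>i. i \<in> I \<Longrightarrow> Ck_on k S (f i)"
  shows "Ck_on k S (\<lambda>x. \<Sum>i\<in>I. f i x)"
  using assms(2)
  by (induction I rule: infinite_finite_induct) (auto intro: Ck_on_const Ck_on_add assms(1))

text \<open>The chain rule evaluates the derivative of \<open>g\<close> in a direction that moves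
  with x, whereas \<open>Ck_on\<close> controls only fixed directions. Expanding the direction in
  the basis leaves finitely many products to which the induction applies.\<close>

lemma Ck_on_compose:
  fixes f :: "'a::euclidean_space \<Rightarrow> 'b::euclidean_space" and g :: "'b \<Rightarrow> 'c::real_normed_vector"
  assumes "open S" "open T" "f ` S \<subseteq> T" "Ck_on k S f" "Ck_on k T g"
  shows "Ck_on k S (\<lambda>x. g (f x))"
  using assms(4,5)
proof (induction k arbitrary: g)
  case 0
  then show ?case using assms(3) by (auto intro: continuous_on_compose2)
next
  case (Suc k)
  have fk: "Ck_on k S f"
    using Suc.prems(1) by (rule Ck_on_SucD)
  show ?case
  proof (rule Ck_on_SucI[OF assms(1)])
    fix x assume "x \<in> S"
    then have "f x \<in> T" using assms(3) by auto
    define D where "D = frechet_derivative g (at (f x))"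
    have D: "(g has_derivative D) (at (f x))"
      unfolding D_def by (rule Ck_on_has_derivative[OF Suc.prems(2) \<open>f x \<in> T\<close>])
    have "((\<lambda>x. g (f x)) has_derivative (\<lambda>v. D (frechet_derivative f (at x) v))) (at x)"
      by (rule has_derivative_compose[OF Ck_on_has_derivative[OF Suc.prems(1) \<open>x \<in> S\<close>] D])
    also have "(\<lambda>v. D (frechet_derivative f (at x) v))
        = (\<lambda>v. \<Sum>b\<in>Basis. (frechet_derivative f (at x) v \<bullet> b) *\<^sub>R D b)"
    proof
      fix v
      let ?w = "frechet_derivative f (at x) v"
      have "D ?w = D (\<Sum>b\<in>Basis. (?w \<bullet> b) *\<^sub>R b)"
        by (simp add: euclidean_representation)
      also have "\<dots> = (\<Sum>b\<in>Basis. (?w \<bullet> b) *\<^sub>R D b)"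
        by (simp add: linear_sum[OF has_derivative_linear[OF D]]
            linear_cmul[OF has_derivative_linear[OF D]])
      finally show "D ?w = (\<Sum>b\<in>Basis. (?w \<bullet> b) *\<^sub>R D b)" .
    qed
    finally show "((\<lambda>x. g (f x)) has_derivative (\<lambda>v. \<Sum>b\<in>Basis.
        (frechet_derivative f (at x) v \<bullet> b) *\<^sub>R frechet_derivative g (at (f x)) b)) (at x)"
      unfolding D_def .
  next
    fix v
    have "Ck_on k S (\<lambda>x. frechet_derivative g (at (f x)) b)" for b
      using Suc.prems(2) by (intro Suc.IH[OF fk]) auto
    then show "Ck_on k S (\<lambda>x. \<Sum>b\<in>Basis.
        (frechet_derivative f (at x) v \<bullet> b) *\<^sub>R frechet_derivative g (at (f x)) b)"
      using Suc.prems(1)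
      by (intro Ck_on_sum[OF assms(1)] Ck_on_bilinear[OF assms(1) bounded_bilinear_scaleR]
          Ck_on_linear[OF assms(1) bounded_linear_inner_left]) auto
  qed
qed

section \<open>Smooth maps and operator-valued derivatives\<close>

lemma smooth_on_subset: "smooth_on S f \<Longrightarrow> T \<subseteq> S \<Longrightarrow> smooth_on T f"
  unfolding smooth_on_def using Ck_on_subset by blast

lemma smooth_on_cong:
  "open S \<Longrightarrow> (\<And>x. x \<in> S \<Longrightarrow> f x = g x) \<Longrightarrow> smooth_on S f \<Longrightarrow> smooth_on S g"
  unfolding smooth_on_def by (rule allI, rule Ck_on_cong[where f = f]) auto

lemma smooth_on_local:
  "(\<And>x. x \<in> S \<Longrightarrow> \<exists>T. open T \<and> x \<in> T \<and> smooth_on T f) \<Longrightarrow> smooth_on S f"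
  unfolding smooth_on_def by (intro allI Ck_on_local) blast

lemma smooth_on_const: "open S \<Longrightarrow> smooth_on S (\<lambda>x. c)"
  by (simp add: smooth_on_def Ck_on_const)

lemma smooth_on_id: "open S \<Longrightarrow> smooth_on S (\<lambda>x. x)"
  by (simp add: smooth_on_def Ck_on_id)

lemma smooth_on_linear:
  "open S \<Longrightarrow> bounded_linear L \<Longrightarrow> smooth_on S f \<Longrightarrow> smooth_on S (\<lambda>x. L (f x))"
  unfolding smooth_on_def by (rule allI, rule Ck_on_linear) auto

lemma smooth_on_add:
  "open S \<Longrightarrow> smooth_on S f \<Longrightarrow> smooth_on S g \<Longrightarrow> smooth_on S (\<lambda>x. f x + g x)"
  unfolding smooth_on_def by (rule allI, rule Ck_on_add) auto

lemma smooth_on_bilinear: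
  "open S \<Longrightarrow> bounded_bilinear B \<Longrightarrow> smooth_on S f \<Longrightarrow> smooth_on S g
    \<Longrightarrow> smooth_on S (\<lambda>x. B (f x) (g x))"
  unfolding smooth_on_def by (rule allI, rule Ck_on_bilinear) auto

lemmas smooth_on_scaleR = smooth_on_bilinear[OF _ bounded_bilinear_scaleR]
lemmas smooth_on_blinfun_apply = smooth_on_bilinear[OF _ bounded_bilinear_blinfun_apply]
lemmas smooth_on_blinfun_compose = smooth_on_bilinear[OF _ bounded_bilinear_blinfun_compose]

lemma smooth_on_diff:
  "open S \<Longrightarrow> smooth_on S f \<Longrightarrow> smooth_on S g \<Longrightarrow> smooth_on S (\<lambda>x. f x - g x)"
  using smooth_on_add[of S f "\<lambda>x. - g x"]
    smooth_on_linear[OF _ bounded_linear_minus[OF bounded_linear_ident], of S g] by simp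

lemma smooth_on_Pair:
  assumes "open S" "smooth_on S f" "smooth_on S g"
  shows "smooth_on S (\<lambda>x. (f x, g x))"
proof -
  have "smooth_on S (\<lambda>x. (f x, 0) + (0, g x))"
    by (intro smooth_on_add smooth_on_linear[OF _ _ assms(2)] smooth_on_linear[OF _ _ assms(3)]
        assms(1) bounded_linear_Pair bounded_linear_ident bounded_linear_zero)
  then show ?thesis by simp
qed

lemma smooth_on_compose:
  fixes f :: "'a::euclidean_space \<Rightarrow> 'b::euclidean_space"
  shows "open S \<Longrightarrow> open T \<Longrightarrow> smooth_on S f \<Longrightarrow> smooth_on T g \<Longrightarrow> f ` S \<subseteq> T
    \<Longrightarrow> smooth_on S (\<lambda>x. g (f x))"
  unfolding smooth_on_def by (rule allI, rule Ck_on_compose[where T = T]) auto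

lemma smooth_on_imp_continuous_on: "smooth_on S f \<Longrightarrow> continuous_on S f"
  unfolding smooth_on_def by (drule spec[of _ 0]) simp

lemma smooth_on_has_derivative:
  "smooth_on S f \<Longrightarrow> x \<in> S \<Longrightarrow> (f has_derivative frechet_derivative f (at x)) (at x)"
  unfolding smooth_on_def by (drule spec[of _ "Suc 0"]) (rule Ck_on_has_derivative)

lemma smooth_on_frechet_derivative:
  "smooth_on S f \<Longrightarrow> smooth_on S (\<lambda>x. frechet_derivative f (at x) v)"
  unfolding smooth_on_def by (rule allI, rename_tac k, drule_tac x = "Suc k" in spec) simp

lemma Blinfun_eq_sum:
  fixes D :: "'a::euclidean_space \<Rightarrow> 'b::real_normed_vector"
  assumes "bounded_linear D"
  shows "Blinfun D = (\<Sum>b\<in>Basis. blinfun_scaleR_left (D b) o\<^sub>L blinfun_inner_left b)"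
proof (rule blinfun_eqI)
  fix w
  have "D w = D (\<Sum>b\<in>Basis. (w \<bullet> b) *\<^sub>R b)"
    by (simp add: euclidean_representation)
  also have "\<dots> = (\<Sum>b\<in>Basis. (w \<bullet> b) *\<^sub>R D b)"
    using assms by (simp add: bounded_linear.linear linear_sum linear_cmul)
  finally show "Blinfun D w
      = (\<Sum>b\<in>Basis. blinfun_scaleR_left (D b) o\<^sub>L blinfun_inner_left b) w"
    by (simp add: bounded_linear_Blinfun_apply[OF assms] blinfun.sum_left inner_commute)
qed

text \<open>Smoothness is defined through directional derivatives. Assembling those along the basis
  gives a derivative that is smooth as a map into the operator space, so it can be differentiated
  again and is continuous in the operator norm.\<close>

lemma smooth_on_blinfun_derivative:
  fixes f :: "'a::euclidean_space \<Rightarrow> 'b::real_normed_vector"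
  assumes "open S" "smooth_on S f"
  obtains f' :: "'a \<Rightarrow> 'a \<Rightarrow>\<^sub>L 'b" where "smooth_on S f'"
    "\<And>x. x \<in> S \<Longrightarrow> (f has_derivative f' x) (at x)"
proof
  let ?f' = "\<lambda>x. Blinfun (frechet_derivative f (at x))"
  have bl: "bounded_linear (frechet_derivative f (at x))" if "x \<in> S" for x
    using smooth_on_has_derivative[OF assms(2) that] by (rule has_derivative_bounded_linear)
  show "(f has_derivative ?f' x) (at x)" if "x \<in> S" for x
    by (simp add: bounded_linear_Blinfun_apply[OF bl[OF that]] smooth_on_has_derivative[OF assms(2) that])
  have "smooth_on S (\<lambda>x. \<Sum>b\<in>Basis.
      blinfun_scaleR_left (frechet_derivative f (at x) b) o\<^sub>L blinfun_inner_left b)"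
    unfolding smooth_on_def
  proof (intro allI Ck_on_sum[OF assms(1)])
    fix k and b :: 'a
    have "bounded_linear (\<lambda>w :: 'b. blinfun_scaleR_left w o\<^sub>L blinfun_inner_left b)"
      by (intro bounded_linear_compose[OF bounded_bilinear.bounded_linear_left[OF
          bounded_bilinear_blinfun_compose] bounded_linear_blinfun_scaleR_left])
    from Ck_on_linear[OF assms(1) this]
    show "Ck_on k S (\<lambda>x. blinfun_scaleR_left (frechet_derivative f (at x) b)
        o\<^sub>L blinfun_inner_left b)"
      using smooth_on_frechet_derivative[OF assms(2)] unfolding smooth_on_def by blast
  qed
  then show "smooth_on S ?f'"
    by (rule smooth_on_cong[OF assms(1), rotated]) (simp add: Blinfun_eq_sum[OF bl])
qed

text \<open>Bootstrapping: if \<open>f\<close> is $C^k$, then so is its derivative \<open>F (f x)\<close>.\<close>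

lemma smooth_on_autonomous:
  fixes f :: "'a::euclidean_space \<Rightarrow> 'b::euclidean_space" and F :: "'b \<Rightarrow> 'a \<Rightarrow>\<^sub>L 'b"
  assumes "open S" "open T" "f ` S \<subseteq> T" "smooth_on T F"
    and der: "\<And>x. x \<in> S \<Longrightarrow> (f has_derivative F (f x)) (at x)"
  shows "smooth_on S f"
  unfolding smooth_on_def
proof
  fix k
  show "Ck_on k S f"
  proof (induction k)
    case 0
    show ?case
      using der by (auto intro!: continuous_at_imp_continuous_on has_derivative_continuous)
  next
    case (Suc k)
    have "Ck_on k S (\<lambda>x. F (f x))"
      using assms(4) by (intro Ck_on_compose[OF assms(1,2,3) Suc]) (auto simp: smooth_on_def)
    then show ?case
      by (intro Ck_on_SucI[OF assms(1) der]
          Ck_on_bilinear[OF assms(1) bounded_bilinear_blinfun_apply] Ck_on_const assms(1))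
  qed
qed

text \<open>Everything follows from J y - J x = - J y (B y - B x) J x. With the uniform bound
  \<open>K\<close> it yields continuity, then the derivative - J B' J. The latter contains
  \<open>J\<close> only undifferentiated, so regularity climbs one order at a time.\<close>

lemma smooth_on_blinfun_inverse:
  fixes B J :: "'a::euclidean_space \<Rightarrow> 'b::real_normed_vector \<Rightarrow>\<^sub>L 'b"
  assumes "open S" "smooth_on S B"
    and J1: "\<And>x. x \<in> S \<Longrightarrow> J x o\<^sub>L B x = id_blinfun"
    and J2: "\<And>x. x \<in> S \<Longrightarrow> B x o\<^sub>L J x = id_blinfun"
    and bnd: "\<And>x. x \<in> S \<Longrightarrow> norm (J x) \<le> K"
  shows "smooth_on S J"
proof -
  have dJ: "J y - J x = - (J y o\<^sub>L (B y - B x) o\<^sub>L J x)" if "x \<in> S" "y \<in> S" for x y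
  proof -
    have "J y (B y w) = w" "B x (J x w) = w" for w
      using J1[OF that(2)] J2[OF that(1)]
      by (metis blinfun_apply_blinfun_compose blinfun_apply_id_blinfun id_apply)+
    then show ?thesis
      by (intro blinfun_eqI) (simp add: blinfun.bilinear_simps)
  qed
  obtain B' where B': "\<And>x. x \<in> S \<Longrightarrow> (B has_derivative blinfun_apply (B' x)) (at x)"
    using smooth_on_blinfun_derivative[OF assms(1,2)] by metis
  have cont: "isCont J x" if "x \<in> S" for x
  proof -
    have "((\<lambda>y. norm (J y - J x)) \<longlongrightarrow> 0) (at x)"
    proof (rule tendsto_sandwich[OF _ _ tendsto_const])
      show "\<forall>\<^sub>F y in at x. norm (J y - J x) \<le> K * norm (B y - B x) * K"
        using eventually_at_in_open'[OF assms(1) that]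
      proof eventually_elim
        case (elim y)
        have "norm (J y - J x) \<le> norm (J y o\<^sub>L (B y - B x)) * norm (J x)"
          unfolding dJ[OF that elim] by (simp add: norm_blinfun_compose)
        also have "\<dots> \<le> (norm (J y) * norm (B y - B x)) * norm (J x)"
          by (intro mult_right_mono norm_blinfun_compose norm_ge_zero)
        also have "\<dots> \<le> (K * norm (B y - B x)) * K"
          using bnd[OF elim] bnd[OF that] order_trans[OF norm_ge_zero bnd[OF that]]
          by (intro mult_mono) auto
        finally show ?case .
      qed
      have "(B \<longlongrightarrow> B x) (at x)"
        using has_derivative_continuous[OF B'[OF that]] by (simp add: isCont_def)
      then have "((\<lambda>y. K * norm (B y - B x) * K) \<longlongrightarrow> K * norm (B x - B x) * K) (at x)"
        by (intro tendsto_intros)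
      then show "((\<lambda>y. K * norm (B y - B x) * K) \<longlongrightarrow> 0) (at x)" by simp
    qed simp
    then have "((\<lambda>y. J y - J x) \<longlongrightarrow> 0) (at x)"
      by (rule tendsto_norm_zero_cancel)
    then show ?thesis
      unfolding isCont_def by (simp add: LIM_zero_cancel)
  qed
  have der: "(J has_derivative (\<lambda>v. - (J x o\<^sub>L B' x v o\<^sub>L J x))) (at x)" if "x \<in> S" for x
  proof -
    have lin: "bounded_linear (\<lambda>v. - (J x o\<^sub>L B' x v o\<^sub>L J x))"
      by (intro bounded_linear_minus bounded_linear_compose[OF bounded_bilinear.bounded_linear_left[OF
          bounded_bilinear_blinfun_compose]] bounded_linear_compose[OF
          bounded_bilinear.bounded_linear_right[OF bounded_bilinear_blinfun_compose]]
          blinfun.bounded_linear_right)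
    \<comment> \<open>\<open>?r\<close> is the remainder quotient of \<open>B\<close> and
      \<open>?q\<close> that of \<open>J\<close>. The identity \<open>dJ\<close> splits
      \<open>?q\<close> into - J y r J x and a term in which J y - J x meets a quotient bounded by
      \<open>norm (B' x)\<close>; both tend to 0.\<close>
    let ?r = "\<lambda>y. (B y - B x - B' x (y - x)) /\<^sub>R norm (y - x)"
    let ?q = "\<lambda>y. (J y - J x + (J x o\<^sub>L B' x (y - x) o\<^sub>L J x)) /\<^sub>R norm (y - x)"
    have r: "(?r \<longlongrightarrow> 0) (at x)"
      using B'[OF that] unfolding has_derivative_at_within by simp
    have Bx: "(J \<longlongrightarrow> J x) (at x)"
      using cont[OF that] by (simp add: isCont_def)
    have "((\<lambda>y. K * (norm (?r y) * K) + norm (J y - J x) * (norm (B' x) * K)) \<longlongrightarrow>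
        K * (norm (0 :: 'b \<Rightarrow>\<^sub>L 'b) * K) + norm (J x - J x) * (norm (B' x) * K)) (at x)"
      by (intro tendsto_intros r Bx)
    then have lim: "((\<lambda>y. K * (norm (?r y) * K) + norm (J y - J x) * (norm (B' x) * K)) \<longlongrightarrow> 0) (at x)"
      by simp
    have q: "((\<lambda>y. norm (?q y)) \<longlongrightarrow> 0) (at x)"
    proof (rule tendsto_sandwich[OF _ _ tendsto_const lim])
      have "\<forall>\<^sub>F y in at x. y \<in> S \<and> y \<noteq> x"
        using eventually_at_in_open[OF assms(1) that] by eventually_elim auto
      then show "\<forall>\<^sub>F y in at x. norm (?q y) \<le>
          K * (norm (?r y) * K) + norm (J y - J x) * (norm (B' x) * K)"
      proof eventually_elim
        case (elim y)
        let ?u = "inverse (norm (y - x))"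
        have K: "norm (J y) \<le> K" "norm (J x) \<le> K" "0 \<le> K"
          using bnd elim that order_trans[OF norm_ge_zero bnd[OF that]] by auto
        have "- (J y o\<^sub>L ?r y o\<^sub>L J x)
            = ?u *\<^sub>R (- (J y o\<^sub>L (B y - B x) o\<^sub>L J x) + (J y o\<^sub>L B' x (y - x) o\<^sub>L J x))"
          by (rule blinfun_eqI) (simp add: blinfun.bilinear_simps algebra_simps)
        also have "\<dots> = ?u *\<^sub>R ((J y - J x) + (J y o\<^sub>L B' x (y - x) o\<^sub>L J x))"
          using dJ[OF that conjunct1[OF elim]] by simp
        finally have "- (J y o\<^sub>L ?r y o\<^sub>L J x)
            = ?u *\<^sub>R ((J y - J x) + (J y o\<^sub>L B' x (y - x) o\<^sub>L J x))" .
        moreover have "(J y - J x) o\<^sub>L ?u *\<^sub>R B' x (y - x) o\<^sub>L J x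
            = ?u *\<^sub>R ((J y o\<^sub>L B' x (y - x) o\<^sub>L J x) - (J x o\<^sub>L B' x (y - x) o\<^sub>L J x))"
          by (rule blinfun_eqI)
            (simp add: blinfun.diff_left blinfun.scaleR_left blinfun.scaleR_right scaleR_diff_right)
        ultimately have "?q y
            = - (J y o\<^sub>L ?r y o\<^sub>L J x) - ((J y - J x) o\<^sub>L ?u *\<^sub>R B' x (y - x) o\<^sub>L J x)"
          by (simp only: scaleR_add_right scaleR_diff_right) simp
        also have "norm \<dots> \<le> norm (J y o\<^sub>L ?r y o\<^sub>L J x)
            + norm ((J y - J x) o\<^sub>L ?u *\<^sub>R B' x (y - x) o\<^sub>L J x)"
          by (rule order_trans[OF norm_triangle_ineq4]) (simp only: norm_minus_cancel order_refl)
        also have "\<dots> \<le> K * (norm (?r y) * K) + norm (J y - J x) * (norm (B' x) * K)"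
        proof (rule add_mono)
          have "norm (J y o\<^sub>L ?r y o\<^sub>L J x) \<le> (norm (J y) * norm (?r y)) * norm (J x)"
            by (intro order_trans[OF norm_blinfun_compose] mult_right_mono norm_blinfun_compose
                norm_ge_zero)
          also have "\<dots> \<le> (K * norm (?r y)) * K"
            using K by (intro mult_mono) auto
          finally show "norm (J y o\<^sub>L ?r y o\<^sub>L J x) \<le> K * (norm (?r y) * K)"
            by (simp add: mult.assoc)
          have "norm (?u *\<^sub>R B' x (y - x)) \<le> ?u * (norm (B' x) * norm (y - x))"
            by (simp add: mult_left_mono norm_blinfun)
          also have "\<dots> = norm (B' x)"
            using elim by simp
          finally have u: "norm (?u *\<^sub>R B' x (y - x)) \<le> norm (B' x)" .
          have "norm ((J y - J x) o\<^sub>L ?u *\<^sub>R B' x (y - x) o\<^sub>L J x)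
              \<le> (norm (J y - J x) * norm (?u *\<^sub>R B' x (y - x))) * norm (J x)"
            by (intro order_trans[OF norm_blinfun_compose] mult_right_mono norm_blinfun_compose
                norm_ge_zero)
          also have "\<dots> \<le> (norm (J y - J x) * norm (B' x)) * K"
            using K u by (intro mult_mono) auto
          finally show "norm ((J y - J x) o\<^sub>L ?u *\<^sub>R B' x (y - x) o\<^sub>L J x)
              \<le> norm (J y - J x) * (norm (B' x) * K)"
            by (simp add: mult.assoc)
        qed
        finally show ?case .
      qed
    qed simp
    show ?thesis
      unfolding has_derivative_at_within using lin tendsto_norm_zero_cancel[OF q] by simp
  qed
  show ?thesis
    unfolding smooth_on_def
  proof
    fix k
    show "Ck_on k S J"
    proof (induction k)
      case 0
      show ?case
        using cont by (auto intro: continuous_at_imp_continuous_on)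
    next
      case (Suc k)
      have "Ck_on k S (\<lambda>x. frechet_derivative B (at x) v)" for v
        using smooth_on_frechet_derivative[OF assms(2)] by (auto simp: smooth_on_def)
      then have "Ck_on k S (\<lambda>x. B' x v)" for v
        by (rule Ck_on_cong[OF assms(1), rotated]) (simp add: frechet_derivative_eq[OF B'])
      then have "Ck_on k S (\<lambda>x. - (J x o\<^sub>L B' x v o\<^sub>L J x))" for v
        by (intro Ck_on_linear[OF assms(1) bounded_linear_minus[OF bounded_linear_ident]]
            Ck_on_bilinear[OF assms(1) bounded_bilinear_blinfun_compose] Suc)
      from Ck_on_SucI[OF assms(1) der this] show ?case .
    qed
  qed
qed

section \<open>Symmetry of second derivatives and bump functions\<close>

text \<open>Mean value inequality in s for the increment of f along t u, corrected by the expected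
  bilinear term. The derivative in s is a difference of two first-order remainders of f' at x,
  whence the factor 2.\<close>

lemma second_difference_bound:
  fixes f :: "'a::real_normed_vector \<Rightarrow> 'b::real_normed_vector" and f' :: "'a \<Rightarrow> 'a \<Rightarrow>\<^sub>L 'b"
  assumes der: "\<And>y. y \<in> ball x d \<Longrightarrow> (f has_derivative f' y) (at y)"
    and lin: "linear f''"
    and bnd: "\<And>y. y \<in> ball x d \<Longrightarrow> norm (f' y - f' x - f'' (y - x)) \<le> e * norm (y - x)"
    and t: "0 < t" "t * N < d" and N: "norm u + norm v \<le> N" and "0 \<le> e"
  shows "norm (f (x + t *\<^sub>R u + t *\<^sub>R v) - f (x + t *\<^sub>R u) - f (x + t *\<^sub>R v) + f x
    - (t * t) *\<^sub>R f'' u v) \<le> 2 * e * (t * t) * (N * N)"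
proof -
  define g where "g s = f (x + t *\<^sub>R u + s *\<^sub>R v) - f (x + s *\<^sub>R v) - s *\<^sub>R (t *\<^sub>R f'' u v)" for s
  define g' where
    "g' s = f' (x + t *\<^sub>R u + s *\<^sub>R v) v - f' (x + s *\<^sub>R v) v - t *\<^sub>R f'' u v" for s
  have in_ball: "x + w \<in> ball x d" "norm w \<le> t * N" if "norm w \<le> t * (norm u + norm v)" for w
  proof -
    show "norm w \<le> t * N"
      using that N t by (meson mult_left_mono less_imp_le order_trans)
    then show "x + w \<in> ball x d" using t by (simp add: dist_norm)
  qed
  have w1: "norm (t *\<^sub>R u + s *\<^sub>R v) \<le> t * (norm u + norm v)"
    and w2: "norm (s *\<^sub>R v) \<le> t * (norm u + norm v)" if "s \<in> {0..t}" for s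
  proof -
    have "norm (s *\<^sub>R v) \<le> t * norm v"
      using that by (simp add: mult_right_mono)
    moreover have "norm (t *\<^sub>R u) = t * norm u" using t by simp
    ultimately show "norm (t *\<^sub>R u + s *\<^sub>R v) \<le> t * (norm u + norm v)"
      using norm_triangle_ineq[of "t *\<^sub>R u" "s *\<^sub>R v"] unfolding distrib_left by linarith
    show "norm (s *\<^sub>R v) \<le> t * (norm u + norm v)"
      using \<open>norm (s *\<^sub>R v) \<le> t * norm v\<close> t
      by (smt (verit) distrib_left mult_nonneg_nonneg norm_ge_zero)
  qed
  have "norm (g t - g 0) \<le> (2 * (e * (t * N)) * N) * norm (t - 0)"
  proof (rule differentiable_bound[where S = "{0..t}" and f' = "\<lambda>s h. h *\<^sub>R g' s"])
    fix s assume s: "s \<in> {0..t}"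
    have d1: "(f has_derivative f' (x + t *\<^sub>R u + s *\<^sub>R v)) (at (x + t *\<^sub>R u + s *\<^sub>R v))"
      using der[OF in_ball(1)[OF w1[OF s]]] by (simp add: add.assoc)
    have d2: "(f has_derivative f' (x + s *\<^sub>R v)) (at (x + s *\<^sub>R v))"
      using der[OF in_ball(1)[OF w2[OF s]]] .
    have "((\<lambda>s. f (x + t *\<^sub>R u + s *\<^sub>R v)) has_derivative
        (\<lambda>h. f' (x + t *\<^sub>R u + s *\<^sub>R v) (h *\<^sub>R v))) (at s within {0..t})"
      by (rule has_derivative_compose[where f = "\<lambda>s. x + t *\<^sub>R u + s *\<^sub>R v", OF _ d1]) (auto intro!: derivative_eq_intros)
    moreover have "((\<lambda>s. f (x + s *\<^sub>R v)) has_derivative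
        (\<lambda>h. f' (x + s *\<^sub>R v) (h *\<^sub>R v))) (at s within {0..t})"
      by (rule has_derivative_compose[where f = "\<lambda>s. x + s *\<^sub>R v", OF _ d2]) (auto intro!: derivative_eq_intros)
    ultimately have "(g has_derivative (\<lambda>h. f' (x + t *\<^sub>R u + s *\<^sub>R v) (h *\<^sub>R v)
        - f' (x + s *\<^sub>R v) (h *\<^sub>R v) - h *\<^sub>R (t *\<^sub>R f'' u v))) (at s within {0..t})"
      unfolding g_def by (intro has_derivative_diff) (auto intro!: derivative_eq_intros)
    then show "(g has_derivative (\<lambda>h. h *\<^sub>R g' s)) (at s within {0..t})"
      by (rule has_derivative_eq_rhs) (simp add: g'_def blinfun.scaleR_right scaleR_diff_right fun_eq_iff)
    let ?a = "f' (x + (t *\<^sub>R u + s *\<^sub>R v)) - f' x - f'' (t *\<^sub>R u + s *\<^sub>R v)"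
    let ?b = "f' (x + s *\<^sub>R v) - f' x - f'' (s *\<^sub>R v)"
    have a: "norm ?a \<le> e * (t * N)"
      by (rule order_trans[OF _ mult_left_mono[OF in_ball(2)[OF w1[OF s]] \<open>0 \<le> e\<close>]])
        (use bnd[OF in_ball(1)[OF w1[OF s]]] in \<open>simp only: add_diff_cancel_left'\<close>)
    have b: "norm ?b \<le> e * (t * N)"
      by (rule order_trans[OF _ mult_left_mono[OF in_ball(2)[OF w2[OF s]] \<open>0 \<le> e\<close>]])
        (use bnd[OF in_ball(1)[OF w2[OF s]]] in \<open>simp only: add_diff_cancel_left'\<close>)
    have "g' s = (?a - ?b) v"
      using lin by (simp add: g'_def linear_add linear_cmul blinfun.bilinear_simps add.assoc)
    also have "norm \<dots> \<le> norm (?a - ?b) * norm v"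
      by (rule norm_blinfun)
    also have "\<dots> \<le> (2 * (e * (t * N))) * N"
    proof (rule mult_mono)
      show "norm (?a - ?b) \<le> 2 * (e * (t * N))"
        using a b norm_triangle_ineq4[of ?a ?b] by linarith
      show "norm v \<le> N" using N norm_ge_zero[of u] by linarith
      show "0 \<le> 2 * (e * (t * N))" using a norm_ge_zero[of ?a] by linarith
    qed simp
    finally show "onorm (\<lambda>h. h *\<^sub>R g' s) \<le> (2 * (e * (t * N))) * N"
      by (intro onorm_le) (simp add: mult.commute mult_left_mono)
  qed (use t in auto)
  then show ?thesis
    using t by (simp add: g_def algebra_simps)
qed

text \<open>The second difference of f is symmetric in u and v, and t^2 f'' approximates it up to an
  arbitrarily small multiple of t^2.\<close>

lemma symmetric_second_derivative:
  fixes f :: "'a::real_normed_vector \<Rightarrow> 'b::real_normed_vector" and f' :: "'a \<Rightarrow> 'a \<Rightarrow>\<^sub>L 'b"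
  assumes "open S" "x \<in> S"
    and der: "\<And>y. y \<in> S \<Longrightarrow> (f has_derivative f' y) (at y)"
    and der2: "(f' has_derivative f'') (at x)"
  shows "f'' u v = f'' v u"
proof -
  \<comment> \<open>The summand 1 keeps N positive when both vectors vanish, since N occurs in
    denominators.\<close>
  define N where "N = norm u + norm v + 1"
  have "N > 0" unfolding N_def by (smt (verit) norm_ge_zero)
  have "norm (f'' u v - f'' v u) \<le> 0 + e" if "e > 0" for e
  proof -
    \<comment> \<open>Two approximations, each with error 2 e' t^2 N^2, add up to e t^2.\<close>
    define e' where "e' = e / (4 * (N * N))"
    have "e' > 0" using \<open>N > 0\<close> \<open>e > 0\<close> by (simp add: e'_def)
    obtain d1 where d1: "d1 > 0" "ball x d1 \<subseteq> S"
      using assms(1,2) openE by blast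
    obtain d2 where d2: "d2 > 0"
      "\<And>y. norm (y - x) < d2 \<Longrightarrow> norm (f' y - f' x - f'' (y - x)) \<le> e' * norm (y - x)"
      using der2 \<open>e' > 0\<close> unfolding has_derivative_at_alt by blast
    define d where "d = min d1 d2"
    define t where "t = d / (2 * N)"
    have t: "t > 0" "t * N < d"
      using d1 d2 \<open>N > 0\<close> by (auto simp: t_def d_def)
    have lin: "linear f''"
      using der2 by (rule has_derivative_linear)
    let ?D = "\<lambda>u v. f (x + t *\<^sub>R u + t *\<^sub>R v) - f (x + t *\<^sub>R u) - f (x + t *\<^sub>R v) + f x"
    have *: "norm (?D u v - (t * t) *\<^sub>R f'' u v) \<le> 2 * e' * (t * t) * (N * N)"
      if "norm u + norm v \<le> N" for u v
    proof (rule second_difference_bound[OF _ lin _ t that])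
      fix y assume "y \<in> ball x d"
      then have "y \<in> S" "norm (y - x) < d2"
        using d1 by (auto simp: d_def dist_norm norm_minus_commute subset_iff)
      then show "(f has_derivative f' y) (at y)"
        "norm (f' y - f' x - f'' (y - x)) \<le> e' * norm (y - x)"
        using der d2 by auto
    qed (use \<open>e' > 0\<close> in auto)
    have eq: "?D v u = ?D u v" by (simp add: add_ac)
    have "norm (?D v u - (t * t) *\<^sub>R f'' v u) \<le> 2 * e' * (t * t) * (N * N)"
      by (rule *) (simp add: N_def)
    then have 1: "norm (?D u v - (t * t) *\<^sub>R f'' v u) \<le> 2 * e' * (t * t) * (N * N)"
      by (simp only: eq)
    have 2: "norm (?D u v - (t * t) *\<^sub>R f'' u v) \<le> 2 * e' * (t * t) * (N * N)"
      by (rule *) (simp add: N_def)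
    have "(t * t) *\<^sub>R (f'' u v - f'' v u)
        = (?D u v - (t * t) *\<^sub>R f'' v u) - (?D u v - (t * t) *\<^sub>R f'' u v)"
      by (simp add: scaleR_diff_right)
    also have "norm \<dots> \<le> 2 * e' * (t * t) * (N * N) + 2 * e' * (t * t) * (N * N)"
      by (rule order_trans[OF norm_triangle_ineq4 add_mono[OF 1 2]])
    finally have "norm ((t * t) *\<^sub>R (f'' u v - f'' v u)) \<le> 4 * e' * (t * t) * (N * N)"
      by linarith
    then have "(t * t) * norm (f'' u v - f'' v u) \<le> (t * t) * (4 * e' * (N * N))"
      by (simp add: mult_ac)
    then have "norm (f'' u v - f'' v u) \<le> 4 * e' * (N * N)"
      using t by (simp add: mult_le_cancel_left_pos)
    also have "\<dots> = e" using \<open>N > 0\<close> by (simp add: e'_def)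
    finally show ?thesis by simp
  qed
  then have "norm (f'' u v - f'' v u) \<le> 0" by (rule field_le_epsilon)
  then show ?thesis by simp
qed

section \<open>Flat functions and cutoffs\<close>

definition flat_fun :: "real poly \<Rightarrow> real \<Rightarrow> real" where
  "flat_fun q x = (if x \<le> 0 then 0 else poly q (1 / x) * exp (- (1 / x)))"

lemma flat_fun_tendsto_0: "(flat_fun q \<longlongrightarrow> 0) (at 0)"
proof -
  have "((\<lambda>y. poly q y * exp (- y)) \<longlongrightarrow> (\<Sum>i\<le>degree q. coeff q i * 0)) at_top"
  proof -
    have "((\<lambda>y. \<Sum>i\<le>degree q. coeff q i * (y ^ i / exp y)) \<longlongrightarrow> (\<Sum>i\<le>degree q. coeff q i * 0)) at_top"
      by (intro tendsto_sum tendsto_mult tendsto_const tendsto_power_div_exp_0)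
    then show ?thesis
      by (simp add: poly_altdef sum_distrib_right exp_minus divide_inverse mult.assoc)
  qed
  then have "((\<lambda>x. poly q (inverse x) * exp (- inverse x)) \<longlongrightarrow> 0) (at_right 0)"
    using filterlim_compose[OF _ filterlim_inverse_at_top_right] by simp
  moreover have "\<forall>\<^sub>F x in at_right 0. poly q (inverse x) * exp (- inverse x) = flat_fun q x"
    using eventually_at_right_less[of 0]
    by eventually_elim (simp add: flat_fun_def divide_inverse)
  ultimately have right: "(flat_fun q \<longlongrightarrow> 0) (at_right 0)"
    by (rule Lim_transform_eventually)
  have "\<forall>\<^sub>F x in at_left 0. 0 = flat_fun q x"
    by (auto simp: flat_fun_def eventually_at_filter)
  then have left: "(flat_fun q \<longlongrightarrow> 0) (at_left 0)"
    by (rule Lim_transform_eventually[OF tendsto_const])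
  show ?thesis
    using left right by (rule filterlim_split_at)
qed

text \<open>The functions q(1/x) exp(-1/x), extended by 0, form a family closed under
  differentiation: q(y) turns into y^2 (q(y) - q'(y)). Keeping the polynomial as a parameter makes
  smoothness a plain induction.\<close>

lemma flat_fun_has_derivative:
  "(flat_fun q has_real_derivative flat_fun (monom 1 2 * (q - pderiv q)) x) (at x)"
proof -
  consider "x < 0" | "x = 0" | "x > 0" by linarith
  then show ?thesis
  proof cases
    case 1
    have "((\<lambda>_. 0) has_real_derivative 0) (at x)" by simp
    then have "(flat_fun q has_real_derivative 0) (at x)"
      using has_field_derivative_transform_within_open[of "\<lambda>_. 0" 0 x "{..<0}" "flat_fun q"] 1
      by (simp add: flat_fun_def)
    then show ?thesis using 1 by (simp add: flat_fun_def)
  next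
    case 2
    \<comment> \<open>The difference quotient at 0 is the member of the family with polynomial y
      q(y), whose limit is already known.\<close>
    have "((\<lambda>h. (flat_fun q (0 + h) - flat_fun q 0) / h) \<longlongrightarrow> 0) (at 0)"
    proof (rule Lim_transform_eventually[OF flat_fun_tendsto_0[of "monom 1 1 * q"]])
      show "\<forall>\<^sub>F h in at 0. flat_fun (monom 1 1 * q) h = (flat_fun q (0 + h) - flat_fun q 0) / h"
        by (auto simp: eventually_at_filter flat_fun_def poly_monom)
    qed
    then show ?thesis using 2 by (simp add: DERIV_def flat_fun_def)
  next
    case 3
    have "((\<lambda>x. poly q (1 / x) * exp (- (1 / x))) has_real_derivative
        poly (monom 1 2 * (q - pderiv q)) (1 / x) * exp (- (1 / x))) (at x)"
      using 3 by (auto intro!: derivative_eq_intros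
          simp: poly_monom power2_eq_square field_simps)
    from has_field_derivative_transform_within_open[OF this, of "{0<..}" "flat_fun q"] 3
    have "(flat_fun q has_real_derivative
        poly (monom 1 2 * (q - pderiv q)) (1 / x) * exp (- (1 / x))) (at x)"
      by (simp add: flat_fun_def)
    then show ?thesis using 3 by (simp add: flat_fun_def)
  qed
qed

lemma smooth_on_flat_fun: "smooth_on UNIV (flat_fun q)"
  unfolding smooth_on_def
proof
  fix k
  show "Ck_on k UNIV (flat_fun q)"
  proof (induction k arbitrary: q)
    case 0
    show ?case
      using flat_fun_has_derivative by (auto intro!: continuous_at_imp_continuous_on DERIV_isCont)
  next
    case (Suc k)
    show ?case
    proof (rule Ck_on_SucI[OF open_UNIV])
      show "(flat_fun q has_derivative (*) (flat_fun (monom 1 2 * (q - pderiv q)) x)) (at x)" for x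
        using flat_fun_has_derivative by (rule has_field_derivative_imp_has_derivative)
      show "Ck_on k UNIV (\<lambda>x. flat_fun (monom 1 2 * (q - pderiv q)) x * v)" for v
        by (rule Ck_on_linear[OF open_UNIV bounded_linear_mult_left Suc])
    qed
  qed
qed

text \<open>The argument r^2 - |x - x0|^2 has a critical point at the centre, so the cutoff has
  derivative 0 there, and multiplying a field by it changes neither the value nor the first
  derivative at x0. The constant \<open>c\<close> normalises the central value.\<close>

lemma bump_function:
  fixes x0 :: "'a::euclidean_space"
  assumes "r > 0"
  obtains \<phi> :: "'a \<Rightarrow> real" where "smooth_on UNIV \<phi>" "\<phi> x0 = 1"
    "(\<phi> has_derivative (\<lambda>_. 0)) (at x0)" "\<And>x. x \<notin> ball x0 r \<Longrightarrow> \<phi> x = 0"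
proof
  define c where "c = flat_fun 1 (r * r)"
  have "c > 0" using assms by (simp add: c_def flat_fun_def zero_less_mult_iff not_le)
  let ?h = "\<lambda>x. r * r - (x - x0) \<bullet> (x - x0)"
  let ?\<phi> = "\<lambda>x. flat_fun 1 (?h x) / c"
  have "smooth_on UNIV ?h"
    by (intro smooth_on_diff smooth_on_bilinear[OF _ bounded_bilinear_inner] smooth_on_id
        smooth_on_const open_UNIV)
  then have "smooth_on UNIV (\<lambda>x. flat_fun 1 (?h x))"
    by (intro smooth_on_compose[OF open_UNIV open_UNIV _ smooth_on_flat_fun]) auto
  then show "smooth_on UNIV ?\<phi>"
    by (rule smooth_on_linear[OF open_UNIV bounded_linear_divide])
  show "?\<phi> x0 = 1"
    using \<open>c > 0\<close> by (simp add: c_def)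
  show "?\<phi> x = 0" if "x \<notin> ball x0 r" for x
  proof -
    have "r * r \<le> norm (x - x0) * norm (x - x0)"
      using that assms by (intro mult_mono) (auto simp: dist_norm norm_minus_commute)
    then show ?thesis
      by (simp add: flat_fun_def dot_square_norm power2_eq_square)
  qed
  have "(?h has_derivative (\<lambda>_. 0)) (at x0)"
    by (auto intro!: derivative_eq_intros)
  from has_derivative_compose[OF this has_field_derivative_imp_has_derivative[OF flat_fun_has_derivative]]
  have "((\<lambda>x. flat_fun 1 (?h x)) has_derivative (\<lambda>_. 0)) (at x0)"
    by simp
  from bounded_linear.has_derivative[OF bounded_linear_divide this]
  show "(?\<phi> has_derivative (\<lambda>_. 0)) (at x0)" by simp
qed

section \<open>Total differential equations\<close>

text \<open>At a maximum point m of the norm, the mean value inequality from 0 to m reads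
  |\<phi>(m)| \<le> |\<phi>(m)|/2 + B. This works because growth constant times interval length is
  below 1.\<close>

lemma small_gronwall:
  fixes \<phi> :: "real \<Rightarrow> 'b::real_normed_vector"
  assumes der: "\<And>t. t \<in> {0..1} \<Longrightarrow> (\<phi> has_vector_derivative \<phi>' t) (at t within {0..1})"
    and "\<phi> 0 = 0"
    and bnd: "\<And>t. t \<in> {0..1} \<Longrightarrow> norm (\<phi>' t) \<le> norm (\<phi> t) / 2 + B"
    and "t \<in> {0..1}"
  shows "norm (\<phi> t) \<le> 2 * B"
proof -
  have "continuous_on {0..1} (\<lambda>t. norm (\<phi> t))"
    by (rule continuous_on_norm[OF continuous_on_vector_derivative[OF der]])
  from continuous_attains_sup[OF compact_Icc _ this]
  obtain m where m: "m \<in> {0..1}" "\<And>t. t \<in> {0..1} \<Longrightarrow> norm (\<phi> t) \<le> norm (\<phi> m)"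
    by fastforce
  have "norm (\<phi> m - \<phi> 0) \<le> (norm (\<phi> m) / 2 + B) * norm (m - 0)"
  proof (rule differentiable_bound[where S = "{0..1}" and f' = "\<lambda>s h. h *\<^sub>R \<phi>' s"])
    fix s :: real assume s: "s \<in> {0..1}"
    show "(\<phi> has_derivative (\<lambda>h. h *\<^sub>R \<phi>' s)) (at s within {0..1})"
      using der[OF s] by (simp add: has_vector_derivative_def)
    have "norm (\<phi>' s) \<le> norm (\<phi> m) / 2 + B"
      using bnd[OF s] m(2)[OF s] by linarith
    then show "onorm (\<lambda>h. h *\<^sub>R \<phi>' s) \<le> norm (\<phi> m) / 2 + B"
      by (intro onorm_le) (simp add: mult.commute mult_left_mono)
  qed (use m in auto)
  also have "\<dots> \<le> (norm (\<phi> m) / 2 + B) * 1"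
    using m(1) order_trans[OF norm_ge_zero bnd[OF m(1)]] by (intro mult_left_mono) auto
  finally have "norm (\<phi> m) \<le> 2 * B"
    using \<open>\<phi> 0 = 0\<close> by simp
  then show ?thesis
    using m(2)[OF \<open>t \<in> {0..1}\<close>] by linarith
qed

text \<open>On a time interval of length 1 the Picard operator contracts the plain supremum norm by
  1/2. The field lives on the whole space, so there is no question of escape; a field given on a
  ball is extended beforehand.\<close>

lemma ode_exists:
  fixes H :: "'b::euclidean_space \<Rightarrow> 'b"
  assumes bnd: "\<And>z. norm (H z) \<le> M"
    and lip: "\<And>y z. norm (H y - H z) \<le> norm (y - z) / 2"
  obtains u where "u 0 = x0"
    "\<And>t. t \<in> {0..1} \<Longrightarrow> (u has_vector_derivative H (u t)) (at t within {0..1})"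
proof -
  have contH: "continuous_on UNIV H"
  proof (rule continuous_at_imp_continuous_on, rule ballI)
    fix z
    have "((\<lambda>y. norm (H y - H z)) \<longlongrightarrow> 0) (at z)"
    proof (rule tendsto_sandwich[OF _ _ tendsto_const])
      have "((\<lambda>y. norm (y - z) / 2) \<longlongrightarrow> norm (z - z) / 2) (at z)"
        by (intro tendsto_intros) auto
      then show "((\<lambda>y. norm (y - z) / 2) \<longlongrightarrow> 0) (at z)" by simp
    qed (use lip in auto)
    then show "isCont H z"
      unfolding isCont_def by (rule LIM_zero_cancel[OF tendsto_norm_zero_cancel])
  qed
  \<comment> \<open>Clamping time to [0,1] turns the Picard integral into a bounded continuous
    function on the whole line, the space in which the fixed point is sought.\<close>
  define c where "c t = min 1 (max 0 t)" for t :: real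
  have c: "c t \<in> {0..1}" for t by (simp add: c_def)
  define T where "T u t = x0 + integral {0..c t} (\<lambda>s. H (apply_bcontfun u s))" for u :: "real \<Rightarrow>\<^sub>C 'b" and t
  have contHu: "continuous_on {a..b} (\<lambda>s. H (apply_bcontfun u s))" for u :: "real \<Rightarrow>\<^sub>C 'b" and a b
    by (rule continuous_on_compose2[OF contH]) auto
  note intHu = integrable_continuous_interval[OF contHu]
  have T_bcont: "T u \<in> bcontfun" for u
  proof (rule bcontfun_normI)
    have "continuous_on {0..1} (\<lambda>t. integral {0..t} (\<lambda>s. H (apply_bcontfun u s)))"
      by (rule indefinite_integral_continuous_1[OF intHu])
    then have "continuous_on UNIV (\<lambda>t. integral {0..c t} (\<lambda>s. H (apply_bcontfun u s)))"
      by (rule continuous_on_compose2) (use c in \<open>auto simp: c_def intro!: continuous_intros\<close>)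
    then show "continuous_on UNIV (T u)"
      unfolding T_def by (intro continuous_on_add continuous_on_const)
    fix t
    have "norm (integral {0..c t} (\<lambda>s. H (apply_bcontfun u s))) \<le> M * (c t - 0)"
      by (rule integral_bound[OF _ contHu]) (use c bnd in auto)
    also have "\<dots> \<le> M * 1"
      using c[of t] order_trans[OF norm_ge_zero bnd] by (intro mult_left_mono) auto
    finally show "norm (T u t) \<le> norm x0 + M"
      unfolding T_def using norm_triangle_ineq[of x0] by (smt (verit))
  qed
  have "\<exists>!u. Bcontfun (T u) = u"
  proof (rule banach_fix_type[where c = "1/2"]; (intro allI)?)
    fix u v :: "real \<Rightarrow>\<^sub>C 'b"
    show "dist (Bcontfun (T u)) (Bcontfun (T v)) \<le> 1/2 * dist u v"
    proof (rule dist_bound)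
      fix t
      let ?u = "apply_bcontfun u" and ?v = "apply_bcontfun v"
      have "T u t - T v t = integral {0..c t} (\<lambda>s. H (?u s) - H (?v s))"
        by (simp add: T_def integral_diff[OF intHu intHu])
      also have "norm \<dots> \<le> (1/2 * dist u v) * (c t - 0)"
      proof (rule integral_bound)
        show "norm (H (?u s) - H (?v s)) \<le> 1/2 * dist u v" for s
          using lip[of "?u s" "?v s"] dist_bounded[of u s v] by (simp add: dist_norm)
      qed (use c in \<open>auto intro!: continuous_on_diff contHu\<close>)
      also have "\<dots> \<le> (1/2 * dist u v) * 1"
        using c[of t] by (intro mult_left_mono) auto
      finally show "dist (apply_bcontfun (Bcontfun (T u)) t) (apply_bcontfun (Bcontfun (T v)) t)
          \<le> 1/2 * dist u v"
        by (simp add: Bcontfun_inverse[OF T_bcont] dist_norm)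
    qed
  qed auto
  then obtain u where "Bcontfun (T u) = u" by auto
  then have u: "apply_bcontfun u = T u"
    using Bcontfun_inverse[OF T_bcont, of u] by simp
  show ?thesis
  proof
    show "apply_bcontfun u 0 = x0"
      by (subst u) (simp add: T_def c_def)
    fix t :: real assume t: "t \<in> {0..1}"
    have "((\<lambda>t. x0 + integral {0..t} (\<lambda>s. H (apply_bcontfun u s))) has_vector_derivative
        0 + H (apply_bcontfun u t)) (at t within {0..1})"
      by (intro has_vector_derivative_add has_vector_derivative_const
          integral_has_vector_derivative contHu t)
    moreover have "apply_bcontfun u s = x0 + integral {0..s} (\<lambda>s. H (apply_bcontfun u s))"
      if "s \<in> {0..1}" for s
    proof -
      have "c s = s" using that by (auto simp: c_def)
      then show ?thesis by (subst u) (simp add: T_def)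
    qed
    ultimately show "(apply_bcontfun u has_vector_derivative H (apply_bcontfun u t)) (at t within {0..1})"
      using has_vector_derivative_transform[OF t, of "apply_bcontfun u"] by simp
  qed
qed

text \<open>The lower bound 1 makes the constants safe as denominators when a radius is
  chosen.\<close>

lemma compact_norm_bound:
  fixes f :: "'a::topological_space \<Rightarrow> 'b::real_normed_vector"
  assumes "compact K" "continuous_on K f"
  obtains M where "M \<ge> 1" "\<And>x. x \<in> K \<Longrightarrow> norm (f x) \<le> M"
proof -
  have "bounded (f ` K)"
    using assms by (intro compact_imp_bounded compact_continuous_image)
  then obtain b where "\<And>x. x \<in> K \<Longrightarrow> norm (f x) \<le> b"
    unfolding bounded_iff by auto
  then show ?thesis
    by (intro that[of "max 1 b"]) (auto intro: max.coboundedI2)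
qed

text \<open>The solution of \<open>Df = G \<circ> f\<close> is constructed along rays: \<open>f x\<close> is the value at time 1 of
  the solution \<open>u\<close> of \<open>u' = G u x\<close>. By integrability of the system, the deviation
  \<open>u\<^sub>x\<^sub>+\<^sub>h(t) - u\<^sub>x(t) - t G(u\<^sub>x(t)) h\<close> satisfies a linear differential inequality with an inhomogeneity
  of order \<open>|h|\<^sup>2\<close>.\<close>

lemma total_differential_equation:
  fixes G :: "'b::euclidean_space \<Rightarrow> 'a::euclidean_space \<Rightarrow>\<^sub>L 'b"
  assumes "r > 0" and smooth: "smooth_on (ball x0 r) G"
    and integrable: "\<And>z u v. z \<in> ball x0 r \<Longrightarrow>
      frechet_derivative G (at z) (G z u) v = frechet_derivative G (at z) (G z v) u"
  shows "\<exists>f \<eta>. \<eta> > 0 \<and> f 0 = x0 \<and> f ` ball 0 \<eta> \<subseteq> ball x0 r \<and>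
    (\<forall>x\<in>ball 0 \<eta>. (f has_derivative G (f x)) (at x))"
proof -
  obtain G' where G'_smooth: "smooth_on (ball x0 r) G'"
    and G': "\<And>z. z \<in> ball x0 r \<Longrightarrow> (G has_derivative blinfun_apply (G' z)) (at z)"
    using smooth_on_blinfun_derivative[OF open_ball smooth] by blast
  obtain G'' where G''_smooth: "smooth_on (ball x0 r) G''"
    and G'': "\<And>z. z \<in> ball x0 r \<Longrightarrow> (G' has_derivative blinfun_apply (G'' z)) (at z)"
    using smooth_on_blinfun_derivative[OF open_ball G'_smooth] by blast
  have sym: "G' z (G z u) v = G' z (G z v) u" if "z \<in> ball x0 r" for z u v
    using integrable[OF that] by (simp add: frechet_derivative_eq[OF G'[OF that]])
  \<comment> \<open>Compactness bounds \<open>G\<close> and its first two derivatives on this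
    smaller ball; convexity turns the bounds into Lipschitz and Taylor estimates.\<close>
  define K where "K = cball x0 (r / 2)"
  have K: "compact K" "convex K" "K \<noteq> {}" "closed K" "K \<subseteq> ball x0 r" "x0 \<in> K"
    using \<open>r > 0\<close> by (auto simp: K_def)
  note cont = continuous_on_subset[OF smooth_on_imp_continuous_on K(5)]
  obtain M where M: "M \<ge> 1" "\<And>z. z \<in> K \<Longrightarrow> norm (G z) \<le> M"
    using compact_norm_bound[OF K(1) cont[OF smooth]] by blast
  obtain L where L: "L \<ge> 1" "\<And>z. z \<in> K \<Longrightarrow> norm (G' z) \<le> L"
    using compact_norm_bound[OF K(1) cont[OF G'_smooth]] by blast
  obtain N where N: "N \<ge> 1" "\<And>z. z \<in> K \<Longrightarrow> norm (G'' z) \<le> N"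
    using compact_norm_bound[OF K(1) cont[OF G''_smooth]] by blast
  have derG: "(G has_derivative G' z) (at z within X)"
    and derG': "(G' has_derivative G'' z) (at z within X)" if "z \<in> K" for z X
    using has_derivative_at_withinI[OF G'] has_derivative_at_withinI[OF G''] that K(5) by blast+
  have lipG: "norm (G y - G z) \<le> L * norm (y - z)" if "y \<in> K" "z \<in> K" for y z
    by (rule differentiable_bound[OF K(2) derG]) (use L that in \<open>auto simp: norm_blinfun.rep_eq[symmetric]\<close>)
  have lipG': "norm (G' y - G' z) \<le> N * norm (y - z)" if "y \<in> K" "z \<in> K" for y z
    by (rule differentiable_bound[OF K(2) derG']) (use N that in \<open>auto simp: norm_blinfun.rep_eq[symmetric]\<close>)
  have taylorG: "norm (G y - G z - G' z (y - z)) \<le> norm (y - z) * (N * norm (y - z))"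
    if "y \<in> K" "z \<in> K" for y z
  proof (rule differentiable_bound_linearization[where S = "closed_segment z y"])
    have sub: "closed_segment z y \<subseteq> K"
      using K(2) that by (simp add: closed_segment_subset)
    show "z + t *\<^sub>R (y - z) \<in> closed_segment z y" if "t \<in> {0..1}" for t
      using that by (auto simp: closed_segment_def algebra_simps intro!: exI[of _ t])
    show "(G has_derivative G' w) (at w within closed_segment z y)" if "w \<in> closed_segment z y" for w
      using derG sub that by blast
    fix w assume w: "w \<in> closed_segment z y"
    have "norm (G' w - G' z) \<le> N * norm (w - z)"
      using lipG' w sub that by blast
    also have "\<dots> \<le> N * norm (y - z)"
      using N(1) segment_bound(1)[OF w] by (intro mult_left_mono) auto
    finally show "onorm (blinfun_apply (G' w) - blinfun_apply (G' z)) \<le> N * norm (y - z)"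
      by (simp add: norm_blinfun.rep_eq minus_blinfun.rep_eq fun_diff_def)
  qed auto
  \<comment> \<open>The first bound keeps the solutions along rays inside \<open>K\<close> during
    unit time. The second gives the constant 1/2 that \<open>ode_exists\<close> and
    \<open>small_gronwall\<close> require.\<close>
  define \<eta> where "\<eta> = min (r / (2 * M)) (1 / (2 * L))"
  have "\<eta> > 0" using \<open>r > 0\<close> M(1) L(1) by (simp add: \<eta>_def)
  have \<eta>M: "M * norm x \<le> r / 2" and \<eta>L: "L * norm x \<le> 1 / 2" if "x \<in> ball 0 \<eta>" for x :: 'a
  proof -
    have "norm x \<le> r / (2 * M)" "norm x \<le> 1 / (2 * L)"
      using that by (auto simp: \<eta>_def)
    then show "M * norm x \<le> r / 2" "L * norm x \<le> 1 / 2"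
      using M(1) L(1) by (simp_all add: field_simps)
  qed
  have "\<exists>u. u 0 = x0 \<and> (\<forall>t\<in>{0..1}. u t \<in> K) \<and>
      (\<forall>t\<in>{0..1}. (u has_vector_derivative G (u t) x) (at t within {0..1}))"
    if x: "x \<in> ball 0 \<eta>" for x
  proof -
    \<comment> \<open>The nearest-point map onto the convex set \<open>K\<close> does not increase
      distances, so it extends the field to the whole space with the same Lipschitz bound. The
      solution stays in \<open>K\<close>, hence solves the original equation.\<close>
    define H where "H z = G (closest_point K z) x" for z
    have cp: "closest_point K z \<in> K" for z
      using K by (simp add: closest_point_in_set)
    have bnd: "norm (H z) \<le> M * norm x" for z
      unfolding H_def using M(2)[OF cp] by (intro order_trans[OF norm_blinfun] mult_right_mono) auto
    have lip: "norm (H y - H z) \<le> norm (y - z) / 2" for y z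
    proof -
      have "norm (H y - H z) \<le> norm (G (closest_point K y) - G (closest_point K z)) * norm x"
        unfolding H_def using norm_blinfun by (metis blinfun.diff_left)
      also have "\<dots> \<le> (L * norm (closest_point K y - closest_point K z)) * norm x"
        by (intro mult_right_mono lipG cp) auto
      also have "\<dots> = (L * norm x) * dist (closest_point K y) (closest_point K z)"
        by (simp add: dist_norm)
      also have "\<dots> \<le> 1 / 2 * dist y z"
        using \<eta>L[OF x] closest_point_lipschitz[OF K(2,4,3)] L(1) by (intro mult_mono) auto
      finally show ?thesis by (simp add: dist_norm)
    qed
    obtain u where u: "u 0 = x0"
      "\<And>t. t \<in> {0..1} \<Longrightarrow> (u has_vector_derivative H (u t)) (at t within {0..1})"
      using ode_exists[of H, OF bnd lip] by blast
    have uK: "u t \<in> K" if t: "t \<in> {0..1}" for t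
    proof -
      have "norm (u t - u 0) \<le> (M * norm x) * norm (t - 0)"
      proof (rule differentiable_bound[where S = "{0..1}" and f' = "\<lambda>s h. h *\<^sub>R H (u s)"])
        fix s :: real assume s: "s \<in> {0..1}"
        show "(u has_derivative (\<lambda>h. h *\<^sub>R H (u s))) (at s within {0..1})"
          using u(2)[OF s] by (simp add: has_vector_derivative_def)
        show "onorm (\<lambda>h. h *\<^sub>R H (u s)) \<le> M * norm x"
          using bnd[of "u s"] by (intro onorm_le) (simp add: mult.commute mult_left_mono)
      qed (use t in auto)
      also have "\<dots> \<le> (r / 2) * 1"
        using \<eta>M[OF x] t M(1) \<open>r > 0\<close> by (intro mult_mono) auto
      finally show ?thesis
        by (simp add: K_def u(1) dist_norm norm_minus_commute)
    qed
    then have "H (u t) = G (u t) x" if "t \<in> {0..1}" for t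
      using that by (simp add: H_def closest_point_self)
    then show ?thesis
      using u uK by metis
  qed
  then obtain u where u0: "\<And>x. x \<in> ball 0 \<eta> \<Longrightarrow> u x 0 = x0"
    and uK: "\<And>x t. x \<in> ball 0 \<eta> \<Longrightarrow> t \<in> {0..1} \<Longrightarrow> u x t \<in> K"
    and du: "\<And>x t. x \<in> ball 0 \<eta> \<Longrightarrow> t \<in> {0..1} \<Longrightarrow>
      (u x has_vector_derivative G (u x t) x) (at t within {0..1})"
    by metis
  \<comment> \<open>Collects the two errors quadratic in h, given that the solutions for x and x + h
    differ by at most 2 M |h|: the Taylor remainder of \<open>G\<close> applied to x, and the change
    of \<open>G\<close> applied to h.\<close>
  define C where "C = N * (2 * M) * (2 * M) * \<eta> + L * (2 * M)"
  have main: "norm (u y 1 - u x 1 - G (u x 1) (y - x)) \<le> 2 * (C * (norm (y - x) * norm (y - x)))"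
    if x: "x \<in> ball 0 \<eta>" and y: "y \<in> ball 0 \<eta>" for x y
  proof -
    define h where "h = y - x"
    have y_eq: "y = x + h" by (simp add: h_def)
    define k where "k t = u y t - u x t" for t
    have dk: "(k has_vector_derivative G (u y t) y - G (u x t) x) (at t within {0..1})"
      if "t \<in> {0..1}" for t
      unfolding k_def by (intro has_vector_derivative_diff du x y that)
    have k_bound: "norm (k t) \<le> 2 * (M * norm h)" if t: "t \<in> {0..1}" for t
    proof (rule small_gronwall[OF dk _ _ t])
      show "k 0 = 0" using x y by (simp add: k_def u0)
      fix t :: real assume t: "t \<in> {0..1}"
      have "G (u y t) y - G (u x t) x = (G (u y t) - G (u x t)) x + G (u y t) h"
        by (simp add: y_eq blinfun.bilinear_simps)
      also have "norm \<dots> \<le> norm (G (u y t) - G (u x t)) * norm x + norm (G (u y t)) * norm h"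
        by (intro order_trans[OF norm_triangle_ineq] add_mono norm_blinfun)
      also have "\<dots> \<le> (L * norm (k t)) * norm x + M * norm h"
        unfolding k_def by (intro add_mono mult_right_mono lipG M(2) uK x y t norm_ge_zero)
      also have "(L * norm (k t)) * norm x = norm (k t) * (L * norm x)" by simp
      also have "\<dots> \<le> norm (k t) * (1 / 2)"
        by (intro mult_left_mono \<eta>L x norm_ge_zero)
      finally show "norm (G (u y t) y - G (u x t) x) \<le> norm (k t) / 2 + M * norm h" by simp
    qed
    define \<delta> where "\<delta> t = k t - t *\<^sub>R G (u x t) h" for t
    define \<delta>' where "\<delta>' t = (G (u y t) y - G (u x t) x)
        - (t *\<^sub>R G' (u x t) (G (u x t) x) h + G (u x t) h)" for t
    have d\<delta>: "(\<delta> has_vector_derivative \<delta>' t) (at t within {0..1})" if t: "t \<in> {0..1}" for t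
    proof -
      have "((\<lambda>t. G (u x t)) has_derivative (\<lambda>s. G' (u x t) (s *\<^sub>R G (u x t) x))) (at t within {0..1})"
        by (rule has_derivative_compose[where f = "u x", OF _ derG])
          (use du[OF x t] uK[OF x t] in \<open>auto simp: has_vector_derivative_def\<close>)
      then have "((\<lambda>t. G (u x t)) has_vector_derivative G' (u x t) (G (u x t) x)) (at t within {0..1})"
        by (simp add: has_vector_derivative_def blinfun.scaleR_right)
      from bounded_linear.has_vector_derivative[OF blinfun.bounded_linear_left this]
      have "((\<lambda>t. G (u x t) h) has_vector_derivative G' (u x t) (G (u x t) x) h) (at t within {0..1})" .
      from has_vector_derivative_scaleR[OF DERIV_ident this]
      have "((\<lambda>t. t *\<^sub>R G (u x t) h) has_vector_derivative
          t *\<^sub>R G' (u x t) (G (u x t) x) h + 1 *\<^sub>R G (u x t) h) (at t within {0..1})" .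
      then show ?thesis
        unfolding \<delta>_def \<delta>'_def using has_vector_derivative_diff[OF dk[OF t]] by simp
    qed
    have "norm (\<delta> 1) \<le> 2 * (C * (norm h * norm h))"
    proof (rule small_gronwall[OF d\<delta>])
      show "\<delta> 0 = 0" using x y by (simp add: \<delta>_def k_def u0)
      fix t :: real assume t: "t \<in> {0..1}"
      let ?z = "u x t"
      let ?E = "G (u y t) - G ?z - G' ?z (k t)"
      have z: "?z \<in> K" "u y t \<in> K" "?z \<in> ball x0 r" using uK[OF x t] uK[OF y t] K(5) by blast+
      have k: "k t = \<delta> t + t *\<^sub>R G ?z h" by (simp add: \<delta>_def)
      \<comment> \<open>Integrability enters here: it exchanges x and h in the derivative of t G(u x
        t) h. The first-order terms then combine to G' in direction \<delta>, and only quadratic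
        errors remain.\<close>
      have "\<delta>' t = G' ?z (k t) x + ?E x + (G (u y t) - G ?z) h - t *\<^sub>R G' ?z (G ?z h) x"
        unfolding \<delta>'_def sym[OF z(3), of x h] by (simp add: y_eq blinfun.bilinear_simps)
      also have "\<dots> = G' ?z (\<delta> t) x + (?E x + (G (u y t) - G ?z) h)"
        by (subst (1) k) (simp add: blinfun.bilinear_simps)
      also have "norm \<dots> \<le> norm (G' ?z (\<delta> t) x) + (norm (?E x) + norm ((G (u y t) - G ?z) h))"
        by (intro order_trans[OF norm_triangle_ineq] add_mono norm_triangle_ineq order_refl)
      also have "\<dots> \<le> norm (\<delta> t) / 2
          + ((norm h * norm h) * (N * (2 * M) * (2 * M) * \<eta>) + (norm h * norm h) * (L * (2 * M)))"
      proof (intro add_mono)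
        have "norm (G' ?z (\<delta> t) x) \<le> (norm (G' ?z) * norm (\<delta> t)) * norm x"
          by (intro order_trans[OF norm_blinfun] mult_right_mono norm_blinfun norm_ge_zero)
        also have "\<dots> \<le> (L * norm (\<delta> t)) * norm x"
          by (intro mult_right_mono L(2) z norm_ge_zero)
        also have "\<dots> = norm (\<delta> t) * (L * norm x)" by simp
        also have "\<dots> \<le> norm (\<delta> t) * (1 / 2)"
          by (intro mult_left_mono \<eta>L x norm_ge_zero)
        finally show "norm (G' ?z (\<delta> t) x) \<le> norm (\<delta> t) / 2" by simp
        have kt: "norm (k t) \<le> norm h * (2 * M)"
          using k_bound[OF t] by (simp add: mult_ac)
        have "norm (?E x) \<le> norm ?E * norm x" by (rule norm_blinfun)
        also have "\<dots> \<le> (norm (k t) * (N * norm (k t))) * norm x"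
          using taylorG[OF z(2,1)] by (intro mult_right_mono) (simp_all add: k_def)
        also have "\<dots> \<le> ((norm h * (2 * M)) * (N * (norm h * (2 * M)))) * \<eta>"
          using kt N(1) M(1) x by (intro mult_mono mult_nonneg_nonneg) auto
        finally show "norm (?E x) \<le> (norm h * norm h) * (N * (2 * M) * (2 * M) * \<eta>)"
          by (simp add: mult_ac)
        have "norm ((G (u y t) - G ?z) h) \<le> norm (G (u y t) - G ?z) * norm h"
          by (rule norm_blinfun)
        also have "\<dots> \<le> (L * norm (k t)) * norm h"
          using lipG[OF z(2,1)] by (intro mult_right_mono) (simp_all add: k_def)
        also have "\<dots> \<le> (L * (norm h * (2 * M))) * norm h"
          using kt L(1) M(1) by (intro mult_mono) auto
        finally show "norm ((G (u y t) - G ?z) h) \<le> (norm h * norm h) * (L * (2 * M))"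
          by (simp add: mult_ac)
      qed
      finally show "norm (\<delta>' t) \<le> norm (\<delta> t) / 2 + C * (norm h * norm h)"
        by (simp add: C_def algebra_simps)
    qed auto
    then show ?thesis by (simp add: \<delta>_def k_def h_def)
  qed
  show ?thesis
  proof (rule exI[of _ "\<lambda>x. u x 1"], rule exI[of _ \<eta>], intro conjI ballI)
    show "\<eta> > 0" by fact
    show "u 0 1 = x0"
    proof -
      have "(0 :: 'a) \<in> ball 0 \<eta>" using \<open>\<eta> > 0\<close> by simp
      have "norm (u 0 1 - x0) \<le> 2 * 0"
      proof (rule small_gronwall[where \<phi>' = "\<lambda>_. 0"])
        show "((\<lambda>t. u 0 t - x0) has_vector_derivative 0) (at t within {0..1})" if "t \<in> {0..1}" for t
          using has_vector_derivative_diff[OF du[OF \<open>0 \<in> ball 0 \<eta>\<close> that] has_vector_derivative_const]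
          by simp
        show "u 0 0 - x0 = 0" using u0[OF \<open>0 \<in> ball 0 \<eta>\<close>] by simp
      qed auto
      then show ?thesis by simp
    qed
    show "(\<lambda>x. u x 1) ` ball 0 \<eta> \<subseteq> ball x0 r"
      using uK[of _ 1] K(5) by auto
    fix x :: 'a assume x: "x \<in> ball 0 \<eta>"
    then obtain e where e: "e > 0" "ball x e \<subseteq> ball 0 \<eta>"
      using openE[OF open_ball] by metis
    show "((\<lambda>x. u x 1) has_derivative G (u x 1)) (at x)"
    proof (rule has_derivativeI_sandwich[OF e(1)])
      show "((\<lambda>y. 2 * C * norm (y - x)) \<longlongrightarrow> 0) (at x)"
      proof -
        have "((\<lambda>y. 2 * C * norm (y - x)) \<longlongrightarrow> 2 * C * norm (x - x)) (at x)"
          by (intro tendsto_intros)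
        then show ?thesis by simp
      qed
      fix y assume "y \<noteq> x" "dist y x < e"
      then have "y \<in> ball 0 \<eta>" using e(2) by (auto simp: dist_commute)
      from main[OF x this] \<open>y \<noteq> x\<close>
      show "norm (u y 1 - u x 1 - G (u x 1) (y - x)) / norm (y - x) \<le> 2 * C * norm (y - x)"
        by (simp add: divide_le_eq mult_ac)
    qed (rule blinfun.bounded_linear_right)
  qed
qed

section \<open>The Frobenius theorem for the range of a smooth family of projections\<close>

text \<open>The estimate |v| \<le> 2 |B v| gives injectivity, hence invertibility in finite
  dimension, and also the bound on the inverse that \<open>smooth_on_blinfun_inverse\<close> asks
  for.\<close>

lemma blinfun_near_id_inverse:
  fixes B :: "'a::euclidean_space \<Rightarrow>\<^sub>L 'a"
  assumes "norm (B - id_blinfun) \<le> 1 / 2"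
  obtains J where "J o\<^sub>L B = id_blinfun" "B o\<^sub>L J = id_blinfun" "norm J \<le> 2"
proof -
  have low: "norm v \<le> 2 * norm (B v)" for v
  proof -
    have "norm (B v - v) \<le> norm (B - id_blinfun) * norm v"
      using norm_blinfun[of "B - id_blinfun" v] by (simp add: blinfun.diff_left)
    also have "\<dots> \<le> 1 / 2 * norm v"
      using assms by (intro mult_right_mono) auto
    finally show ?thesis
      using norm_triangle_ineq2[of v "B v"] by (simp add: norm_minus_commute)
  qed
  have lin: "linear (blinfun_apply B)"
    by (rule bounded_linear.linear[OF blinfun.bounded_linear_right])
  have inj: "inj (blinfun_apply B)"
    unfolding linear_injective_0[OF lin]
  proof (intro allI impI)
    show "v = 0" if "B v = 0" for v using low[of v] that by simp
  qed
  obtain h where h: "linear h" "h \<circ> blinfun_apply B = id"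
    using linear_injective_left_inverse[OF lin inj] by blast
  have h2: "blinfun_apply B \<circ> h = id"
    using linear_inverse_left[OF h(1) lin] h(2) by simp
  have bl: "bounded_linear h"
    using h(1) by (simp add: linear_conv_bounded_linear)
  have hB: "h (B v) = v" and Bh: "B (h v) = v" for v
    using h(2) h2 by (auto simp: fun_eq_iff)
  show ?thesis
  proof
    show "Blinfun h o\<^sub>L B = id_blinfun" "B o\<^sub>L Blinfun h = id_blinfun"
      by (auto intro!: blinfun_eqI simp: bounded_linear_Blinfun_apply[OF bl] hB Bh)
    show "norm (Blinfun h) \<le> 2"
    proof (rule norm_blinfun_bound)
      show "norm (Blinfun h v) \<le> 2 * norm v" for v
        using low[of "h v"] by (simp add: bounded_linear_Blinfun_apply[OF bl] Bh)
    qed simp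
  qed
qed

text \<open>The distribution is encoded as the ranges of smooth projections. \<open>G z\<close>
  inverts \<open>P0\<close> restricted to the range of \<open>P z\<close> and kills the kernel of
  \<open>P0\<close>. Hence Df = G(f) can be solved on the full model space, and W, the range of
  \<open>P0\<close>, only selects the directions in which f is immersive. Involutivity is assumed
  for fields on smaller open sets because the frame exists only near x0.\<close>

lemma frobenius_projection:
  fixes P :: "'a::euclidean_space \<Rightarrow> 'a \<Rightarrow>\<^sub>L 'a"
  assumes "open V" "x0 \<in> V" and smooth: "smooth_on V P"
    and proj: "\<And>x v. x \<in> V \<Longrightarrow> P x (P x v) = P x v"
    and involutive: "\<And>T \<xi> \<zeta> z. open T \<Longrightarrow> T \<subseteq> V \<Longrightarrow> smooth_on T \<xi> \<Longrightarrow> smooth_on T \<zeta> \<Longrightarrow>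
      (\<And>x. x \<in> T \<Longrightarrow> P x (\<xi> x) = \<xi> x) \<Longrightarrow> (\<And>x. x \<in> T \<Longrightarrow> P x (\<zeta> x) = \<zeta> x) \<Longrightarrow> z \<in> T \<Longrightarrow>
      P z (frechet_derivative \<zeta> (at z) (\<xi> z) - frechet_derivative \<xi> (at z) (\<zeta> z))
        = frechet_derivative \<zeta> (at z) (\<xi> z) - frechet_derivative \<xi> (at z) (\<zeta> z)"
  shows "\<exists>W U (f :: 'a \<Rightarrow> 'a) f'. subspace W \<and> open U \<and> 0 \<in> U \<and> smooth_on U f \<and> f 0 = x0 \<and> f ` U \<subseteq> V \<and>
    (\<forall>x\<in>U. (f has_derivative f' x) (at x) \<and> inj_on (f' x) W \<and> f' x ` W = {v. P (f x) v = v})"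
proof -
  define P0 where "P0 = P x0"
  have P0: "P0 (P0 v) = P0 v" for v
    unfolding P0_def by (rule proj[OF assms(2)])
  text \<open>\<open>C z\<close> maps the range of \<open>P z\<close> to the range of \<open>P0\<close>, where it agrees with \<open>P0\<close>.\<close>
  define C where "C z = (P0 o\<^sub>L P z) + ((id_blinfun - P0) o\<^sub>L (id_blinfun - P z))" for z
  have C_apply: "C z v = P0 (P z v) + (v - P z v - P0 (v - P z v))" for z v
    by (simp add: C_def blinfun.bilinear_simps)
  have C_smooth: "smooth_on V C"
    unfolding C_def
    by (intro smooth_on_add smooth_on_blinfun_compose smooth_on_const smooth_on_diff smooth \<open>open V\<close>)
  have "C x0 = id_blinfun"
    by (rule blinfun_eqI) (simp add: C_apply P0 flip: P0_def, simp add: blinfun.bilinear_simps P0)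
  moreover have "isCont C x0"
    using smooth_on_imp_continuous_on[OF C_smooth] assms(1,2) by (simp add: continuous_on_eq_continuous_at)
  ultimately obtain d where d: "d > 0" "\<And>z. dist z x0 < d \<Longrightarrow> dist (C z) id_blinfun < 1 / 2"
    unfolding continuous_at_eps_delta by (metis half_gt_zero zero_less_one)
  obtain e where e: "e > 0" "ball x0 e \<subseteq> V"
    using openE[OF assms(1,2)] .
  define r where "r = min d e"
  have r: "r > 0" "ball x0 r \<subseteq> V"
    using d e by (auto simp: r_def)
  have rC: "norm (C z - id_blinfun) \<le> 1 / 2" if "z \<in> ball x0 r" for z
    using d(2)[of z] that by (simp add: r_def dist_commute flip: dist_norm)
  have "\<exists>J. J o\<^sub>L C z = id_blinfun \<and> C z o\<^sub>L J = id_blinfun \<and> norm J \<le> 2" if "z \<in> ball x0 r" for z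
    using blinfun_near_id_inverse[OF rC[OF that]] by metis
  then obtain J where J1: "\<And>z. z \<in> ball x0 r \<Longrightarrow> J z o\<^sub>L C z = id_blinfun"
    and J2: "\<And>z. z \<in> ball x0 r \<Longrightarrow> C z o\<^sub>L J z = id_blinfun"
    and Jn: "\<And>z. z \<in> ball x0 r \<Longrightarrow> norm (J z) \<le> 2"
    by metis
  have JC: "J z (C z v) = v" and CJ: "C z (J z v) = v" if "z \<in> ball x0 r" for z v
    using J1[OF that] J2[OF that]
    by (metis blinfun_apply_blinfun_compose blinfun_apply_id_blinfun id_apply)+
  have J_smooth: "smooth_on (ball x0 r) J"
    by (rule smooth_on_blinfun_inverse[OF open_ball smooth_on_subset[OF C_smooth r(2)] J1 J2 Jn])
  define G where "G z = J z o\<^sub>L P0" for z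
  have G_smooth: "smooth_on (ball x0 r) G"
    unfolding G_def by (intro smooth_on_blinfun_compose smooth_on_const J_smooth open_ball)
  have C_range: "C z v = P0 v" if "P z v = v" for z v
    using that by (simp add: C_apply)
  have GP0: "G z (P0 v) = v" "G z v = v" if "z \<in> ball x0 r" "P z v = v" for z v
    using JC[OF that(1), of v] by (simp_all add: G_def P0 C_range[OF that(2)])
  \<comment> \<open>\<open>C z\<close> intertwines \<open>P z\<close> with \<open>P0\<close>, so its
    inverse carries the range of \<open>P0\<close> into the range of \<open>P z\<close>.\<close>
  have PG: "P z (G z u) = G z u" if z: "z \<in> ball x0 r" for z u
  proof -
    have "C z (P z (G z u)) = P0 (P z (G z u))"
      using z r(2) by (intro C_range proj) auto
    also have "\<dots> = P0 (C z (G z u))"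
      by (simp add: C_apply blinfun.bilinear_simps P0)
    also have "\<dots> = C z (G z u)"
      by (simp add: G_def CJ[OF z] P0)
    finally show ?thesis
      using JC[OF z] by metis
  qed
  have P0G: "P0 (G z u) = P0 u" if z: "z \<in> ball x0 r" for z u
    using C_range[OF PG[OF z]] by (simp add: G_def CJ[OF z])
  have sym: "frechet_derivative G (at z) (G z u) v = frechet_derivative G (at z) (G z v) u"
    if z: "z \<in> ball x0 r" for z u v
  proof -
    let ?D = "frechet_derivative G (at z)"
    have der: "((\<lambda>y. G y w) has_derivative (\<lambda>h. ?D h w)) (at z)" for w
      by (rule bounded_linear.has_derivative[OF blinfun.bounded_linear_left
            smooth_on_has_derivative[OF G_smooth z]])
    \<comment> \<open>The frame fields have constant image under \<open>P0\<close>, so their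
      derivatives lie in its kernel.\<close>
    have P0D: "P0 (?D h w) = 0" for h w
    proof -
      have "((\<lambda>y. P0 (G y w)) has_derivative (\<lambda>h. P0 (?D h w))) (at z)"
        by (rule bounded_linear.has_derivative[OF blinfun.bounded_linear_right der])
      then have "((\<lambda>y. P0 w) has_derivative (\<lambda>h. P0 (?D h w))) (at z)"
        by (rule has_derivative_transform_within_open[OF _ open_ball z]) (simp add: P0G)
      then have "(\<lambda>h. P0 (?D h w)) = (\<lambda>h. 0)"
        by (rule has_derivative_unique) (rule has_derivative_const)
      then show ?thesis by (simp add: fun_eq_iff)
    qed
    have Gw: "smooth_on (ball x0 r) (\<lambda>y. G y w)" for w
      by (intro smooth_on_blinfun_apply G_smooth smooth_on_const open_ball)
    let ?b = "?D (G z u) v - ?D (G z v) u"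
    have "P z (frechet_derivative (\<lambda>y. G y v) (at z) (G z u) - frechet_derivative (\<lambda>y. G y u) (at z) (G z v))
        = frechet_derivative (\<lambda>y. G y v) (at z) (G z u) - frechet_derivative (\<lambda>y. G y u) (at z) (G z v)"
      by (rule involutive[OF open_ball r(2) Gw[of u] Gw[of v] _ _ z]) (erule PG)+
    then have "P z ?b = ?b"
      unfolding frechet_derivative_eq[OF der] .
    \<comment> \<open>A vector in the range of \<open>P z\<close> is determined by its image under
      \<open>P0\<close>, and for the bracket that image is 0.\<close>
    then have "?b = G z (P0 ?b)"
      by (rule GP0(1)[OF z, symmetric])
    also have "\<dots> = 0"
      by (simp add: blinfun.diff_right P0D)
    finally show ?thesis by simp
  qed
  have "\<exists>f \<eta>. \<eta> > 0 \<and> f 0 = x0 \<and> f ` ball 0 \<eta> \<subseteq> ball x0 r \<and>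
      (\<forall>x\<in>ball 0 \<eta>. (f has_derivative G (f x)) (at x))"
    by (rule total_differential_equation[OF r(1) G_smooth]) (rule sym)
  then obtain f \<eta> where f_conj: "\<eta> > 0 \<and> f 0 = x0 \<and> f ` ball 0 \<eta> \<subseteq> ball x0 r \<and>
      (\<forall>x\<in>ball 0 \<eta>. (f has_derivative G (f x)) (at x))"
    by (elim exE) (rule that)
  then have f: "\<eta> > 0" "f 0 = x0" "f ` ball 0 \<eta> \<subseteq> ball x0 r"
    and df: "\<And>x. x \<in> ball 0 \<eta> \<Longrightarrow> (f has_derivative G (f x)) (at x)"
    by blast+
  show ?thesis
  proof (rule exI[of _ "range P0"], rule exI[of _ "ball 0 \<eta>"], rule exI[of _ f],
      rule exI[of _ "\<lambda>x. blinfun_apply (G (f x))"], intro conjI ballI)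
    show "subspace (range P0)"
      using bounded_linear.linear[OF blinfun.bounded_linear_right] by (rule linear_subspace_image) simp
    show "smooth_on (ball 0 \<eta>) f"
      by (rule smooth_on_autonomous[OF open_ball open_ball f(3) G_smooth df])
    show "f ` ball 0 \<eta> \<subseteq> V" using f(3) r(2) by blast
    fix x :: 'a assume x: "x \<in> ball 0 \<eta>"
    then have fx: "f x \<in> ball x0 r" using f(3) by blast
    show "(f has_derivative G (f x)) (at x)" by (rule df[OF x])
    show "inj_on (G (f x)) (range P0)"
    proof (rule inj_onI)
      fix v w assume v: "v \<in> range P0" and w: "w \<in> range P0" and eq: "G (f x) v = G (f x) w"
      have "P0 v = v" using v by (rule imageE) (simp only: P0)
      then have "v = P0 v" ..
      also have "P0 v = P0 w"
        using arg_cong[OF eq, of "blinfun_apply P0"] unfolding P0G[OF fx] .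
      also have "P0 w = w" using w by (rule imageE) (simp only: P0)
      finally show "v = w" .
    qed
    show "G (f x) ` range P0 = {v. P (f x) v = v}"
    proof (intro equalityI subsetI)
      show "v \<in> {v. P (f x) v = v}" if "v \<in> G (f x) ` range P0" for v
        using that PG[OF fx] by auto
      show "v \<in> G (f x) ` range P0" if "v \<in> {v. P (f x) v = v}" for v
        using GP0(1)[OF fx, of v] that by (intro image_eqI[of v _ "P0 v"]) auto
    qed
  qed (use f in auto)
qed

section \<open>Coordinate changes and vector fields\<close>

lemma dual_map_apply [simp]: "dual_map B \<sigma> v = \<sigma> (B v)"
  by (simp add: dual_map.rep_eq)

locale manifold =
  fixes A :: "('m::{t2_space,second_countable_topology}, 'e::euclidean_space) chart set"
  assumes atlas: "smooth_atlas A"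
begin

definition overlap :: "('m, 'e) chart \<Rightarrow> ('m, 'e) chart \<Rightarrow> 'e set" where
  "overlap c c' = snd c ` (fst c \<inter> fst c')"

definition trans_map :: "('m, 'e) chart \<Rightarrow> ('m, 'e) chart \<Rightarrow> 'e \<Rightarrow> 'e" where
  "trans_map c c' x = snd c' (chart_inv c x)"

lemma chart_homeo:
  "c \<in> A \<Longrightarrow> homeomorphism (fst c) (snd c ` fst c) (snd c) (chart_inv c)"
  using atlas by (simp add: smooth_atlas_def)

lemma open_chart [intro, simp]: "c \<in> A \<Longrightarrow> open (fst c)" "c \<in> A \<Longrightarrow> open (snd c ` fst c)"
  using atlas by (simp_all add: smooth_atlas_def)

lemma chart_inv_chart [simp]: "c \<in> A \<Longrightarrow> q \<in> fst c \<Longrightarrow> chart_inv c (snd c q) = q"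
  using chart_homeo by (simp add: homeomorphism_def)

lemma chart_inv_continuous: "c \<in> A \<Longrightarrow> continuous_on (snd c ` fst c) (chart_inv c)"
  using chart_homeo by (simp add: homeomorphism_def)

lemma overlap_eq: "c \<in> A \<Longrightarrow> overlap c c' = snd c ` fst c \<inter> chart_inv c -` fst c'"
  by (auto simp: overlap_def)

lemma open_chart_inv_vimage:
  "c \<in> A \<Longrightarrow> open S \<Longrightarrow> open (snd c ` fst c \<inter> chart_inv c -` S)"
  by (intro continuous_open_preimage chart_inv_continuous open_chart)

lemma open_overlap [intro, simp]: "c \<in> A \<Longrightarrow> c' \<in> A \<Longrightarrow> open (overlap c c')"
  by (simp add: overlap_eq open_chart_inv_vimage)

lemma overlapI: "q \<in> fst c \<Longrightarrow> q \<in> fst c' \<Longrightarrow> snd c q \<in> overlap c c'"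
  by (auto simp: overlap_def)

lemma smooth_trans_map: "c \<in> A \<Longrightarrow> c' \<in> A \<Longrightarrow> smooth_on (overlap c c') (trans_map c c')"
  using atlas unfolding smooth_atlas_def overlap_def trans_map_def comp_def by blast

lemma trans_map_image: "c \<in> A \<Longrightarrow> c' \<in> A \<Longrightarrow> x \<in> overlap c c' \<Longrightarrow> trans_map c c' x \<in> overlap c' c"
  by (auto simp: overlap_def trans_map_def)

lemma coord_change_derivative:
  assumes "c \<in> A" "c' \<in> A" "q \<in> fst c" "q \<in> fst c'"
  shows "(trans_map c c' has_derivative coord_change c c' q) (at (snd c q))"
proof -
  have d: "(trans_map c c' has_derivative frechet_derivative (trans_map c c') (at (snd c q))) (at (snd c q))"
    by (rule smooth_on_has_derivative[OF smooth_trans_map[OF assms(1,2)] overlapI[OF assms(3,4)]])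
  have "coord_change c c' q = Blinfun (frechet_derivative (trans_map c c') (at (snd c q)))"
    by (simp add: coord_change_def trans_map_def[abs_def] comp_def)
  then show ?thesis
    using d by (simp add: bounded_linear_Blinfun_apply[OF has_derivative_bounded_linear[OF d]])
qed

lemma smooth_coord_change:
  assumes "c \<in> A" "c' \<in> A"
  shows "smooth_on (overlap c c') (\<lambda>x. coord_change c c' (chart_inv c x))"
proof -
  obtain D where D: "smooth_on (overlap c c') D"
    "\<And>x. x \<in> overlap c c' \<Longrightarrow> (trans_map c c' has_derivative blinfun_apply (D x)) (at x)"
    using smooth_on_blinfun_derivative[OF open_overlap[OF assms] smooth_trans_map[OF assms]] by blast
  show ?thesis
  proof (rule smooth_on_cong[OF open_overlap[OF assms] _ D(1)])
    fix x assume x: "x \<in> overlap c c'"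
    then obtain q where q: "q \<in> fst c" "q \<in> fst c'" "x = snd c q"
      by (auto simp: overlap_def)
    have "blinfun_apply (D x) = blinfun_apply (coord_change c c' q)"
      using has_derivative_unique[OF D(2)[OF x]] coord_change_derivative[OF assms q(1,2)] q(3) by simp
    then show "D x = coord_change c c' (chart_inv c x)"
      using q assms by (simp add: blinfun_apply_inject)
  qed
qed

lemma coord_change_self: "c \<in> A \<Longrightarrow> q \<in> fst c \<Longrightarrow> coord_change c c q = id_blinfun"
proof (rule blinfun_eqI)
  fix v
  assume c: "c \<in> A" "q \<in> fst c"
  have "(trans_map c c has_derivative (\<lambda>v. v)) (at (snd c q))"
    by (rule has_derivative_transform_within_open[OF has_derivative_ident open_chart(2)[OF c(1)]])
      (use c in \<open>auto simp: trans_map_def\<close>)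
  from has_derivative_unique[OF this coord_change_derivative[OF c(1,1) c(2,2)]]
  show "coord_change c c q v = id_blinfun v"
    by (simp add: fun_eq_iff)
qed

text \<open>Chain rule for transition maps. Since \<open>to_chart\<close> and
  \<open>from_chart\<close> are coordinate changes with the preferred chart, it eliminates that
  chart from the pointwise transformation rules.\<close>

lemma coord_change_cocycle:
  assumes "c \<in> A" "c' \<in> A" "c'' \<in> A" "q \<in> fst c" "q \<in> fst c'" "q \<in> fst c''"
  shows "coord_change c' c'' q (coord_change c c' q v) = coord_change c c'' q v"
proof -
  have "trans_map c c' (snd c q) = snd c' q"
    using assms by (simp add: trans_map_def)
  then have "((\<lambda>x. trans_map c' c'' (trans_map c c' x)) has_derivative
      (\<lambda>v. coord_change c' c'' q (coord_change c c' q v))) (at (snd c q))"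
    using coord_change_derivative[OF assms(2,3,5,6)]
    by (intro has_derivative_compose[OF coord_change_derivative[OF assms(1,2,4,5)]]) simp
  then have "(trans_map c c'' has_derivative
      (\<lambda>v. coord_change c' c'' q (coord_change c c' q v))) (at (snd c q))"
    by (rule has_derivative_transform_within_open[OF _ open_overlap[OF assms(1,2)] overlapI[OF assms(4,5)]])
      (use assms in \<open>auto simp: trans_map_def overlap_def\<close>)
  from has_derivative_unique[OF this coord_change_derivative[OF assms(1,3,4,6)]]
  show ?thesis by (simp add: fun_eq_iff)
qed

lemma chart_at: "chart_at A q \<in> A" "q \<in> fst (chart_at A q)"
proof -
  have "\<exists>c. c \<in> A \<and> q \<in> fst c"
    using atlas unfolding smooth_atlas_def by blast
  from someI_ex[OF this] show "chart_at A q \<in> A" "q \<in> fst (chart_at A q)"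
    by (simp_all add: chart_at_def)
qed

lemma to_from_chart [simp]: "c \<in> A \<Longrightarrow> q \<in> fst c \<Longrightarrow> to_chart A c q (from_chart A c q v) = v"
  and from_to_chart [simp]: "c \<in> A \<Longrightarrow> q \<in> fst c \<Longrightarrow> from_chart A c q (to_chart A c q v) = v"
  and to_from_chart_change:
    "c \<in> A \<Longrightarrow> c' \<in> A \<Longrightarrow> q \<in> fst c \<Longrightarrow> q \<in> fst c' \<Longrightarrow>
      to_chart A c' q (from_chart A c q v) = coord_change c c' q v"
  using chart_at[of q] by (simp_all add: to_chart_def from_chart_def coord_change_cocycle coord_change_self)

lemma to_chart_change:
  "c \<in> A \<Longrightarrow> c' \<in> A \<Longrightarrow> q \<in> fst c \<Longrightarrow> q \<in> fst c' \<Longrightarrow>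
    coord_change c c' q (to_chart A c q v) = to_chart A c' q v"
  using chart_at[of q] by (simp add: to_chart_def coord_change_cocycle)

section \<open>Local expressions, brackets and extension of fields\<close>

lemma vec_in_chart_apply: "vec_in_chart A c X x = to_chart A c (chart_inv c x) (X (chart_inv c x))"
  by (simp add: vec_in_chart_def Let_def)

lemma vec_in_chart_change:
  assumes "c \<in> A" "c' \<in> A" "x \<in> overlap c c'"
  shows "vec_in_chart A c' X (trans_map c c' x)
    = coord_change c c' (chart_inv c x) (vec_in_chart A c X x)"
  using assms by (auto simp: vec_in_chart_apply trans_map_def overlap_def to_chart_change)

lemma vec_in_chart_zero [simp]: "vec_in_chart A c (\<lambda>_. 0) = (\<lambda>_. 0)"
  by (simp add: vec_in_chart_apply fun_eq_iff)

lemma covec_in_chart_zero [simp]: "covec_in_chart A c (\<lambda>_. 0) = (\<lambda>_. 0)"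
  by (auto simp: covec_in_chart_def fun_eq_iff intro!: blinfun_eqI)

lemma vec_in_chart_endo:
  fixes j :: "'m \<Rightarrow> 'e \<Rightarrow>\<^sub>L 'e"
  shows "c \<in> A \<Longrightarrow> x \<in> snd c ` fst c \<Longrightarrow>
    vec_in_chart A c (\<lambda>q. j q (X q)) x = endo_in_chart A c j x (vec_in_chart A c X x)"
  by (auto simp: vec_in_chart_apply endo_in_chart_def)

lemma covec_in_chart_bilin:
  fixes w :: "'m \<Rightarrow> 'e \<Rightarrow>\<^sub>L 'e cotan"
  shows "c \<in> A \<Longrightarrow> x \<in> snd c ` fst c \<Longrightarrow>
    covec_in_chart A c (\<lambda>q. w q (X q)) x = bilin_in_chart A c w x (vec_in_chart A c X x)"
  by (auto simp: covec_in_chart_def vec_in_chart_apply bilin_in_chart_def)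

lemma smooth_vec_endo:
  fixes j :: "'m \<Rightarrow> 'e \<Rightarrow>\<^sub>L 'e"
  assumes "smooth_endo A j" "smooth_vec A X"
  shows "smooth_vec A (\<lambda>q. j q (X q))"
  unfolding smooth_vec_def
proof
  fix c assume c: "c \<in> A"
  have "smooth_on (snd c ` fst c) (\<lambda>x. endo_in_chart A c j x (vec_in_chart A c X x))"
    using assms c by (intro smooth_on_blinfun_apply) (auto simp: smooth_endo_def smooth_vec_def)
  then show "smooth_on (snd c ` fst c) (vec_in_chart A c (\<lambda>q. j q (X q)))"
    by (rule smooth_on_cong[OF open_chart(2)[OF c], rotated]) (simp add: vec_in_chart_endo c)
qed

lemma smooth_vec_zero: "smooth_vec A (\<lambda>_. 0)"
  by (simp add: smooth_vec_def smooth_on_const)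

lemma smooth_gvecI:
  assumes "smooth_vec A X" "\<And>c. c \<in> A \<Longrightarrow> smooth_on (snd c ` fst c) (covec_in_chart A c \<sigma>)"
  shows "smooth_gvec A (\<lambda>q. (X q, \<sigma> q))"
  unfolding smooth_gvec_def
proof
  fix c assume c: "c \<in> A"
  have "smooth_on (snd c ` fst c) (\<lambda>x. (vec_in_chart A c X x, covec_in_chart A c \<sigma> x))"
    using assms c by (intro smooth_on_Pair) (auto simp: smooth_vec_def)
  then show "smooth_on (snd c ` fst c) (gvec_in_chart A c (\<lambda>q. (X q, \<sigma> q)))"
    by (simp add: gvec_in_chart_def[abs_def] comp_def)
qed

lemma smooth_gvec_vec: "smooth_vec A X \<Longrightarrow> smooth_gvec A (\<lambda>q. (X q, 0))"
  by (rule smooth_gvecI) (auto intro!: smooth_on_const)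

lemma smooth_covec_bilin:
  fixes w :: "'m \<Rightarrow> 'e \<Rightarrow>\<^sub>L 'e cotan"
  assumes "smooth_bilin A w" "smooth_vec A Y" "c \<in> A"
  shows "smooth_on (snd c ` fst c) (covec_in_chart A c (\<lambda>q. w q (Y q)))"
proof -
  have "smooth_on (snd c ` fst c) (\<lambda>x. bilin_in_chart A c w x (vec_in_chart A c Y x))"
    using assms by (intro smooth_on_blinfun_apply) (auto simp: smooth_bilin_def smooth_vec_def)
  then show ?thesis
    by (rule smooth_on_cong[OF open_chart(2)[OF assms(3)], rotated])
      (simp add: covec_in_chart_bilin assms(3))
qed

lemma smooth_gvec_bilin:
  fixes w :: "'m \<Rightarrow> 'e \<Rightarrow>\<^sub>L 'e cotan"
  shows "smooth_bilin A w \<Longrightarrow> smooth_vec A X \<Longrightarrow> smooth_vec A Y \<Longrightarrow> smooth_gvec A (\<lambda>q. (X q, w q (Y q)))"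
  by (intro smooth_gvecI smooth_covec_bilin)

text \<open>Changing charts adds to each of the two terms of the bracket a second derivative of the
  transition map; by symmetry the two contributions cancel. This makes brackets at neighbouring
  points comparable, although each is defined in its own preferred chart.\<close>

lemma to_chart_lie_bracket:
  assumes "smooth_vec A X" "smooth_vec A Y" "c \<in> A" "q \<in> fst c"
  defines "x \<equiv> snd c q" and "X' \<equiv> vec_in_chart A c X" and "Y' \<equiv> vec_in_chart A c Y"
  shows "to_chart A c q (lie_bracket A X Y q)
    = frechet_derivative Y' (at x) (X' x) - frechet_derivative X' (at x) (Y' x)"
proof -
  define c0 where "c0 = chart_at A q"
  define x0 where "x0 = snd c0 q"
  have c0: "c0 \<in> A" "q \<in> fst c0" by (simp_all add: c0_def chart_at)
  define \<psi> where "\<psi> = trans_map c0 c"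
  define S where "S = overlap c0 c"
  have S: "open S" "x0 \<in> S"
    using c0 assms(3,4) by (auto simp: S_def x0_def intro: overlapI)
  have \<psi>x0: "\<psi> x0 = x" using c0 by (simp add: \<psi>_def trans_map_def x0_def x_def)
  define D where "D y = coord_change c0 c (chart_inv c0 y)" for y
  have D_smooth: "smooth_on S D"
    unfolding D_def S_def by (rule smooth_coord_change[OF c0(1) assms(3)])
  have D: "(\<psi> has_derivative D y) (at y)" if "y \<in> S" for y
  proof -
    obtain p where "p \<in> fst c0" "p \<in> fst c" "y = snd c0 p"
      using \<open>y \<in> S\<close> by (auto simp: S_def overlap_def)
    then show ?thesis
      using coord_change_derivative[OF c0(1) assms(3)] c0(1) by (simp add: \<psi>_def D_def)
  qed
  define D2 where "D2 = frechet_derivative D (at x0)"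
  have D2: "(D has_derivative D2) (at x0)"
    unfolding D2_def by (rule smooth_on_has_derivative[OF D_smooth S(2)])
  have sym: "D2 u v = D2 v u" for u v
    by (rule symmetric_second_derivative[OF S D D2])
  \<comment> \<open>Obtained by differentiating the transformation law of a field in two ways: as a
    composite with the transition map, and by the product rule.\<close>
  have field: "D2 h (vec_in_chart A c0 Z x0)
      + D x0 (frechet_derivative (vec_in_chart A c0 Z) (at x0) h)
      = frechet_derivative (vec_in_chart A c Z) (at x) (D x0 h)"
    and vec: "vec_in_chart A c Z x = D x0 (vec_in_chart A c0 Z x0)"
    if Z: "smooth_vec A Z" for Z h
  proof -
    have change: "vec_in_chart A c Z (\<psi> y) = D y (vec_in_chart A c0 Z y)" if "y \<in> S" for y
      using vec_in_chart_change[OF c0(1) assms(3)] that by (simp add: \<psi>_def D_def S_def)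
    show "vec_in_chart A c Z x = D x0 (vec_in_chart A c0 Z x0)"
      using change[OF S(2)] by (simp add: \<psi>x0)
    have dZ: "(vec_in_chart A c' Z has_derivative frechet_derivative (vec_in_chart A c' Z) (at (snd c' q)))
        (at (snd c' q))" if "c' \<in> A" "q \<in> fst c'" for c'
      using Z that unfolding smooth_vec_def by (intro smooth_on_has_derivative[of "snd c' ` fst c'"]) auto
    have "((\<lambda>y. vec_in_chart A c Z (\<psi> y)) has_derivative
        (\<lambda>h. frechet_derivative (vec_in_chart A c Z) (at x) (D x0 h))) (at x0)"
      using dZ[OF assms(3,4)] by (intro has_derivative_compose[OF D[OF S(2)]]) (simp add: \<psi>x0 x_def)
    then have 1: "((\<lambda>y. D y (vec_in_chart A c0 Z y)) has_derivative
        (\<lambda>h. frechet_derivative (vec_in_chart A c Z) (at x) (D x0 h))) (at x0)"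
      by (rule has_derivative_transform_within_open[OF _ S]) (simp add: change)
    have 2: "((\<lambda>y. D y (vec_in_chart A c0 Z y)) has_derivative
        (\<lambda>h. D x0 (frechet_derivative (vec_in_chart A c0 Z) (at x0) h)
          + D2 h (vec_in_chart A c0 Z x0))) (at x0)"
      using dZ[OF c0] unfolding x0_def[symmetric]
      by (rule bounded_bilinear.FDERIV[OF bounded_bilinear_blinfun_apply D2])
    show "D2 h (vec_in_chart A c0 Z x0) + D x0 (frechet_derivative (vec_in_chart A c0 Z) (at x0) h)
        = frechet_derivative (vec_in_chart A c Z) (at x) (D x0 h)"
      using fun_cong[OF has_derivative_unique[OF 1 2], of h] by (simp add: add.commute)
  qed
  have "to_chart A c q (lie_bracket A X Y q) = D x0 (lie_bracket A X Y q)"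
    using c0 by (simp add: D_def x0_def to_chart_def c0_def[symmetric])
  also have "\<dots> = D x0 (frechet_derivative (vec_in_chart A c0 Y) (at x0) (vec_in_chart A c0 X x0))
      - D x0 (frechet_derivative (vec_in_chart A c0 X) (at x0) (vec_in_chart A c0 Y x0))"
    by (simp add: lie_bracket_def Let_def c0_def[symmetric] x0_def[symmetric] blinfun.diff_right)
  also have "\<dots> = frechet_derivative Y' (at x) (X' x) - frechet_derivative X' (at x) (Y' x)"
    unfolding X'_def Y'_def vec[OF assms(1)] vec[OF assms(2)]
      field[OF assms(1), symmetric] field[OF assms(2), symmetric]
    by (simp add: sym[of "vec_in_chart A c0 X x0"])
  finally show ?thesis .
qed

text \<open>The explicit formula for \<open>X\<close> is part of the conclusion so that pointwise
  linear conditions on \<xi>, such as an eigenvalue equation, pass to the extension.\<close>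

lemma extend_field:
  assumes c: "c \<in> A" and V: "open V" "V \<subseteq> snd c ` fst c" and \<xi>: "smooth_on V \<xi>" and "x0 \<in> V"
  obtains \<phi> X where "smooth_vec A X" "\<phi> x0 = 1" "(\<phi> has_derivative (\<lambda>_. 0)) (at x0)"
    "\<And>q. X q = (if q \<in> fst c \<and> snd c q \<in> V
      then \<phi> (snd c q) *\<^sub>R from_chart A c q (\<xi> (snd c q)) else 0)"
proof -
  obtain r where r: "r > 0" "cball x0 r \<subseteq> V"
    using open_contains_cball_eq[OF V(1)] \<open>x0 \<in> V\<close> by blast
  obtain \<phi> :: "'e \<Rightarrow> real" where \<phi>: "smooth_on UNIV \<phi>" "\<phi> x0 = 1"
    "(\<phi> has_derivative (\<lambda>_. 0)) (at x0)" "\<And>x. x \<notin> ball x0 r \<Longrightarrow> \<phi> x = 0"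
    using bump_function[OF r(1)] by blast
  define X where "X q = (if q \<in> fst c \<and> snd c q \<in> V
      then \<phi> (snd c q) *\<^sub>R from_chart A c q (\<xi> (snd c q)) else 0)" for q
  define K where "K = chart_inv c ` cball x0 r"
  \<comment> \<open>Compact sets in a Hausdorff space are closed, so the complement of
    \<open>K\<close> is an open set on which the field vanishes. Together with the chart region over
    \<open>V\<close> it covers the manifold.\<close>
  have "compact K"
    unfolding K_def using r V
    by (intro compact_continuous_image continuous_on_subset[OF chart_inv_continuous[OF c]]) auto
  then have "closed K" by (rule compact_imp_closed)
  have "smooth_on (snd c' ` fst c') (vec_in_chart A c' X)" if c': "c' \<in> A" for c'
  proof (rule smooth_on_local)
    fix y assume y: "y \<in> snd c' ` fst c'"
    show "\<exists>T. open T \<and> y \<in> T \<and> smooth_on T (vec_in_chart A c' X)"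
    proof (cases "chart_inv c' y \<in> fst c \<and> snd c (chart_inv c' y) \<in> V")
      case True
      define T where "T = overlap c' c \<inter> trans_map c' c -` V"
      define S where "S = overlap c c' \<inter> V"
      have "open T"
        unfolding T_def
        by (intro continuous_open_preimage smooth_on_imp_continuous_on smooth_trans_map open_overlap c c' V)
      have "open S" unfolding S_def by (intro open_Int open_overlap c c' V)
      have "y \<in> T"
        using True y c' by (simp add: T_def overlap_eq trans_map_def)
      have "smooth_on S (\<lambda>x. coord_change c c' (chart_inv c x) (\<phi> x *\<^sub>R \<xi> x))"
        by (intro smooth_on_blinfun_apply smooth_on_scaleR \<open>open S\<close>
            smooth_on_subset[OF smooth_coord_change[OF c c']] smooth_on_subset[OF \<phi>(1)]
            smooth_on_subset[OF \<xi>]) (auto simp: S_def)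
      moreover have "smooth_on T (trans_map c' c)"
        using smooth_trans_map[OF c' c] by (rule smooth_on_subset) (simp add: T_def)
      moreover have "trans_map c' c ` T \<subseteq> S"
        using trans_map_image[OF c' c] by (auto simp: T_def S_def)
      ultimately have "smooth_on T (\<lambda>y. coord_change c c' (chart_inv c (trans_map c' c y))
          (\<phi> (trans_map c' c y) *\<^sub>R \<xi> (trans_map c' c y)))"
        using smooth_on_compose[OF \<open>open T\<close> \<open>open S\<close>] by blast
      then have "smooth_on T (vec_in_chart A c' X)"
      proof (rule smooth_on_cong[OF \<open>open T\<close>, rotated])
        fix z assume "z \<in> T"
        then obtain q where q: "q \<in> fst c" "q \<in> fst c'" "z = snd c' q" "snd c q \<in> V"
          using c' by (auto simp: T_def overlap_def trans_map_def)
        then show "coord_change c c' (chart_inv c (trans_map c' c z))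
            (\<phi> (trans_map c' c z) *\<^sub>R \<xi> (trans_map c' c z)) = vec_in_chart A c' X z"
          using c c' by (simp add: vec_in_chart_apply X_def trans_map_def to_from_chart_change
              blinfun.scaleR_right)
      qed
      then show ?thesis using \<open>open T\<close> \<open>y \<in> T\<close> by blast
    next
      case False
      define T where "T = snd c' ` fst c' \<inter> chart_inv c' -` (- K)"
      have "open T"
        unfolding T_def using \<open>closed K\<close> by (intro open_chart_inv_vimage c') (simp add: open_Compl)
      have "chart_inv c' y \<notin> K"
      proof
        assume "chart_inv c' y \<in> K"
        then obtain x where x: "x \<in> cball x0 r" "chart_inv c' y = chart_inv c x"
          unfolding K_def by blast
        then have "x \<in> V" "x \<in> snd c ` fst c" using r V by auto
        with False x c show False by auto
      qed
      then have "y \<in> T" using y by (simp add: T_def)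
      have "vec_in_chart A c' X z = 0" if "z \<in> T" for z
      proof -
        have "X q = 0" if "q \<notin> K" for q
        proof (cases "q \<in> fst c")
          case True
          then have "snd c q \<notin> cball x0 r"
            using that c unfolding K_def by (metis chart_inv_chart imageI)
          then show ?thesis using \<phi>(4)[of "snd c q"] by (simp add: X_def)
        qed (simp add: X_def)
        then show ?thesis using that by (simp add: T_def vec_in_chart_apply)
      qed
      then have "smooth_on T (vec_in_chart A c' X)"
        by (intro smooth_on_cong[OF \<open>open T\<close> _ smooth_on_const[OF \<open>open T\<close>, of 0]]) simp
      then show ?thesis using \<open>open T\<close> \<open>y \<in> T\<close> by blast
    qed
  qed
  then have "smooth_vec A X" by (simp add: smooth_vec_def)
  then show ?thesis
    using that \<phi>(2,3) X_def by blast
qed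

lemma extended_field_in_chart:
  assumes "c \<in> A" "V \<subseteq> snd c ` fst c" "x \<in> V"
    and "\<And>q. X q = (if q \<in> fst c \<and> snd c q \<in> V
      then \<phi> (snd c q) *\<^sub>R from_chart A c q (\<xi> (snd c q)) else 0)"
  shows "vec_in_chart A c X x = \<phi> x *\<^sub>R \<xi> x"
proof -
  obtain q where "q \<in> fst c" "x = snd c q" using assms by auto
  then show ?thesis
    using assms by (simp add: vec_in_chart_apply blinfun.scaleR_right)
qed

lemma extended_field_derivative:
  assumes "c \<in> A" "open V" "V \<subseteq> snd c ` fst c" "x \<in> V" "(\<xi> has_derivative \<xi>') (at x)"
    and "\<phi> x = 1" "(\<phi> has_derivative (\<lambda>_. 0)) (at x)"
    and "\<And>q. X q = (if q \<in> fst c \<and> snd c q \<in> V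
      then \<phi> (snd c q) *\<^sub>R from_chart A c q (\<xi> (snd c q)) else 0)"
  shows "(vec_in_chart A c X has_derivative \<xi>') (at x)"
proof -
  have "((\<lambda>x. \<phi> x *\<^sub>R \<xi> x) has_derivative (\<lambda>h. \<phi> x *\<^sub>R \<xi>' h + 0 *\<^sub>R \<xi> x)) (at x)"
    by (rule has_derivative_scaleR[OF assms(7,5)])
  then have "((\<lambda>x. \<phi> x *\<^sub>R \<xi> x) has_derivative \<xi>') (at x)"
    by (simp add: assms(6))
  then show ?thesis
    by (rule has_derivative_transform_within_open[OF _ assms(2,4)])
      (rule extended_field_in_chart[OF assms(1,3) _ assms(8), symmetric])
qed


section \<open>Integrability of eigendistributions\<close>

lemma endo_in_chart_apply:
  "c \<in> A \<Longrightarrow> q \<in> fst c \<Longrightarrow>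
    endo_in_chart A c s (snd c q) v = to_chart A c q (s q (from_chart A c q v))"
  by (simp add: endo_in_chart_def)

text \<open>The hypothesis \<open>closed\<close> concerns global fields, the Frobenius argument
  local ones in the chart at p. Each instance of local involutivity is reduced to a global one by
  extending both fields from a neighbourhood of the point in question.\<close>

lemma eigendistribution_integrable:
  fixes s :: "'m \<Rightarrow> 'e \<Rightarrow>\<^sub>L 'e"
  assumes smooth: "smooth_endo A s" and square: "\<And>q u. s q (s q u) = u"
    and \<epsilon>: "\<epsilon> * \<epsilon> = 1"
    and closed: "\<And>X Y q. smooth_vec A X \<Longrightarrow> smooth_vec A Y \<Longrightarrow>
      (\<And>q. s q (X q) = \<epsilon> *\<^sub>R X q) \<Longrightarrow> (\<And>q. s q (Y q) = \<epsilon> *\<^sub>R Y q) \<Longrightarrow>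
      s q (lie_bracket A X Y q) = \<epsilon> *\<^sub>R lie_bracket A X Y q"
  shows "integrable_distribution A (\<lambda>p. {u. s p u = \<epsilon> *\<^sub>R u})"
  unfolding integrable_distribution_def
proof
  fix p
  define c where "c = chart_at A p"
  have c: "c \<in> A" "p \<in> fst c" by (simp_all add: c_def chart_at)
  define V where "V = snd c ` fst c"
  have "open V" "snd c p \<in> V" using c by (simp_all add: V_def)
  define sc where "sc = endo_in_chart A c s"
  have sc: "sc (snd c q) v = to_chart A c q (s q (from_chart A c q v))" if "q \<in> fst c" for q v
    using endo_in_chart_apply[OF c(1) that] by (simp add: sc_def)
  have sc_sc: "sc x (sc x v) = v" if "x \<in> V" for x v
    using that c(1) by (auto simp: V_def sc square)
  have sc_eigen: "s q (from_chart A c q v) = \<epsilon> *\<^sub>R from_chart A c q v \<longleftrightarrow> sc (snd c q) v = \<epsilon> *\<^sub>R v"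
    if "q \<in> fst c" for q v
    using from_to_chart[OF c(1) that, of "s q (from_chart A c q v)"] to_from_chart[OF c(1) that]
    by (metis blinfun.scaleR_right sc[OF that])
  \<comment> \<open>As \<epsilon>^2 = 1, this is the projection onto the \<epsilon>-eigenspace along
    the other one. It treats both signs at once and has whatever rank occurs.\<close>
  define P where "P x = (1 / 2) *\<^sub>R (id_blinfun + \<epsilon> *\<^sub>R sc x)" for x
  have P: "P x v = (1 / 2) *\<^sub>R (v + \<epsilon> *\<^sub>R sc x v)" for x v
    by (simp add: P_def blinfun.bilinear_simps)
  have P_eigen: "P x v = v \<longleftrightarrow> sc x v = \<epsilon> *\<^sub>R v" for x v
  proof
    assume "P x v = v"
    moreover have "v + \<epsilon> *\<^sub>R sc x v = 2 *\<^sub>R P x v" by (simp add: P)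
    ultimately have "v + \<epsilon> *\<^sub>R sc x v = v + v" by (simp add: scaleR_2)
    then have "\<epsilon> *\<^sub>R (\<epsilon> *\<^sub>R sc x v) = \<epsilon> *\<^sub>R v" by simp
    then show "sc x v = \<epsilon> *\<^sub>R v" by (simp add: \<epsilon>)
  next
    assume "sc x v = \<epsilon> *\<^sub>R v"
    then show "P x v = v"
      by (simp add: P \<epsilon> flip: scaleR_2)
  qed
  have "smooth_on V sc"
    using smooth c(1) by (simp add: smooth_endo_def V_def sc_def)
  then have P_smooth: "smooth_on V P"
    unfolding P_def
    by (intro smooth_on_linear[OF _ bounded_linear_scaleR_right] smooth_on_add smooth_on_const \<open>open V\<close>)
  have P_proj: "P x (P x v) = P x v" if "x \<in> V" for x v
    unfolding P_eigen unfolding P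
    by (simp add: blinfun.bilinear_simps sc_sc[OF that] scaleR_add_right \<epsilon> add.commute)
  have involutive: "P z (frechet_derivative \<zeta> (at z) (\<xi> z) - frechet_derivative \<xi> (at z) (\<zeta> z))
      = frechet_derivative \<zeta> (at z) (\<xi> z) - frechet_derivative \<xi> (at z) (\<zeta> z)"
    if T: "open T" "T \<subseteq> V" and \<xi>: "smooth_on T \<xi>" and \<zeta>: "smooth_on T \<zeta>"
      and P\<xi>: "\<And>x. x \<in> T \<Longrightarrow> P x (\<xi> x) = \<xi> x" and P\<zeta>: "\<And>x. x \<in> T \<Longrightarrow> P x (\<zeta> x) = \<zeta> x"
      and z: "z \<in> T" for T \<xi> \<zeta> z
  proof -
    define q where "q = chart_inv c z"
    have T': "T \<subseteq> snd c ` fst c" using T(2) by (simp add: V_def)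
    have q: "q \<in> fst c" "snd c q = z"
      using z T' c(1) by (auto simp: q_def)
    obtain \<phi> X where X: "smooth_vec A X" "\<phi> z = 1" "(\<phi> has_derivative (\<lambda>_. 0)) (at z)"
      "\<And>q. X q = (if q \<in> fst c \<and> snd c q \<in> T
        then \<phi> (snd c q) *\<^sub>R from_chart A c q (\<xi> (snd c q)) else 0)"
      using extend_field[OF c(1) T(1) T' \<xi> z] by blast
    obtain \<psi> Y where Y: "smooth_vec A Y" "\<psi> z = 1" "(\<psi> has_derivative (\<lambda>_. 0)) (at z)"
      "\<And>q. Y q = (if q \<in> fst c \<and> snd c q \<in> T
        then \<psi> (snd c q) *\<^sub>R from_chart A c q (\<zeta> (snd c q)) else 0)"
      using extend_field[OF c(1) T(1) T' \<zeta> z] by blast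
    \<comment> \<open>Scaling by the cutoff and extending by 0 both preserve the eigenvalue
      equation.\<close>
    have sX: "s q (X q) = \<epsilon> *\<^sub>R X q" for q
    proof (cases "q \<in> fst c \<and> snd c q \<in> T")
      case True
      then have "s q (from_chart A c q (\<xi> (snd c q))) = \<epsilon> *\<^sub>R from_chart A c q (\<xi> (snd c q))"
        using P\<xi> by (simp add: sc_eigen flip: P_eigen)
      with True show ?thesis by (simp add: X(4) blinfun.scaleR_right)
    qed (auto simp: X(4))
    have sY: "s q (Y q) = \<epsilon> *\<^sub>R Y q" for q
    proof (cases "q \<in> fst c \<and> snd c q \<in> T")
      case True
      then have "s q (from_chart A c q (\<zeta> (snd c q))) = \<epsilon> *\<^sub>R from_chart A c q (\<zeta> (snd c q))"
        using P\<zeta> by (simp add: sc_eigen flip: P_eigen)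
      with True show ?thesis by (simp add: Y(4) blinfun.scaleR_right)
    qed (auto simp: Y(4))
    have dX: "frechet_derivative (vec_in_chart A c X) (at z) = frechet_derivative \<xi> (at z)"
      by (rule frechet_derivative_eq[OF extended_field_derivative[OF c(1) T(1) T' z
            smooth_on_has_derivative[OF \<xi> z] X(2,3,4)]])
    have dY: "frechet_derivative (vec_in_chart A c Y) (at z) = frechet_derivative \<zeta> (at z)"
      by (rule frechet_derivative_eq[OF extended_field_derivative[OF c(1) T(1) T' z
            smooth_on_has_derivative[OF \<zeta> z] Y(2,3,4)]])
    have Xz: "vec_in_chart A c X z = \<xi> z"
      using extended_field_in_chart[OF c(1) T' z X(4)] X(2) by simp
    have Yz: "vec_in_chart A c Y z = \<zeta> z"
      using extended_field_in_chart[OF c(1) T' z Y(4)] Y(2) by simp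
    \<comment> \<open>The point q need not have \<open>c\<close> as its preferred chart, so chart
      independence of the bracket is essential.\<close>
    have b: "to_chart A c q (lie_bracket A X Y q)
        = frechet_derivative \<zeta> (at z) (\<xi> z) - frechet_derivative \<xi> (at z) (\<zeta> z)"
      using to_chart_lie_bracket[OF X(1) Y(1) c(1) q(1)] unfolding q(2) dX dY Xz Yz .
    have "s q (lie_bracket A X Y q) = \<epsilon> *\<^sub>R lie_bracket A X Y q"
      by (rule closed[OF X(1) Y(1) sX sY])
    then have "sc z (to_chart A c q (lie_bracket A X Y q)) = \<epsilon> *\<^sub>R to_chart A c q (lie_bracket A X Y q)"
      using sc[OF q(1)] by (simp add: q(2) c(1) q(1) blinfun.scaleR_right)
    then show ?thesis
      unfolding b P_eigen .
  qed
  have "\<exists>W U (f :: 'e \<Rightarrow> 'e) f'. subspace W \<and> open U \<and> 0 \<in> U \<and> smooth_on U f \<and> f 0 = snd c p \<and> f ` U \<subseteq> V \<and>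
    (\<forall>x\<in>U. (f has_derivative f' x) (at x) \<and> inj_on (f' x) W \<and> f' x ` W = {v. P (f x) v = v})"
    by (rule frobenius_projection[OF \<open>open V\<close> \<open>snd c p \<in> V\<close> P_smooth], erule P_proj)
      (rule involutive; (assumption | blast))
  then obtain W U and f :: "'e \<Rightarrow> 'e" and f' where Wf: "subspace W \<and> open U \<and> 0 \<in> U \<and> smooth_on U f \<and>
      f 0 = snd c p \<and> f ` U \<subseteq> V \<and>
      (\<forall>x\<in>U. (f has_derivative f' x) (at x) \<and> inj_on (f' x) W \<and> f' x ` W = {v. P (f x) v = v})"
    by (elim exE) (rule that)
  then have W: "subspace W" and U: "open U" "0 \<in> U" and f: "smooth_on U f" "f 0 = snd c p" "f ` U \<subseteq> V"
    and df: "\<And>x. x \<in> U \<Longrightarrow> (f has_derivative f' x) (at x)"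
    and inj: "\<And>x. x \<in> U \<Longrightarrow> inj_on (f' x) W"
    and im: "\<And>x. x \<in> U \<Longrightarrow> f' x ` W = {v. P (f x) v = v}"
    by blast+
  define F where "F x = chart_inv c (f x)" for x
  have F: "F x \<in> fst c" "snd c (F x) = f x" if "x \<in> U" for x
    using that f(3) c(1) by (auto simp: F_def V_def)
  \<comment> \<open>\<open>map_deriv\<close> uses the preferred chart at the image point, which may
    jump along \<open>F\<close>; at each single x it differs from the derivative in \<open>c\<close>
    by an isomorphism.\<close>
  have deriv: "map_deriv A F x v = from_chart A c (F x) (f' x v)" if x: "x \<in> U" for x v
  proof -
    let ?c = "chart_at A (F x)"
    have "(trans_map c ?c has_derivative coord_change c ?c (F x)) (at (f x))"
      using coord_change_derivative[OF c(1) chart_at(1) F(1)[OF x] chart_at(2)] by (simp add: F(2)[OF x])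
    from has_derivative_compose[OF df[OF x] this]
    have "((snd ?c \<circ> F) has_derivative (\<lambda>v. coord_change c ?c (F x) (f' x v))) (at x)"
      by (simp add: trans_map_def F_def comp_def)
    from frechet_derivative_eq[OF this]
    show ?thesis by (simp add: map_deriv_def from_chart_def)
  qed
  have "smooth_into A U F"
    unfolding smooth_into_def
  proof (intro conjI ballI)
    have contf: "continuous_on U f" by (rule smooth_on_imp_continuous_on[OF f(1)])
    show "continuous_on U F"
      unfolding F_def[abs_def]
      using f(3) by (intro continuous_on_compose2[OF chart_inv_continuous[OF c(1)] contf]) (simp add: V_def)
    fix c' assume c': "c' \<in> A"
    have eq: "U \<inter> F -` fst c' = U \<inter> f -` overlap c c'"
      using f(3) by (auto simp: overlap_eq[OF c(1)] F_def V_def)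
    have "open (U \<inter> F -` fst c')"
      unfolding eq by (intro continuous_open_preimage contf U open_overlap c c')
    then have "smooth_on (U \<inter> F -` fst c') (\<lambda>x. trans_map c c' (f x))"
      by (rule smooth_on_compose[OF _ open_overlap[OF c(1) c'] smooth_on_subset[OF f(1)]
            smooth_trans_map[OF c(1) c']]) (auto simp: eq)
    then show "smooth_on (U \<inter> F -` fst c') (snd c' \<circ> F)"
      by (simp add: trans_map_def F_def comp_def)
  qed
  moreover have "F 0 = p" using c by (simp add: F_def f(2))
  moreover have "inj_on (map_deriv A F x) W \<and> map_deriv A F x ` W = {u. s (F x) u = \<epsilon> *\<^sub>R u}"
    if x: "x \<in> U \<inter> W" for x
  proof
    have x: "x \<in> U" using x by simp
    note Fx = c(1) F(1)[OF x]
    show "inj_on (map_deriv A F x) W"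
    proof (rule inj_onI)
      fix v w assume vw: "v \<in> W" "w \<in> W" "map_deriv A F x v = map_deriv A F x w"
      then have "f' x v = f' x w"
        using to_from_chart[OF Fx] by (metis deriv[OF x])
      then show "v = w" using inj_onD[OF inj[OF x]] vw by blast
    qed
    have "map_deriv A F x ` W = from_chart A c (F x) ` {v. P (f x) v = v}"
      unfolding im[OF x, symmetric] by (simp add: deriv[OF x] image_image)
    also have "\<dots> = {u. s (F x) u = \<epsilon> *\<^sub>R u}"
    proof (intro equalityI subsetI)
      fix u assume "u \<in> from_chart A c (F x) ` {v. P (f x) v = v}"
      then show "u \<in> {u. s (F x) u = \<epsilon> *\<^sub>R u}"
        using sc_eigen[OF F(1)[OF x]] by (auto simp: P_eigen F(2)[OF x])
    next
      fix u assume "u \<in> {u. s (F x) u = \<epsilon> *\<^sub>R u}"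
      then have "P (f x) (to_chart A c (F x) u) = to_chart A c (F x) u"
        unfolding P_eigen F(2)[OF x, symmetric]
        using sc_eigen[OF F(1)[OF x], of "to_chart A c (F x) u"] by (simp add: Fx)
      then show "u \<in> from_chart A c (F x) ` {v. P (f x) v = v}"
        by (intro image_eqI[of _ _ "to_chart A c (F x) u"]) (simp_all add: Fx)
    qed
    finally show "map_deriv A F x ` W = {u. s (F x) u = \<epsilon> *\<^sub>R u}" .
  qed
  ultimately show "\<exists>W U f. subspace W \<and> open U \<and> 0 \<in> U \<and> smooth_into A U f \<and> f 0 = p \<and>
      (\<forall>x\<in>U \<inter> W. inj_on (map_deriv A f x) W \<and> map_deriv A f x ` W = {u. s (f x) u = \<epsilon> *\<^sub>R u})"
    using W U by blast
qed


section \<open>Closedness of a two-form from the Courant bracket\<close>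

text \<open>With vanishing first derivatives in coordinates, every term that differentiates a field
  drops out of the Lie and Courant brackets at p.\<close>

lemma constant_jet_field:
  obtains X where "smooth_vec A X" "vec_in_chart A (chart_at A p) X (snd (chart_at A p) p) = v"
    "(vec_in_chart A (chart_at A p) X has_derivative (\<lambda>_. 0)) (at (snd (chart_at A p) p))"
proof -
  let ?c = "chart_at A p"
  let ?V = "snd ?c ` fst ?c" and ?x = "snd ?c p"
  have c: "?c \<in> A" and V: "open ?V" "?V \<subseteq> snd ?c ` fst ?c" and x: "?x \<in> ?V"
    using chart_at[of p] by simp_all
  obtain \<phi> X where X: "smooth_vec A X" "\<phi> ?x = 1" "(\<phi> has_derivative (\<lambda>_. 0)) (at ?x)"
    "\<And>q. X q = (if q \<in> fst ?c \<and> snd ?c q \<in> ?V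
      then \<phi> (snd ?c q) *\<^sub>R from_chart A ?c q ((\<lambda>_. v) (snd ?c q)) else 0)"
    by (rule extend_field[OF c V smooth_on_const[OF V(1)] x]) blast
  show ?thesis
  proof (rule that[OF X(1)])
    show "vec_in_chart A ?c X ?x = v"
      using extended_field_in_chart[OF c V(2) x X(4)] X(2) by simp
    show "(vec_in_chart A ?c X has_derivative (\<lambda>_. 0)) (at ?x)"
      by (rule extended_field_derivative[OF c V x has_derivative_const X(2,3,4)])
  qed
qed

lemma lie_derivative_zero [simp]: "lie_derivative A (\<lambda>_. 0) (\<lambda>_. 0) p = 0"
  by (rule blinfun_eqI) (simp add: lie_derivative_def Let_def frechet_derivative_const)

lemma lie_bracket_zero [simp]: "lie_bracket A (\<lambda>_. 0) (\<lambda>_. 0) p = 0"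
  by (simp add: lie_bracket_def Let_def frechet_derivative_const)

text \<open>For fields with constant first jet the Lie derivatives give D u v and D v u, where D is
  the derivative of w in coordinates; by antisymmetry the differential with its factor 1/2 supplies
  the third term of d w. The first form is one Courant bracket, for the real case. In the second the
  pairing is split over two brackets, as happens for the imaginary part in the complex case.\<close>

lemma ext_deriv2_eq_courant:
  fixes w :: "'m \<Rightarrow> 'e \<Rightarrow>\<^sub>L 'e cotan"
  assumes smooth: "smooth_bilin A w" and anti: "\<And>q u v. w q u v = - w q v u"
  obtains X Y where "smooth_vec A X" "smooth_vec A Y" "lie_bracket A X Y p = 0"
    "ext_deriv2 A w p u v = blinfun_apply (lie_derivative A X (\<lambda>q. w q (Y q)) p
      - lie_derivative A Y (\<lambda>q. w q (X q)) p
      - (1/2) *\<^sub>R differential A (\<lambda>q. w q (Y q) (X q) - w q (X q) (Y q)) p)"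
    "ext_deriv2 A w p u v = blinfun_apply (lie_derivative A X (\<lambda>q. w q (Y q)) p
      - (1/2) *\<^sub>R differential A (\<lambda>q. w q (Y q) (X q)) p
      + (- lie_derivative A Y (\<lambda>q. w q (X q)) p
      - (1/2) *\<^sub>R differential A (\<lambda>q. - w q (X q) (Y q)) p))"
proof -
  define c where "c = chart_at A p"
  define x where "x = snd c p"
  have c: "c \<in> A" "p \<in> fst c" by (simp_all add: c_def chart_at)
  define b where "b = bilin_in_chart A c w"
  have x: "x \<in> snd c ` fst c" using c by (simp add: x_def)
  define D where "D = frechet_derivative b (at x)"
  have "smooth_on (snd c ` fst c) b"
    using smooth c(1) by (simp add: smooth_bilin_def b_def)
  then have D: "(b has_derivative D) (at x)"
    unfolding D_def by (rule smooth_on_has_derivative[OF _ x])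
  have b: "b (snd c q) u v = w q (from_chart A c q u) (from_chart A c q v)" if "q \<in> fst c" for q u v
    using that c(1) by (simp add: b_def bilin_in_chart_def)
  have D2: "((\<lambda>y. b y u v) has_derivative (\<lambda>h. D h u v)) (at x)" for u v
    by (intro bounded_linear.has_derivative[OF blinfun.bounded_linear_left] D)
  \<comment> \<open>Antisymmetry holds identically near x, hence survives differentiation.\<close>
  have D_anti: "D h u v = - D h v u" for h u v
  proof -
    have "((\<lambda>y. - b y v u) has_derivative (\<lambda>h. - D h v u)) (at x)"
      by (intro has_derivative_minus D2)
    then have "((\<lambda>y. b y u v) has_derivative (\<lambda>h. - D h v u)) (at x)"
      by (rule has_derivative_transform_within_open[OF _ open_chart(2)[OF c(1)] x])
        (auto simp: b anti[of _ "from_chart A c _ u"])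
    from has_derivative_unique[OF D2 this] show ?thesis by (simp add: fun_eq_iff)
  qed
  have lie_der: "lie_derivative A X (\<lambda>q. w q (Y q)) p = D v u"
    if X: "vec_in_chart A c X x = v" "(vec_in_chart A c X has_derivative (\<lambda>_. 0)) (at x)"
      and Y: "vec_in_chart A c Y x = u" "(vec_in_chart A c Y has_derivative (\<lambda>_. 0)) (at x)"
    for X Y u v
  proof -
    have "((\<lambda>y. b y (vec_in_chart A c Y y)) has_derivative
        (\<lambda>h. b x 0 + D h (vec_in_chart A c Y x))) (at x)"
      by (rule bounded_bilinear.FDERIV[OF bounded_bilinear_blinfun_apply D Y(2)])
    then have "((\<lambda>y. b y (vec_in_chart A c Y y)) has_derivative (\<lambda>h. D h u)) (at x)"
      by (simp add: Y(1) blinfun.zero_right)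
    then have "(covec_in_chart A c (\<lambda>q. w q (Y q)) has_derivative (\<lambda>h. D h u)) (at x)"
      by (rule has_derivative_transform_within_open[OF _ open_chart(2)[OF c(1)] x])
        (simp add: covec_in_chart_bilin[OF c(1)] b_def)
    from frechet_derivative_eq[OF this] frechet_derivative_eq[OF X(2)]
    show ?thesis
      by (intro blinfun_eqI) (simp add: lie_derivative_def Let_def X(1) blinfun.bilinear_simps
          zero_blinfun.abs_eq[symmetric] flip: c_def x_def)
  qed
  have diff: "differential A f p z = D' z"
    if f: "\<And>q. q \<in> fst c \<Longrightarrow> f q = h (snd c q)" "(h has_derivative D') (at x)" for f h D' z
  proof -
    have "((f \<circ> chart_inv c) has_derivative D') (at x)"
      by (rule has_derivative_transform_within_open[OF f(2) open_chart(2)[OF c(1)] x])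
        (use c(1) f(1) in auto)
    from frechet_derivative_eq[OF this] has_derivative_bounded_linear[OF this]
    show ?thesis
      by (simp add: differential_def Let_def bounded_linear_Blinfun_apply flip: c_def x_def)
  qed
  obtain X where X: "smooth_vec A X" "vec_in_chart A c X x = u"
    "(vec_in_chart A c X has_derivative (\<lambda>_. 0)) (at x)"
    unfolding c_def x_def by (rule constant_jet_field)
  obtain Y where Y: "smooth_vec A Y" "vec_in_chart A c Y x = v"
    "(vec_in_chart A c Y has_derivative (\<lambda>_. 0)) (at x)"
    unfolding c_def x_def by (rule constant_jet_field)
  have wYX: "w q (Y q) (X q) = b (snd c q) (vec_in_chart A c Y (snd c q)) (vec_in_chart A c X (snd c q))"
    and wXY: "w q (X q) (Y q) = b (snd c q) (vec_in_chart A c X (snd c q)) (vec_in_chart A c Y (snd c q))"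
    if "q \<in> fst c" for q
    using that c(1) by (simp_all add: b vec_in_chart_apply)
  have dYX: "((\<lambda>y. b y (vec_in_chart A c Y y) (vec_in_chart A c X y)) has_derivative (\<lambda>h. D h v u)) (at x)"
    and dXY: "((\<lambda>y. b y (vec_in_chart A c X y) (vec_in_chart A c Y y)) has_derivative (\<lambda>h. D h u v)) (at x)"
    using bounded_bilinear.FDERIV[OF bounded_bilinear_blinfun_apply
        bounded_bilinear.FDERIV[OF bounded_bilinear_blinfun_apply D Y(3)] X(3)]
      bounded_bilinear.FDERIV[OF bounded_bilinear_blinfun_apply
        bounded_bilinear.FDERIV[OF bounded_bilinear_blinfun_apply D X(3)] Y(3)]
    by (simp_all add: X(2) Y(2) blinfun.zero_right)
  have ext_eq: "ext_deriv2 A w p u v z = D u v z - D v u z + D z u v" for z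
    by (simp add: ext_deriv2_def Let_def D_def b_def c_def x_def)
  show ?thesis
  proof (rule that[OF X(1) Y(1)])
    show "lie_bracket A X Y p = 0"
      using frechet_derivative_eq[OF X(3)] frechet_derivative_eq[OF Y(3)]
      by (simp add: lie_bracket_def Let_def flip: c_def x_def)
    note lie = lie_der[OF X(2,3) Y(2,3)] lie_der[OF Y(2,3) X(2,3)]
    have 1: "differential A (\<lambda>q. w q (Y q) (X q) - w q (X q) (Y q)) p z = D z v u - D z u v" for z
      by (rule diff[OF _ has_derivative_diff[OF dYX dXY]]) (simp add: wYX wXY)
    have 2: "differential A (\<lambda>q. w q (Y q) (X q)) p z = D z v u" for z
      by (rule diff[OF _ dYX]) (simp add: wYX)
    have 3: "differential A (\<lambda>q. - w q (X q) (Y q)) p z = - D z u v" for z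
      by (rule diff[OF _ has_derivative_minus[OF dXY]]) (simp add: wXY)
    show "ext_deriv2 A w p u v = blinfun_apply (lie_derivative A X (\<lambda>q. w q (Y q)) p
      - lie_derivative A Y (\<lambda>q. w q (X q)) p
      - (1/2) *\<^sub>R differential A (\<lambda>q. w q (Y q) (X q) - w q (X q) (Y q)) p)"
      unfolding lie by (rule ext) (simp add: ext_eq blinfun.bilinear_simps 1 D_anti[of _ v u])
    show "ext_deriv2 A w p u v = blinfun_apply (lie_derivative A X (\<lambda>q. w q (Y q)) p
      - (1/2) *\<^sub>R differential A (\<lambda>q. w q (Y q) (X q)) p
      + (- lie_derivative A Y (\<lambda>q. w q (X q)) p
      - (1/2) *\<^sub>R differential A (\<lambda>q. - w q (X q) (Y q)) p))"
      unfolding lie by (rule ext) (simp add: ext_eq blinfun.bilinear_simps 2 3 D_anti[of _ v u])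
  qed
qed

end

section \<open>Block structures\<close>

lemma bounded_linear_block_extract:
  fixes i :: "'c::real_normed_vector \<Rightarrow>\<^sub>L 'a::real_normed_vector"
  shows "bounded_linear (\<lambda>B. fst_blinfun o\<^sub>L B o\<^sub>L i)"
  by (intro bounded_linear_compose[OF bounded_bilinear.bounded_linear_left[OF
        bounded_bilinear_blinfun_compose] bounded_bilinear.bounded_linear_right[OF
        bounded_bilinear_blinfun_compose]])

text \<open>Extracting an entry is a bounded linear operation on operators. The upper row serves
  both structures: \<open>s\<close> on the diagonal and \<open>p\<close> off it. A map from
  covectors to vectors transforms by \<open>to_chart\<close> on both sides, once dualised.\<close>

lemma smooth_block_entries:
  assumes "smooth_atlas A" "smooth_gendo A (\<lambda>q. block (a q) (b q) (d q) (f q))" "c \<in> A"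
  shows "smooth_on (snd c ` fst c) (endo_in_chart A c a)"
    and "smooth_on (snd c ` fst c) (\<lambda>x. let q = chart_inv c x in
      to_chart A c q o\<^sub>L b q o\<^sub>L dual_map (to_chart A c q))"
proof -
  interpret manifold A by standard (rule assms(1))
  define inl :: "'b \<Rightarrow>\<^sub>L 'b gtan" where "inl = Blinfun (\<lambda>u. (u, 0))"
  define inr :: "'b cotan \<Rightarrow>\<^sub>L 'b gtan" where "inr = Blinfun (\<lambda>\<sigma>. (0, \<sigma>))"
  have inl: "inl u = (u, 0)" for u
    unfolding inl_def by (simp add: bounded_linear_Blinfun_apply bounded_linear_Pair
        bounded_linear_ident bounded_linear_zero)
  have inr: "inr \<sigma> = (0, \<sigma>)" for \<sigma>
    unfolding inr_def by (simp add: bounded_linear_Blinfun_apply bounded_linear_Pair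
        bounded_linear_ident bounded_linear_zero)
  let ?S = "\<lambda>q. block (a q) (b q) (d q) (f q)"
  have S: "smooth_on (snd c ` fst c) (gendo_in_chart A c ?S)"
    using assms(2,3) by (simp add: smooth_gendo_def)
  have "(\<lambda>x. fst_blinfun o\<^sub>L gendo_in_chart A c ?S x o\<^sub>L inl) = endo_in_chart A c a"
    by (intro ext blinfun_eqI) (simp add: gendo_in_chart_def endo_in_chart_def Let_def inl
        blinfun.zero_right blinfun.zero_left)
  then show "smooth_on (snd c ` fst c) (endo_in_chart A c a)"
    using smooth_on_linear[OF open_chart(2)[OF assms(3)] bounded_linear_block_extract S, of inl] by simp
  have "(\<lambda>x. fst_blinfun o\<^sub>L gendo_in_chart A c ?S x o\<^sub>L inr)
      = (\<lambda>x. let q = chart_inv c x in to_chart A c q o\<^sub>L b q o\<^sub>L dual_map (to_chart A c q))"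
    by (intro ext blinfun_eqI) (simp add: gendo_in_chart_def Let_def inr
        blinfun.zero_right blinfun.zero_left)
  then show "smooth_on (snd c ` fst c) (\<lambda>x. let q = chart_inv c x in
      to_chart A c q o\<^sub>L b q o\<^sub>L dual_map (to_chart A c q))"
    using smooth_on_linear[OF open_chart(2)[OF assms(3)] bounded_linear_block_extract S, of inr] by simp
qed

text \<open>Identifying covectors with vectors by the inner product turns f into an injective
  endomorphism of a Euclidean space, which is bijective. Boundedness of the inverse is what makes
  \<open>Blinfun\<close> in \<open>blinfun_inv\<close> meaningful.\<close>

lemma blinfun_inv_nondegenerate:
  fixes f :: "'e::euclidean_space \<Rightarrow>\<^sub>L 'e cotan"
  assumes nondeg: "\<And>u. (\<And>v. f u v = 0) \<Longrightarrow> u = 0"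
  shows "blinfun_inv f (f u) = u" and "f (blinfun_inv f \<sigma>) = \<sigma>"
proof -
  define R where "R \<sigma> = (\<Sum>b\<in>Basis. (\<sigma> b) *\<^sub>R b)" for \<sigma> :: "'e cotan"
  have R_inner: "R \<sigma> \<bullet> b = \<sigma> b" if "b \<in> Basis" for \<sigma> b
    using that by (simp add: R_def inner_sum_left inner_Basis if_distrib sum.delta cong: if_cong)
  have R_inj: "\<sigma> = \<tau>" if "R \<sigma> = R \<tau>" for \<sigma> \<tau>
    by (rule blinfun_euclidean_eqI) (metis R_inner that)
  have R_lin: "bounded_linear R"
    unfolding R_def[abs_def]
    by (intro bounded_linear_sum bounded_linear_scaleR_const blinfun.bounded_linear_left)
  have lin: "bounded_linear (\<lambda>u. R (f u))"
    by (rule bounded_linear_compose[OF R_lin blinfun.bounded_linear_right])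
  have inj_f: "u = v" if "f u = f v" for u v
    using nondeg[of "u - v"] that by (simp add: blinfun.bilinear_simps)
  have "inj (\<lambda>u. R (f u))"
    using R_inj inj_f by (intro injI) blast
  then obtain h where h: "linear h" "h \<circ> (\<lambda>u. R (f u)) = id"
    using linear_injective_left_inverse[OF bounded_linear.linear[OF lin]] by blast
  have h2: "(\<lambda>u. R (f u)) \<circ> h = id"
    using linear_inverse_left[OF h(1) bounded_linear.linear[OF lin]] h(2) by simp
  have 1: "h (R (f u)) = u" for u using h(2) by (simp add: fun_eq_iff)
  have 2: "f (h (R \<sigma>)) = \<sigma>" for \<sigma>
    using h2 by (intro R_inj) (simp add: fun_eq_iff)
  have "inv (blinfun_apply f) = (\<lambda>\<sigma>. h (R \<sigma>))"
    by (rule inv_equality) (simp_all add: 1 2)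
  moreover have "bounded_linear (\<lambda>\<sigma>. h (R \<sigma>))"
    using h(1) by (intro bounded_linear_compose[OF _ R_lin]) (simp add: linear_conv_bounded_linear)
  ultimately have "blinfun_inv f \<sigma> = h (R \<sigma>)" for \<sigma>
    by (simp add: blinfun_inv_def bounded_linear_Blinfun_apply)
  then show "blinfun_inv f (f u) = u" "f (blinfun_inv f \<sigma>) = \<sigma>"
    by (simp_all add: 1 2)
qed

section \<open>Algebraic identities and Courant closure of integrable structures\<close>

lemma integrable_structure_almost:
  assumes "lam \<in> {1, -1}" "integrable_structure A g lam ell S"
  shows "smooth_gendo A S" "S p (S p x) = lam *\<^sub>R x"
    "split_metric (S p x) y = - split_metric x (S p y)"
    "S p (I_op g (- lam * ell) p x) = - I_op g (- lam * ell) p (S p x)"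
proof -
  have "almost_gen_structure A lam S"
    using assms by (auto simp: integrable_structure_def gen_complex_structure_def
        gen_paracomplex_structure_def)
  then show "smooth_gendo A S" "split_metric (S p x) y = - split_metric x (S p y)"
    unfolding almost_gen_structure_def by blast+
  have "S p o\<^sub>L S p = lam *\<^sub>R id_blinfun"
    using \<open>almost_gen_structure A lam S\<close> unfolding almost_gen_structure_def by blast
  from arg_cong[OF this, of "\<lambda>B. blinfun_apply B x"]
  show "S p (S p x) = lam *\<^sub>R x"
    by (simp add: blinfun.scaleR_left)
  have "S p o\<^sub>L I_op g (- lam * ell) p = - (I_op g (- lam * ell) p o\<^sub>L S p)"
    using assms(2) by (simp add: integrable_structure_def)
  from arg_cong[OF this, of "\<lambda>B. blinfun_apply B x"]
  show "S p (I_op g (- lam * ell) p x) = - I_op g (- lam * ell) p (S p x)"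
    by (simp add: blinfun.minus_left)
qed

lemma courant_Pair:
  "courant A (\<lambda>q. (X q, \<sigma> q)) (\<lambda>q. (Y q, \<tau> q)) q = (lie_bracket A X Y q,
    lie_derivative A X \<tau> q - lie_derivative A Y \<sigma> q
      - (1/2) *\<^sub>R differential A (\<lambda>q. \<tau> q (X q) - \<sigma> q (Y q)) q)"
  by (simp add: courant_def comp_def)

lemma courant_cplx_Pair:
  "courant_cplx A (\<lambda>q. (a q, b q)) (\<lambda>q. (a' q, b' q)) q
    = (courant A a a' q - courant A b b' q, courant A a b' q + courant A b a' q)"
  by (simp add: courant_cplx_def comp_def)

lemma gen_paracomplex_courant:
  assumes "integrable_structure A g 1 ell S" "\<epsilon> \<in> {1, -1}" "smooth_gvec A e" "smooth_gvec A e'"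
    and "\<And>q. S q (e q) = \<epsilon> *\<^sub>R e q" "\<And>q. S q (e' q) = \<epsilon> *\<^sub>R e' q"
  shows "S q (courant A e e' q) = \<epsilon> *\<^sub>R courant A e e' q"
proof -
  have "gen_paracomplex_structure A S"
    using assms(1) by (simp add: integrable_structure_def)
  then show ?thesis
    unfolding gen_paracomplex_structure_def using assms(2-) by blast
qed

text \<open>The sections \<open>a + i b\<close> with \<open>S a = b\<close> and \<open>S b = - a\<close> span the eigenbundle for \<open>-i\<close>.\<close>

lemma gen_complex_courant:
  assumes "integrable_structure A g (-1) ell S"
    and "smooth_gvec A a" "smooth_gvec A b" "smooth_gvec A a'" "smooth_gvec A b'"
    and "\<And>q. S q (a q) = b q" "\<And>q. S q (b q) = - a q"
    and "\<And>q. S q (a' q) = b' q" "\<And>q. S q (b' q) = - a' q"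
  shows "S q (courant A a a' q - courant A b b' q) = courant A a b' q + courant A b a' q"
proof -
  have closed: "map_prod (S q) (S q) (courant_cplx A e e' q) = (-1) *\<^sub>R times_i (courant_cplx A e e' q)"
    if "smooth_gvec_cplx A e" "smooth_gvec_cplx A e'"
      "\<And>q. map_prod (S q) (S q) (e q) = (-1) *\<^sub>R times_i (e q)"
      "\<And>q. map_prod (S q) (S q) (e' q) = (-1) *\<^sub>R times_i (e' q)" for e e'
  proof -
    have "gen_complex_structure A S"
      using assms(1) by (simp add: integrable_structure_def)
    then show ?thesis
      unfolding gen_complex_structure_def using that by blast
  qed
  have "map_prod (S q) (S q) (courant_cplx A (\<lambda>q. (a q, b q)) (\<lambda>q. (a' q, b' q)) q)
      = (-1) *\<^sub>R times_i (courant_cplx A (\<lambda>q. (a q, b q)) (\<lambda>q. (a' q, b' q)) q)"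
    by (rule closed) (use assms(2-) in \<open>simp_all add: smooth_gvec_cplx_def comp_def times_i_def\<close>)
  from arg_cong[OF this, of fst] show ?thesis
    by (simp add: courant_cplx_Pair times_i_def)
qed

theorem theorem3p6:
  fixes A :: "('m::{t2_space,second_countable_topology}, 'e::euclidean_space) chart set"
    and g :: "'m \<Rightarrow> 'e \<Rightarrow>\<^sub>L 'e cotan"
    and lam ell :: real
    and s :: "'m \<Rightarrow> 'e \<Rightarrow>\<^sub>L 'e"
    and t :: "'m \<Rightarrow> 'e cotan \<Rightarrow>\<^sub>L 'e cotan"
    and p :: "'m \<Rightarrow> 'e cotan \<Rightarrow>\<^sub>L 'e"
    and \<omega> :: "'m \<Rightarrow> 'e \<Rightarrow>\<^sub>L 'e cotan"
  assumes "smooth_atlas A" and "pseudo_riemannian A g"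
    and "lam \<in> {1, -1}" and "ell \<in> {1, -1}"
    and "smooth_bilin A \<omega>"
    and R: "integrable_structure A g lam ell (\<lambda>x. block (s x) 0 0 (t x))"
    and Q: "integrable_structure A g lam ell (\<lambda>x. block 0 (p x) (\<omega> x) 0)"
  shows "lambda_zero_structure A g lam s \<and> zero_ell_structure A g ell \<omega>"
proof
  interpret manifold A by standard (rule assms(1))
  define k where "k = - lam * ell"
  have kk: "k * k = 1" and k_lam: "- k * lam = ell"
    using assms(3,4) by (auto simp: k_def)
  note R_almost = integrable_structure_almost[OF assms(3) R]
  note Q_almost = integrable_structure_almost[OF assms(3) Q]
  have ginv: "blinfun_inv (g q) (g q u) = u" for q u
  proof (rule blinfun_inv_nondegenerate(1))
    show "u = 0" if "\<And>v. g q u v = 0" for u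
      using assms(2) that unfolding pseudo_riemannian_def nondegenerate_def by blast
  qed

  have s_square: "s q (s q u) = lam *\<^sub>R u" for q u
    using R_almost(2)[where p = q and x = "(u, 0)"] by (simp add: blinfun.zero_right blinfun.zero_left)
  have s_smooth: "smooth_endo A s"
    unfolding smooth_endo_def using smooth_block_entries(1)[OF assms(1) R_almost(1)] by blast
  \<comment> \<open>Skew-symmetry says that \<open>t\<close> is minus the dual of \<open>s\<close>,
    and anticommutation with \<open>I_op\<close> says t g = - g s. The two signs cancel, which
    leaves g-symmetry of \<open>s\<close>.\<close>
  have s_t: "\<tau> (s q u) = - t q \<tau> u" for q u and \<tau> :: "'e cotan"
    using R_almost(3)[where p = q and x = "(u, 0)" and y = "(0, \<tau>)"]
    by (simp add: blinfun.zero_right blinfun.zero_left)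
  have t_g: "t q (g q u) = - g q (s q u)" for q u
    using R_almost(4)[where p = q and x = "(u, 0)"]
    by (simp add: I_op_def blinfun.zero_right blinfun.zero_left)
  have s_sym: "g_symmetric g s"
    by (simp add: g_symmetric_def s_t t_g blinfun.minus_left)

  show "lambda_zero_structure A g lam s"
    unfolding lambda_zero_structure_def
  proof (intro conjI impI)
    assume lam: "lam = 1"
    have "integrable_distribution A (\<lambda>q. {u. s q u = \<epsilon> *\<^sub>R u})" if \<epsilon>: "\<epsilon> \<in> {1, -1}" for \<epsilon>
    proof (rule eigendistribution_integrable[OF s_smooth])
      show "s q (s q u) = u" for q u using s_square lam by simp
      show "\<epsilon> * \<epsilon> = 1" using \<epsilon> by auto
      fix X Y q
      assume X: "smooth_vec A X" "\<And>q. s q (X q) = \<epsilon> *\<^sub>R X q"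
        and Y: "smooth_vec A Y" "\<And>q. s q (Y q) = \<epsilon> *\<^sub>R Y q"
      have "block (s q) 0 0 (t q) (courant A (\<lambda>q. (X q, 0)) (\<lambda>q. (Y q, 0)) q)
          = \<epsilon> *\<^sub>R courant A (\<lambda>q. (X q, 0)) (\<lambda>q. (Y q, 0)) q"
        by (rule gen_paracomplex_courant[OF R[unfolded lam] \<epsilon> smooth_gvec_vec smooth_gvec_vec])
          (simp_all add: X Y blinfun.zero_right blinfun.zero_left)
      then show "s q (lie_bracket A X Y q) = \<epsilon> *\<^sub>R lie_bracket A X Y q"
        by (simp add: courant_Pair blinfun.zero_left)
    qed
    then show "plus_zero_structure A g s"
      unfolding plus_zero_structure_def using s_smooth s_sym s_square lam
      by (auto intro!: blinfun_eqI)
  next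
    assume lam: "lam = - 1"
    have "nijenhuis A s X Y q = 0" if X: "smooth_vec A X" and Y: "smooth_vec A Y" for X Y q
    proof -
      let ?sX = "\<lambda>q. s q (X q)" and ?sY = "\<lambda>q. s q (Y q)"
      \<comment> \<open>As s^2 = -1, every field X yields the section X + i sX of the
        (-i)-eigenbundle, so arbitrary fields can be tested.\<close>
      have "block (s q) 0 0 (t q) (courant A (\<lambda>q. (X q, 0)) (\<lambda>q. (Y q, 0)) q
            - courant A (\<lambda>q. (?sX q, 0)) (\<lambda>q. (?sY q, 0)) q)
          = courant A (\<lambda>q. (X q, 0)) (\<lambda>q. (?sY q, 0)) q
            + courant A (\<lambda>q. (?sX q, 0)) (\<lambda>q. (Y q, 0)) q"
        by (rule gen_complex_courant[OF R[unfolded lam]])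
          (simp_all add: smooth_gvec_vec smooth_vec_endo s_smooth X Y s_square lam
            blinfun.zero_right blinfun.zero_left)
      then have "s q (lie_bracket A X Y q - lie_bracket A ?sX ?sY q)
          = lie_bracket A X ?sY q + lie_bracket A ?sX Y q"
        by (simp add: courant_Pair blinfun.zero_left)
      \<comment> \<open>One more application of \<open>s\<close> turns the closure condition into
        the vanishing of the Nijenhuis tensor.\<close>
      from arg_cong[OF this, of "s q"]
      have "- (lie_bracket A X Y q - lie_bracket A ?sX ?sY q)
          = s q (lie_bracket A X ?sY q) + s q (lie_bracket A ?sX Y q)"
        by (simp only: s_square lam blinfun.add_right) simp
      then show ?thesis
        by (simp add: nijenhuis_def Let_def algebra_simps)
    qed
    then show "minus_zero_structure A g s"
      unfolding minus_zero_structure_def complex_structure_def using s_smooth s_sym s_square lam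
      by (auto intro!: blinfun_eqI simp: blinfun.minus_left)
  qed

  have p_\<omega>: "p q (\<omega> q u) = lam *\<^sub>R u" for q u
    using Q_almost(2)[where p = q and x = "(u, 0)"] by (simp add: blinfun.zero_right blinfun.zero_left)
  have \<omega>_anti: "\<omega> q u v = - \<omega> q v u" for q u v
    using Q_almost(3)[where p = q and x = "(u, 0)" and y = "(v, 0)"]
    by (simp add: blinfun.zero_right blinfun.zero_left)
  \<comment> \<open>Testing anticommutation on the covector g u cancels the inverse metric in
    \<open>I_op\<close>.\<close>
  have g_p: "g q (p q (g q u)) = - k *\<^sub>R \<omega> q u" for q u
    using Q_almost(4)[where p = q and x = "(0, g q u)"]
    by (simp add: I_op_def blinfun.bilinear_simps ginv k_def)
  have nondeg: "nondegenerate \<omega>"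
    unfolding nondegenerate_def
  proof (intro allI impI)
    fix q u assume "\<forall>v. \<omega> q u v = 0"
    then have "\<omega> q u = 0" by (intro blinfun_eqI) simp
    then show "u = 0"
      using p_\<omega>[of q u] assms(3) by (auto simp: blinfun.zero_right)
  qed
  have \<omega>_closed: "ext_deriv2 A \<omega> q u v z = 0" for q u v z
  proof -
    obtain X Y where X: "smooth_vec A X" and Y: "smooth_vec A Y" and XY: "lie_bracket A X Y q = 0"
      and ext: "ext_deriv2 A \<omega> q u v = blinfun_apply (lie_derivative A X (\<lambda>q. \<omega> q (Y q)) q
        - lie_derivative A Y (\<lambda>q. \<omega> q (X q)) q
        - (1/2) *\<^sub>R differential A (\<lambda>q. \<omega> q (Y q) (X q) - \<omega> q (X q) (Y q)) q)"
      and ext_split: "ext_deriv2 A \<omega> q u v = blinfun_apply (lie_derivative A X (\<lambda>q. \<omega> q (Y q)) q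
        - (1/2) *\<^sub>R differential A (\<lambda>q. \<omega> q (Y q) (X q)) q
        + (- lie_derivative A Y (\<lambda>q. \<omega> q (X q)) q
        - (1/2) *\<^sub>R differential A (\<lambda>q. - \<omega> q (X q) (Y q)) q))"
      by (rule ext_deriv2_eq_courant[OF assms(5) \<omega>_anti, where p = q and u = u and v = v])
    note smooth_sections = smooth_gvec_vec[OF X] smooth_gvec_vec[OF Y]
      smooth_gvec_bilin[OF assms(5)] smooth_vec_zero X Y
    show ?thesis
    proof (cases "lam = 1")
      case True
      let ?C = "courant A (\<lambda>q. (X q, \<omega> q (X q))) (\<lambda>q. (Y q, \<omega> q (Y q))) q"
      \<comment> \<open>The eigenvalue 1 suffices. The lower component says that the covector part
        of \<open>?C\<close> is \<omega> applied to [X,Y], which is 0 at the point.\<close>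
      have "block 0 (p q) (\<omega> q) 0 ?C = 1 *\<^sub>R ?C"
        by (rule gen_paracomplex_courant[OF Q[unfolded True]])
          (simp_all add: smooth_sections p_\<omega> True blinfun.zero_left)
      then show ?thesis
        unfolding ext by (simp add: courant_Pair XY blinfun.zero_right blinfun.zero_left)
    next
      case False
      then have lam: "lam = - 1" using assms(3) by simp
      \<comment> \<open>The sections are X + i \<omega> X and Y + i \<omega> Y. The two mixed
        brackets on the right carry the Lie derivatives and half of the pairing each, which matches
        \<open>ext_split\<close>.\<close>
      have "block 0 (p q) (\<omega> q) 0 (courant A (\<lambda>q. (X q, 0)) (\<lambda>q. (Y q, 0)) q
            - courant A (\<lambda>q. (0, \<omega> q (X q))) (\<lambda>q. (0, \<omega> q (Y q))) q)
          = courant A (\<lambda>q. (X q, 0)) (\<lambda>q. (0, \<omega> q (Y q))) q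
            + courant A (\<lambda>q. (0, \<omega> q (X q))) (\<lambda>q. (Y q, 0)) q"
        by (rule gen_complex_courant[OF Q[unfolded lam]])
          (simp_all add: smooth_sections p_\<omega> lam blinfun.zero_right blinfun.zero_left)
      from arg_cong[OF this, of snd] show ?thesis
        unfolding ext_split by (simp add: courant_Pair XY blinfun.zero_right blinfun.zero_left)
    qed
  qed

  \<comment> \<open>This is g^-1 \<omega>, since g p g = - k \<omega> and k^2 = 1. Writing it with
    \<open>p\<close> makes its smoothness a consequence of that of Q, without inverting the metric
    smoothly.\<close>
  define r where "r q = (- k) *\<^sub>R (p q o\<^sub>L g q)" for q
  have r: "r q u = (- k) *\<^sub>R p q (g q u)" for q u
    by (simp add: r_def blinfun.bilinear_simps)
  have g_r: "g q (r q u) = \<omega> q u" for q u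
    using kk by (simp add: r blinfun.bilinear_simps g_p)
  have r_square: "r q (r q u) = ell *\<^sub>R u" for q u
  proof -
    have "r q (r q u) = (- k) *\<^sub>R p q (g q (r q u))"
      by (rule r)
    then show ?thesis
      \<comment> \<open>The square is - k p \<omega> = - k lam, which equals ell by the choice k = -
        lam ell.\<close>
      by (simp add: g_r p_\<omega> flip: k_lam)
  qed
  have "smooth_endo A r"
    unfolding smooth_endo_def
  proof
    fix c assume c: "c \<in> A"
    let ?p = "\<lambda>x. let q = chart_inv c x in to_chart A c q o\<^sub>L p q o\<^sub>L dual_map (to_chart A c q)"
    have "smooth_on (snd c ` fst c) (bilin_in_chart A c g)"
      using assms(2) c by (simp add: pseudo_riemannian_def smooth_bilin_def)
    then have "smooth_on (snd c ` fst c) (\<lambda>x. (- k) *\<^sub>R (?p x o\<^sub>L bilin_in_chart A c g x))"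
      by (intro smooth_on_linear[OF _ bounded_linear_scaleR_right] smooth_on_blinfun_compose
          smooth_block_entries(2)[OF assms(1) Q_almost(1)] open_chart c)
    then show "smooth_on (snd c ` fst c) (endo_in_chart A c r)"
    proof (rule smooth_on_cong[OF open_chart(2)[OF c], rotated])
      fix x assume "x \<in> snd c ` fst c"
      then obtain q where q: "q \<in> fst c" "x = snd c q" by auto
      \<comment> \<open>Between the local expressions of \<open>p\<close> and \<open>g\<close> the
        two dualised coordinate changes are inverse to each other and cancel.\<close>
      have "dual_map (to_chart A c q) (dual_map (from_chart A c q) \<sigma>) = \<sigma>" for \<sigma>
        by (rule blinfun_eqI) (simp add: c q)
      then show "(- k) *\<^sub>R (?p x o\<^sub>L bilin_in_chart A c g x) = endo_in_chart A c r x"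
        by (intro blinfun_eqI) (simp add: endo_in_chart_def bilin_in_chart_def Let_def r_def c q
            blinfun.bilinear_simps)
    qed
  qed
  moreover have "r q o\<^sub>L r q = ell *\<^sub>R id_blinfun" for q
    by (rule blinfun_eqI) (simp add: r_square blinfun.scaleR_left)
  moreover have "\<omega> q u v = g q (r q u) v" for q u v
    by (simp only: g_r)
  moreover have "symplectic_form A \<omega>"
    unfolding symplectic_form_def using assms(5) \<omega>_anti nondeg \<omega>_closed by blast
  ultimately show "zero_ell_structure A g ell \<omega>"
    unfolding zero_ell_structure_def by blast
qed

end
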